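(* Let $G$ be a Polish group and $\mathfrak{a}\in \mathfrak{B}_G$ a chief block of $G$. Then every representative $A/B\in\mathfrak{a}$ is of the same type: weak, semisimple, or stacking. (That is, if one representative of $\mathfrak{a}$ is of weak, respectively semisimple, respectively stacking type, then every representative of $\mathfrak a$ is of that type.)
   Context: A Polish group is a topological group whose topology is separable and completely metrizable; quotients of Polish groups by closed normal subgroups and closed subgroups of Polish groups are Polish. Chief blocks of a topological group $G$. A normal factor of $G$ is a quotient $K/L$ with $L<K$ distinct closed normal subgroups of $G$; it is a chief factor if no closed normal subgroup of $G$ lies strictly between $L$ and $K$. Normal factors $K_1/L_1$, $K_2/L_2$ are associated if $\overline{K_1L_2} = \overline{K_2L_1}$, $K_1 \cap \overline{L_1L_2} = L_1$ and $K_2 \cap \overline{L_1L_2} = L_2$; this is an equivalence relation on non-abelian chief factors. A chief block of $G$ is an association class $[K/L]$ of non-abelian chief factors, whose elements are called its representatives; $\mathfrak{B}_G$ is the set of chief blocks. For $\mathfrak{a}=[K/L]\in\mathfrak{B}_G$ put $\mathrm{C}_G(\mathfrak{a}) := \{g\in G\mid [g,k]\in L\ \forall k\in K\}$; this does not depend on the representative. Order $\mathfrak{B}_G$ by $\mathfrak{a}\leq\mathfrak{b}$ iff $\mathrm{C}_G(\mathfrak{a})\leq \mathrm{C}_G(\mathfrak{b})$. A closed normal subgroup $N$ of $G$ covers $\mathfrak{a}$ if $N\not\leq \mathrm{C}_G(\mathfrak{a})$. The block $\mathfrak{a}$ is minimally covered if there is a smallest closed normal subgroup of $G$ covering $\mathfrak{a}$;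 $\mathfrak{B}_G^{\min}$ is the set of minimally covered blocks. The group $\mathrm{Aut}(G)$ of topological group automorphisms acts on $\mathfrak{B}_G$ by $\psi.[K/L]=[\psi(K)/\psi(L)]$. Types. Let $Q$ be a non-trivial topologically characteristically simple topological group (no proper non-trivial closed $\mathrm{Aut}(Q)$-invariant subgroup); every chief factor of a topological group is such a group. $Q$ is of weak type if $\mathfrak{B}_Q^{\min}=\emptyset$. $Q$ is of stacking type if $\mathfrak{B}_Q^{\min}\neq\emptyset$ and for all $\mathfrak{c},\mathfrak{d}\in\mathfrak{B}_Q^{\min}$ there exists $\psi\in\mathrm{Aut}(Q)$ with $\psi.\mathfrak{c}<\mathfrak{d}$. $Q$ is of semisimple type if it is topologically generated by its components, where a component of $Q$ is a closed subgroup $M$ such that, with $\overline{\langle\langle M\rangle\rangle_Q}$ denoting the smallest closed normal subgroup of $Q$ containing $M$: (a) $M$ is normal in $\overline{\langle\langle M\rangle\rangle_Q}$; (b) $M/\mathrm{Z}(M)$ is non-abelian; (c) every proper closed normal subgroup of $M$ is central in $\overline{\langle\langle M\rangle\rangle_Q}$. *)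

theory Defs
  imports "HOL-Analysis.Analysis" "HOL-Algebra.Generated_Groups"
begin

text \<open>Removed because it clashes with the topological infix \<^const>\<open>closure_of\<close>.\<close>

no_notation eq_closure_of (\<open>closure'_of\<index>\<close>)

section \<open>Topological groups and their quotients\<close>

locale topological_group = group G for G (structure) and T :: "'a topology" +
  assumes topspace_eq: "topspace T = carrier G"
    and continuous_mult: "continuous_map (prod_topology T T) T (\<lambda>(x, y). x \<otimes> y)"
    and continuous_inv: "continuous_map T T (\<lambda>x. inv x)"

locale polish_group = topological_group +
  assumes completely_metrizable: "completely_metrizable_space T"
    and separable: "separable_space T"

definition closed_subgroup ::
    "('a, 'b) monoid_scheme \<Rightarrow> 'a topology \<Rightarrow> 'a set \<Rightarrow> bool" where
  "closed_subgroup G T H \<longleftrightarrow> subgroup H G \<and> closedin T H"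

definition closed_normal_subgroup ::
    "('a, 'b) monoid_scheme \<Rightarrow> 'a topology \<Rightarrow> 'a set \<Rightarrow> bool" where
  "closed_normal_subgroup G T N \<longleftrightarrow> N \<lhd> G \<and> closedin T N"

definition quotient_topology :: "'a topology \<Rightarrow> ('a \<Rightarrow> 'b) \<Rightarrow> 'b topology" where
  "quotient_topology T q =
    topology (\<lambda>U. U \<subseteq> q ` topspace T \<and> openin T {x \<in> topspace T. q x \<in> U})"

lemma openin_quotient_topology:
  "openin (quotient_topology T q) U \<longleftrightarrow>
    U \<subseteq> q ` topspace T \<and> openin T {x \<in> topspace T. q x \<in> U}"
proof -
  have Int: "{x \<in> topspace T. q x \<in> S \<inter> U} =
      {x \<in> topspace T. q x \<in> S} \<inter> {x \<in> topspace T. q x \<in> U}" for S U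
    by auto
  have Union: "{x \<in> topspace T. q x \<in> \<Union>\<K>} =
      \<Union>((\<lambda>K. {x \<in> topspace T. q x \<in> K}) ` \<K>)" for \<K>
    by auto
  have "istopology (\<lambda>U. U \<subseteq> q ` topspace T \<and> openin T {x \<in> topspace T. q x \<in> U})"
    unfolding istopology_def Int Union
    by (intro conjI allI impI openin_Int openin_Union) auto
  from topology_inverse'[OF this] show ?thesis
    unfolding quotient_topology_def by (rule fun_cong)
qed

lemma topspace_quotient_topology: "topspace (quotient_topology T q) = q ` topspace T"
proof
  show "topspace (quotient_topology T q) \<subseteq> q ` topspace T"
    using openin_topspace[of "quotient_topology T q"]
    unfolding openin_quotient_topology by (rule conjunct1)
  have "{x \<in> topspace T. q x \<in> q ` topspace T} = topspace T"
    by auto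
  then have "openin (quotient_topology T q) (q ` topspace T)"
    unfolding openin_quotient_topology by simp
  then show "q ` topspace T \<subseteq> topspace (quotient_topology T q)"
    by (rule openin_subset)
qed

lemma quotient_map_quotient_topology: "quotient_map T (quotient_topology T q) q"
  unfolding quotient_map_def topspace_quotient_topology openin_quotient_topology by simp

definition factor_group :: "('a, 'b) monoid_scheme \<Rightarrow> 'a set \<Rightarrow> 'a set \<Rightarrow> 'a set monoid" where
  "factor_group G K L = (G\<lparr>carrier := K\<rparr>) Mod L"

definition factor_topology ::
    "('a, 'b) monoid_scheme \<Rightarrow> 'a topology \<Rightarrow> 'a set \<Rightarrow> 'a set \<Rightarrow> 'a set topology" where
  "factor_topology G T K L = quotient_topology (subtopology T K) (\<lambda>x. L #>\<^bsub>G\<^esub> x)"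

definition top_aut :: "('a, 'b) monoid_scheme \<Rightarrow> 'a topology \<Rightarrow> ('a \<Rightarrow> 'a) set" where
  "top_aut G T = {\<psi> \<in> iso G G. homeomorphic_map T T \<psi>}"


section \<open>Chief factors and chief blocks\<close>

text \<open>A normal factor \<open>K / L\<close> of \<open>G\<close> is encoded as the pair \<open>(K, L)\<close>.\<close>

definition normal_factor ::
    "('a, 'b) monoid_scheme \<Rightarrow> 'a topology \<Rightarrow> 'a set \<times> 'a set \<Rightarrow> bool" where
  "normal_factor G T = (\<lambda>(K, L).
    closed_normal_subgroup G T K \<and> closed_normal_subgroup G T L \<and> L \<subset> K)"

definition chief_factor ::
    "('a, 'b) monoid_scheme \<Rightarrow> 'a topology \<Rightarrow> 'a set \<times> 'a set \<Rightarrow> bool" where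
  "chief_factor G T = (\<lambda>(K, L). normal_factor G T (K, L) \<and>
    \<not> (\<exists>N. closed_normal_subgroup G T N \<and> L \<subset> N \<and> N \<subset> K))"

definition nonabelian_chief_factors ::
    "('a, 'b) monoid_scheme \<Rightarrow> 'a topology \<Rightarrow> ('a set \<times> 'a set) set" where
  "nonabelian_chief_factors G T =
    {(K, L). chief_factor G T (K, L) \<and> \<not> comm_group (factor_group G K L)}"

definition associated ::
    "('a, 'b) monoid_scheme \<Rightarrow> 'a topology \<Rightarrow> 'a set \<times> 'a set \<Rightarrow> 'a set \<times> 'a set \<Rightarrow> bool" where
  "associated G T = (\<lambda>(K1, L1) (K2, L2).
    T closure_of (K1 <#>\<^bsub>G\<^esub> L2) = T closure_of (K2 <#>\<^bsub>G\<^esub> L1) \<and>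
    K1 \<inter> T closure_of (L1 <#>\<^bsub>G\<^esub> L2) = L1 \<and>
    K2 \<inter> T closure_of (L1 <#>\<^bsub>G\<^esub> L2) = L2)"

definition association ::
    "('a, 'b) monoid_scheme \<Rightarrow> 'a topology \<Rightarrow> (('a set \<times> 'a set) \<times> ('a set \<times> 'a set)) set" where
  "association G T = {(F1, F2). F1 \<in> nonabelian_chief_factors G T \<and>
    F2 \<in> nonabelian_chief_factors G T \<and> associated G T F1 F2}"

definition chief_blocks ::
    "('a, 'b) monoid_scheme \<Rightarrow> 'a topology \<Rightarrow> ('a set \<times> 'a set) set set" where
  "chief_blocks G T = nonabelian_chief_factors G T // association G T"

definition factor_centralizer ::
    "('a, 'b) monoid_scheme \<Rightarrow> 'a set \<times> 'a set \<Rightarrow> 'a set" where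
  "factor_centralizer G = (\<lambda>(K, L). {g \<in> carrier G.
    \<forall>k\<in>K. g \<otimes>\<^bsub>G\<^esub> k \<otimes>\<^bsub>G\<^esub> inv\<^bsub>G\<^esub> g \<otimes>\<^bsub>G\<^esub> inv\<^bsub>G\<^esub> k \<in> L})"

text \<open>All representatives of a block have the same centralizer; \<^const>\<open>the_elem\<close> picks
  this common value.\<close>

definition block_centralizer ::
    "('a, 'b) monoid_scheme \<Rightarrow> ('a set \<times> 'a set) set \<Rightarrow> 'a set" where
  "block_centralizer G \<aa> = the_elem (factor_centralizer G ` \<aa>)"

definition block_le ::
    "('a, 'b) monoid_scheme \<Rightarrow> ('a set \<times> 'a set) set \<Rightarrow> ('a set \<times> 'a set) set \<Rightarrow> bool" where
  "block_le G \<aa> \<bb> \<longleftrightarrow> block_centralizer G \<aa> \<subseteq> block_centralizer G \<bb>"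

definition block_less ::
    "('a, 'b) monoid_scheme \<Rightarrow> ('a set \<times> 'a set) set \<Rightarrow> ('a set \<times> 'a set) set \<Rightarrow> bool" where
  "block_less G \<aa> \<bb> \<longleftrightarrow> block_le G \<aa> \<bb> \<and> \<not> block_le G \<bb> \<aa>"

definition covers ::
    "('a, 'b) monoid_scheme \<Rightarrow> 'a set \<Rightarrow> ('a set \<times> 'a set) set \<Rightarrow> bool" where
  "covers G N \<aa> \<longleftrightarrow> \<not> N \<subseteq> block_centralizer G \<aa>"

definition minimally_covered ::
    "('a, 'b) monoid_scheme \<Rightarrow> 'a topology \<Rightarrow> ('a set \<times> 'a set) set \<Rightarrow> bool" where
  "minimally_covered G T \<aa> \<longleftrightarrow>
    (\<exists>N. closed_normal_subgroup G T N \<and> covers G N \<aa> \<and>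
      (\<forall>N'. closed_normal_subgroup G T N' \<and> covers G N' \<aa> \<longrightarrow> N \<subseteq> N'))"

definition min_chief_blocks ::
    "('a, 'b) monoid_scheme \<Rightarrow> 'a topology \<Rightarrow> ('a set \<times> 'a set) set set" where
  "min_chief_blocks G T = {\<aa> \<in> chief_blocks G T. minimally_covered G T \<aa>}"

text \<open>The association class of \<open>\<psi>(K) / \<psi>(L)\<close>, where \<open>K / L\<close> runs through the
  representatives of \<open>\<aa>\<close>; for \<open>\<psi>\<close> in \<^const>\<open>top_aut\<close> all of these classes coincide.\<close>

definition block_action ::
    "('a, 'b) monoid_scheme \<Rightarrow> 'a topology \<Rightarrow> ('a \<Rightarrow> 'a) \<Rightarrow>
      ('a set \<times> 'a set) set \<Rightarrow> ('a set \<times> 'a set) set" where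
  "block_action G T \<psi> \<aa> = association G T `` ((\<lambda>(K, L). (\<psi> ` K, \<psi> ` L)) ` \<aa>)"


section \<open>Types of topologically characteristically simple groups\<close>

definition top_char_simple :: "('a, 'b) monoid_scheme \<Rightarrow> 'a topology \<Rightarrow> bool" where
  "top_char_simple Q T \<longleftrightarrow> topological_group Q T \<and> carrier Q \<noteq> {\<one>\<^bsub>Q\<^esub>} \<and>
    (\<forall>H. closed_subgroup Q T H \<and> (\<forall>\<psi>\<in>top_aut Q T. \<psi> ` H = H) \<longrightarrow>
      H = {\<one>\<^bsub>Q\<^esub>} \<or> H = carrier Q)"

definition weak_type :: "('a, 'b) monoid_scheme \<Rightarrow> 'a topology \<Rightarrow> bool" where
  "weak_type Q T \<longleftrightarrow> top_char_simple Q T \<and> min_chief_blocks Q T = {}"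

definition stacking_type :: "('a, 'b) monoid_scheme \<Rightarrow> 'a topology \<Rightarrow> bool" where
  "stacking_type Q T \<longleftrightarrow> top_char_simple Q T \<and> min_chief_blocks Q T \<noteq> {} \<and>
    (\<forall>\<cc>\<in>min_chief_blocks Q T. \<forall>\<dd>\<in>min_chief_blocks Q T.
      \<exists>\<psi>\<in>top_aut Q T. block_less Q (block_action Q T \<psi> \<cc>) \<dd>)"

definition center :: "('a, 'b) monoid_scheme \<Rightarrow> 'a set" where
  "center G = {z \<in> carrier G. \<forall>g\<in>carrier G. z \<otimes>\<^bsub>G\<^esub> g = g \<otimes>\<^bsub>G\<^esub> z}"

definition closed_normal_closure ::
    "('a, 'b) monoid_scheme \<Rightarrow> 'a topology \<Rightarrow> 'a set \<Rightarrow> 'a set" where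
  "closed_normal_closure Q T M = \<Inter>{N. closed_normal_subgroup Q T N \<and> M \<subseteq> N}"

definition component_of_group ::
    "('a, 'b) monoid_scheme \<Rightarrow> 'a topology \<Rightarrow> 'a set \<Rightarrow> bool" where
  "component_of_group Q T M \<longleftrightarrow> closed_subgroup Q T M \<and>
    M \<lhd> Q\<lparr>carrier := closed_normal_closure Q T M\<rparr> \<and>
    \<not> comm_group ((Q\<lparr>carrier := M\<rparr>) Mod center (Q\<lparr>carrier := M\<rparr>)) \<and>
    (\<forall>H. closed_normal_subgroup (Q\<lparr>carrier := M\<rparr>) (subtopology T M) H \<and> H \<noteq> M \<longrightarrow>
      H \<subseteq> center (Q\<lparr>carrier := closed_normal_closure Q T M\<rparr>))"

definition semisimple_type :: "('a, 'b) monoid_scheme \<Rightarrow> 'a topology \<Rightarrow> bool" where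
  "semisimple_type Q T \<longleftrightarrow> top_char_simple Q T \<and>
    T closure_of (generate Q (\<Union>{M. component_of_group Q T M})) = carrier Q"

end

theory Submission
  imports Defs
begin

text \<open>Let \<open>A / B\<close> be a representative of \<open>\<aa>\<close>, let \<open>C\<close> be its centralizer and let \<open>M\<close> be the
  closure of \<open>A C\<close>. Both \<open>C\<close> and \<open>M\<close> depend on the block only: associated factors have the same
  centralizer, and \<open>A\<close> lies in the closure of \<open>A' B\<close>, where \<open>B \<le> C\<close>
  (\<open>chief_block_representatives\<close>). So it is enough to read the type of \<open>A / B\<close> off the pair
  \<open>(M, C)\<close>, and this is what lemma \<open>type_iff\<close> does.

  The invariant that makes this possible lives in the poset of the closed subgroups \<open>P\<close> with
  \<open>B \<le> P \<le> A\<close> that \<open>A\<close> normalizes. Say that \<open>N\<close> has the non-abelian head \<open>N / N0\<close> if \<open>N0\<close> is the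
  largest proper member of this poset below \<open>N\<close> and \<open>N / N0\<close> is not abelian. In a topologically
  characteristically simple group, where the poset consists of the closed normal subgroups, the
  minimally covered blocks are exactly the classes of non-abelian heads, and one obtains:
  the group is of weak type if there is no non-abelian head, of semisimple type if there is one with
  \<open>N0\<close> trivial, and of stacking type if there are non-abelian heads, but none with \<open>N0\<close> trivial
  (\<open>weak_iff\<close>, \<open>semisimple_iff\<close>, \<open>stacking_iff\<close>). In these three criteria the automorphism group of
  the factor, which may change with the representative, no longer occurs.

  It remains to move heads between \<open>(A, B)\<close> and \<open>(M, C)\<close>. Since \<open>C\<close> acts trivially on \<open>A / B\<close> and
  normalizers of closed subgroups are closed, every \<open>P\<close> in the poset of \<open>(A, B)\<close> is normalized by the
  whole of \<open>M\<close>. Sending \<open>P\<close> to the closure of \<open>P C\<close> and \<open>R\<close> to \<open>R \<inter> A\<close> are not inverse to each other,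
  but the discrepancy is central: \<open>A\<close> commutes with the closure of \<open>P C\<close> modulo \<open>P\<close>. A non-abelian head
  is not affected by central errors, hence heads correspond (\<open>head_lift\<close>, \<open>head_restrict\<close>).
  Heads over \<open>B\<close> and heads over \<open>C\<close> correspond as well; this uses that the conjugates of such an
  \<open>N\<close> in \<open>G\<close> commute modulo \<open>B\<close> and that \<open>A / B\<close> is chief (\<open>head_lift_minimal\<close>).\<close>

section \<open>Commutators\<close>

definition commutator :: "('a, 'b) monoid_scheme \<Rightarrow> 'a \<Rightarrow> 'a \<Rightarrow> 'a" where
  "commutator G x y = x \<otimes>\<^bsub>G\<^esub> y \<otimes>\<^bsub>G\<^esub> inv\<^bsub>G\<^esub> x \<otimes>\<^bsub>G\<^esub> inv\<^bsub>G\<^esub> y"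

definition conjugation :: "('a, 'b) monoid_scheme \<Rightarrow> 'a \<Rightarrow> 'a \<Rightarrow> 'a" where
  "conjugation G g x = g \<otimes>\<^bsub>G\<^esub> x \<otimes>\<^bsub>G\<^esub> inv\<^bsub>G\<^esub> g"

definition invariant_under :: "('a, 'b) monoid_scheme \<Rightarrow> 'a set \<Rightarrow> 'a set \<Rightarrow> bool" where
  "invariant_under G J X \<longleftrightarrow> (\<forall>g\<in>J. \<forall>x\<in>X. conjugation G g x \<in> X)"

definition commutators_in :: "('a, 'b) monoid_scheme \<Rightarrow> 'a set \<Rightarrow> 'a set \<Rightarrow> 'a set \<Rightarrow> bool" where
  "commutators_in G X Y Z \<longleftrightarrow> (\<forall>x\<in>X. \<forall>y\<in>Y. commutator G x y \<in> Z)"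

definition centralizer_mod :: "('a, 'b) monoid_scheme \<Rightarrow> 'a set \<Rightarrow> 'a set \<Rightarrow> 'a set \<Rightarrow> 'a set" where
  "centralizer_mod G X Y Z = {x \<in> X. \<forall>y\<in>Y. commutator G x y \<in> Z}"

lemma invariant_underD: "\<lbrakk>invariant_under G J X; g \<in> J; x \<in> X\<rbrakk> \<Longrightarrow> conjugation G g x \<in> X"
  by (simp add: invariant_under_def)

lemma commutators_inD: "\<lbrakk>commutators_in G X Y Z; x \<in> X; y \<in> Y\<rbrakk> \<Longrightarrow> commutator G x y \<in> Z"
  by (simp add: commutators_in_def)

lemma commutators_in_mono:
  "\<lbrakk>commutators_in G X Y Z; X' \<subseteq> X; Y' \<subseteq> Y; Z \<subseteq> Z'\<rbrakk> \<Longrightarrow> commutators_in G X' Y' Z'"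
  unfolding commutators_in_def by blast

lemma subset_centralizer_mod_iff:
  "P \<subseteq> X \<Longrightarrow> P \<subseteq> centralizer_mod G X Y Z \<longleftrightarrow> commutators_in G P Y Z"
  by (auto simp: centralizer_mod_def commutators_in_def)

lemma invariant_under_Int:
  "\<lbrakk>invariant_under G J X; invariant_under G J Y\<rbrakk> \<Longrightarrow> invariant_under G J (X \<inter> Y)"
  by (auto simp: invariant_under_def)

lemma invariant_under_mono: "\<lbrakk>invariant_under G J X; J' \<subseteq> J\<rbrakk> \<Longrightarrow> invariant_under G J' X"
  by (auto simp: invariant_under_def)

context group
begin

lemma inv_mult_cancel [simp]: "\<lbrakk>x \<in> carrier G; y \<in> carrier G\<rbrakk> \<Longrightarrow> inv x \<otimes> (x \<otimes> y) = y"
  by (simp add: m_assoc[symmetric])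

lemma mult_inv_cancel [simp]: "\<lbrakk>x \<in> carrier G; y \<in> carrier G\<rbrakk> \<Longrightarrow> x \<otimes> (inv x \<otimes> y) = y"
  by (simp add: m_assoc[symmetric])

lemma commutator_closed [simp]: "\<lbrakk>x \<in> carrier G; y \<in> carrier G\<rbrakk> \<Longrightarrow> commutator G x y \<in> carrier G"
  by (simp add: commutator_def)

lemma conjugation_closed [simp]: "\<lbrakk>x \<in> carrier G; y \<in> carrier G\<rbrakk> \<Longrightarrow> conjugation G x y \<in> carrier G"
  by (simp add: conjugation_def)

lemma commutator_mult_left:
  "\<lbrakk>g \<in> carrier G; h \<in> carrier G; x \<in> carrier G\<rbrakk> \<Longrightarrow>
    commutator G (g \<otimes> h) x = conjugation G g (commutator G h x) \<otimes> commutator G g x"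
  by (simp add: commutator_def conjugation_def m_assoc inv_mult_group)

lemma commutator_mult_right:
  "\<lbrakk>g \<in> carrier G; h \<in> carrier G; x \<in> carrier G\<rbrakk> \<Longrightarrow>
    commutator G x (g \<otimes> h) = commutator G x g \<otimes> conjugation G g (commutator G x h)"
  by (simp add: commutator_def conjugation_def m_assoc inv_mult_group)

lemma commutator_inv_left:
  "\<lbrakk>g \<in> carrier G; x \<in> carrier G\<rbrakk> \<Longrightarrow> commutator G (inv g) x = conjugation G (inv g) (inv (commutator G g x))"
  by (simp add: commutator_def conjugation_def m_assoc inv_mult_group)

lemma inv_commutator: "\<lbrakk>g \<in> carrier G; x \<in> carrier G\<rbrakk> \<Longrightarrow> inv (commutator G g x) = commutator G x g"
  by (simp add: commutator_def m_assoc inv_mult_group)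

lemma conjugation_commutator:
  "\<lbrakk>g \<in> carrier G; x \<in> carrier G; y \<in> carrier G\<rbrakk> \<Longrightarrow>
    conjugation G g (commutator G x y) = commutator G (conjugation G g x) (conjugation G g y)"
  by (simp add: commutator_def conjugation_def m_assoc inv_mult_group)

lemma conjugation_conjugation:
  "\<lbrakk>g \<in> carrier G; h \<in> carrier G; x \<in> carrier G\<rbrakk> \<Longrightarrow> conjugation G g (conjugation G h x) = conjugation G (g \<otimes> h) x"
  by (simp add: conjugation_def m_assoc inv_mult_group)

lemma conjugation_one [simp]: "x \<in> carrier G \<Longrightarrow> conjugation G \<one> x = x"
  by (simp add: conjugation_def)

lemma conjugation_mult:
  "\<lbrakk>g \<in> carrier G; x \<in> carrier G; y \<in> carrier G\<rbrakk> \<Longrightarrow> conjugation G g (x \<otimes> y) = conjugation G g x \<otimes> conjugation G g y"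
  by (simp add: conjugation_def m_assoc)

lemma conjugation_inv: "\<lbrakk>g \<in> carrier G; x \<in> carrier G\<rbrakk> \<Longrightarrow> conjugation G g (inv x) = inv (conjugation G g x)"
  by (simp add: conjugation_def m_assoc inv_mult_group)

lemma conjugation_inv_conjugation [simp]: "\<lbrakk>g \<in> carrier G; x \<in> carrier G\<rbrakk> \<Longrightarrow> conjugation G g (conjugation G (inv g) x) = x"
  by (simp add: conjugation_conjugation)

lemma conjugation_conjugation_inv [simp]: "\<lbrakk>g \<in> carrier G; x \<in> carrier G\<rbrakk> \<Longrightarrow> conjugation G (inv g) (conjugation G g x) = x"
  by (simp add: conjugation_conjugation)

lemma commutator_eq_conjugation: "\<lbrakk>g \<in> carrier G; x \<in> carrier G\<rbrakk> \<Longrightarrow> commutator G g x = conjugation G g x \<otimes> inv x"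
  by (simp add: commutator_def conjugation_def)

lemma conjugation_eq_commutator: "\<lbrakk>g \<in> carrier G; x \<in> carrier G\<rbrakk> \<Longrightarrow> conjugation G g x = commutator G g x \<otimes> x"
  by (simp add: commutator_def conjugation_def m_assoc)

lemma commutator_eq_one_iff:
  "\<lbrakk>x \<in> carrier G; y \<in> carrier G\<rbrakk> \<Longrightarrow> commutator G x y = \<one> \<longleftrightarrow> x \<otimes> y = y \<otimes> x"
  (is "\<lbrakk>?x; ?y\<rbrakk> \<Longrightarrow> ?l \<longleftrightarrow> ?r")
proof -
  assume xy: ?x ?y
  then have *: "commutator G x y \<otimes> (y \<otimes> x) = x \<otimes> y"
    by (simp add: commutator_def m_assoc)
  with xy show ?thesis
    by (metis commutator_closed l_one m_closed one_closed right_cancel)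
qed

lemma commutators_in_commute:
  assumes "commutators_in G X Y Z" "subgroup Z G" "X \<subseteq> carrier G" "Y \<subseteq> carrier G"
  shows "commutators_in G Y X Z"
  unfolding commutators_in_def
proof (intro ballI)
  fix y x assume "y \<in> Y" "x \<in> X"
  then have "commutator G y x = inv (commutator G x y)"
    using assms(3,4) by (subst inv_commutator) auto
  then show "commutator G y x \<in> Z"
    using \<open>y \<in> Y\<close> \<open>x \<in> X\<close> assms(1,2) subgroup.m_inv_closed by (fastforce simp: commutators_in_def)
qed

lemma commutators_in_invariant_right:
  assumes "invariant_under G X Y" "subgroup Y G" "X \<subseteq> carrier G"
  shows "commutators_in G X Y Y"
  unfolding commutators_in_def
proof (intro ballI)
  fix x y assume "x \<in> X" "y \<in> Y"
  moreover from this have "commutator G x y = conjugation G x y \<otimes> inv y"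
    using assms subgroup.subset by (intro commutator_eq_conjugation) blast+
  ultimately show "commutator G x y \<in> Y"
    using assms by (simp add: invariant_underD subgroup.m_closed subgroup.m_inv_closed)
qed

lemma commutators_in_invariant_left:
  assumes "invariant_under G Y X" "subgroup X G" "Y \<subseteq> carrier G"
  shows "commutators_in G X Y X"
  using assms commutators_in_invariant_right commutators_in_commute subgroup.subset by metis

lemma invariant_under_commutators_in:
  assumes "commutators_in G X Y Y" "subgroup Y G" "X \<subseteq> carrier G"
  shows "invariant_under G X Y"
  unfolding invariant_under_def
proof (intro ballI)
  fix x y assume "x \<in> X" "y \<in> Y"
  moreover from this have "conjugation G x y = commutator G x y \<otimes> y"
    using assms subgroup.subset by (intro conjugation_eq_commutator) blast+
  ultimately show "conjugation G x y \<in> Y"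
    using assms by (simp add: commutators_inD subgroup.m_closed)
qed

lemma invariant_under_self: "subgroup X G \<Longrightarrow> invariant_under G X X"
  by (simp add: invariant_under_def conjugation_def subgroup.m_closed subgroup.m_inv_closed)

lemma normal_iff_invariant: "N \<lhd> G \<longleftrightarrow> subgroup N G \<and> invariant_under G (carrier G) N"
  by (simp add: normal_inv_iff invariant_under_def conjugation_def)

text \<open>Modulo \<open>Z\<close>, the map \<open>x \<mapsto> [x, y]\<close> is multiplicative up to conjugation in the target, and \<open>Z\<close> is
  stable under the conjugations that occur. This subgroup serves for centralizers of factors, for
  centers, and for the largest subgroup with a prescribed commutation property.\<close>

lemma subgroup_centralizer_mod:
  assumes X: "subgroup X G" and Z: "subgroup Z G" "invariant_under G X Z" and Y: "Y \<subseteq> carrier G"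
  shows "subgroup (centralizer_mod G X Y Z) G"
proof (rule subgroupI)
  interpret X: subgroup X G by fact
  interpret Z: subgroup Z G by fact
  show "centralizer_mod G X Y Z \<subseteq> carrier G"
    by (auto simp: centralizer_mod_def)
  have "commutator G \<one> y = \<one>" if "y \<in> Y" for y
    using that Y by (auto simp: commutator_def)
  then have "\<one> \<in> centralizer_mod G X Y Z"
    by (simp add: centralizer_mod_def)
  then show "centralizer_mod G X Y Z \<noteq> {}"
    by blast
  show "inv a \<in> centralizer_mod G X Y Z" if a: "a \<in> centralizer_mod G X Y Z" for a
  proof -
    have "commutator G (inv a) y \<in> Z" if "y \<in> Y" for y
    proof -
      have "a \<in> X" "a \<in> carrier G" "y \<in> carrier G" "commutator G a y \<in> Z"
        using a that Y by (auto simp: centralizer_mod_def)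
      then show ?thesis
        by (simp add: commutator_inv_left invariant_underD[OF Z(2)])
    qed
    with a show ?thesis
      by (simp add: centralizer_mod_def)
  qed
  show "a \<otimes> b \<in> centralizer_mod G X Y Z"
    if a: "a \<in> centralizer_mod G X Y Z" and b: "b \<in> centralizer_mod G X Y Z" for a b
  proof -
    have "commutator G (a \<otimes> b) y \<in> Z" if "y \<in> Y" for y
    proof -
      have "a \<in> X" "a \<in> carrier G" "b \<in> carrier G" "y \<in> carrier G" "commutator G a y \<in> Z" "commutator G b y \<in> Z"
        using a b that Y by (auto simp: centralizer_mod_def)
      then show ?thesis
        by (simp add: commutator_mult_left invariant_underD[OF Z(2)])
    qed
    with a b show ?thesis
      by (simp add: centralizer_mod_def)
  qed
qed

lemma invariant_under_centralizer_mod: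
  assumes J: "subgroup J G" and "invariant_under G J X" "invariant_under G J Y"
    "invariant_under G J Z" "X \<subseteq> carrier G" "Y \<subseteq> carrier G"
  shows "invariant_under G J (centralizer_mod G X Y Z)"
  unfolding invariant_under_def
proof (intro ballI)
  interpret J: subgroup J G by fact
  fix g x assume g: "g \<in> J" and x: "x \<in> centralizer_mod G X Y Z"
  have "commutator G (conjugation G g x) y \<in> Z" if y: "y \<in> Y" for y
  proof -
    have y': "conjugation G (inv g) y \<in> Y"
      using g y assms(3) by (simp add: invariant_underD)
    have "commutator G (conjugation G g x) y = conjugation G g (commutator G x (conjugation G (inv g) y))"
      using x y g assms(5,6) by (subst conjugation_commutator) (auto simp: centralizer_mod_def)
    moreover have "commutator G x (conjugation G (inv g) y) \<in> Z"
      using x y' by (simp add: centralizer_mod_def)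
    ultimately show ?thesis
      using g assms(4) by (simp add: invariant_underD)
  qed
  moreover have "conjugation G g x \<in> X"
    using g x assms(2) by (simp add: centralizer_mod_def invariant_underD)
  ultimately show "conjugation G g x \<in> centralizer_mod G X Y Z"
    by (simp add: centralizer_mod_def)
qed

lemma subgroup_conj:
  assumes "subgroup H G" "g \<in> carrier G"
  shows "subgroup (conjugation G g ` H) G"
proof (rule subgroupI)
  interpret subgroup H G by fact
  show "conjugation G g ` H \<subseteq> carrier G"
    using assms(2) by auto
  show "conjugation G g ` H \<noteq> {}"
    using one_closed by blast
  show "inv a \<in> conjugation G g ` H" if a: "a \<in> conjugation G g ` H" for a
  proof -
    obtain h where h: "h \<in> H" "a = conjugation G g h"
      using a by blast
    then have "inv a = conjugation G g (inv h)"
      using assms(2) by (simp add: conjugation_inv)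
    with h show ?thesis
      by blast
  qed
  show "a \<otimes> b \<in> conjugation G g ` H" if ab: "a \<in> conjugation G g ` H" "b \<in> conjugation G g ` H" for a b
  proof -
    obtain h k where h: "h \<in> H" "a = conjugation G g h" and k: "k \<in> H" "b = conjugation G g k"
      using ab by blast
    then have "a \<otimes> b = conjugation G g (h \<otimes> k)"
      using assms(2) by (simp add: conjugation_mult)
    with h k show ?thesis
      by blast
  qed
qed

lemma conj_image_eq_vimage:
  assumes "H \<subseteq> carrier G" "g \<in> carrier G"
  shows "conjugation G g ` H = {x \<in> carrier G. conjugation G (inv g) x \<in> H}"
proof
  show "conjugation G g ` H \<subseteq> {x \<in> carrier G. conjugation G (inv g) x \<in> H}"
    using assms by auto
  show "{x \<in> carrier G. conjugation G (inv g) x \<in> H} \<subseteq> conjugation G g ` H"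
  proof
    fix x assume "x \<in> {x \<in> carrier G. conjugation G (inv g) x \<in> H}"
    then have "x = conjugation G g (conjugation G (inv g) x)" "conjugation G (inv g) x \<in> H"
      using assms by auto
    then show "x \<in> conjugation G g ` H"
      by blast
  qed
qed

lemma conj_image_image_inv:
  assumes "P \<subseteq> carrier G" "g \<in> carrier G"
  shows "conjugation G (inv g) ` conjugation G g ` P = P" "conjugation G g ` conjugation G (inv g) ` P = P"
proof -
  have "(\<lambda>x. conjugation G (inv g) (conjugation G g x)) ` P = (\<lambda>x. x) ` P"
    by (rule image_cong) (use assms in auto)
  then show "conjugation G (inv g) ` conjugation G g ` P = P"
    by (simp add: image_image)
  have "(\<lambda>x. conjugation G g (conjugation G (inv g) x)) ` P = (\<lambda>x. x) ` P"
    by (rule image_cong) (use assms in auto)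
  then show "conjugation G g ` conjugation G (inv g) ` P = P"
    by (simp add: image_image)
qed

lemma conj_image_invariant:
  assumes "invariant_under G (carrier G) H" "H \<subseteq> carrier G" "g \<in> carrier G"
  shows "conjugation G g ` H = H"
  using assms by (auto simp: conj_image_eq_vimage invariant_under_def) (metis conjugation_inv_conjugation subset_iff)

end

section \<open>Closed subgroups\<close>

context topological_group
begin

lemma continuous_mult_map:
  assumes "continuous_map X T f" "continuous_map X T g"
  shows "continuous_map X T (\<lambda>x. f x \<otimes> g x)"
proof -
  have "continuous_map X (prod_topology T T) (\<lambda>x. (f x, g x))"
    using assms by (simp add: continuous_map_pairedI)
  from continuous_map_compose[OF this continuous_mult] show ?thesis
    by (simp add: o_def)
qed

lemma continuous_inv_map: "continuous_map X T f \<Longrightarrow> continuous_map X T (\<lambda>x. inv (f x))"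
  using continuous_map_compose[OF _ continuous_inv] by (simp add: o_def)

lemma continuous_const: "x \<in> carrier G \<Longrightarrow> continuous_map X T (\<lambda>_. x)"
  by (simp add: topspace_eq)

lemma continuous_id: "continuous_map T T (\<lambda>x. x)"
  using continuous_map_id by (simp add: id_def)

lemma continuous_conjugation: "g \<in> carrier G \<Longrightarrow> continuous_map T T (conjugation G g)"
  unfolding conjugation_def by (intro continuous_mult_map continuous_const continuous_id) auto

lemma continuous_conjugation_left: "x \<in> carrier G \<Longrightarrow> continuous_map T T (\<lambda>g. conjugation G g x)"
  unfolding conjugation_def
  by (intro continuous_mult_map continuous_inv_map continuous_const continuous_id) auto

lemma continuous_commutator_left: "y \<in> carrier G \<Longrightarrow> continuous_map T T (\<lambda>x. commutator G x y)"
  unfolding commutator_def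
  by (intro continuous_mult_map continuous_inv_map continuous_const continuous_id) auto

lemma closedin_vimage:
  "\<lbrakk>continuous_map T T f; closedin T Z\<rbrakk> \<Longrightarrow> closedin T {x \<in> carrier G. f x \<in> Z}"
  using closedin_continuous_map_preimage topspace_eq by metis

lemma closedin_ball_vimage:
  assumes "closedin T X" "closedin T Z" "\<And>y. y \<in> Y \<Longrightarrow> continuous_map T T (f y)"
  shows "closedin T {x \<in> X. \<forall>y\<in>Y. f y x \<in> Z}"
proof -
  have "X \<subseteq> carrier G"
    using assms(1) closedin_subset topspace_eq by metis
  then have "{x \<in> X. \<forall>y\<in>Y. f y x \<in> Z} = \<Inter>(insert X ((\<lambda>y. {x \<in> carrier G. f y x \<in> Z}) ` Y))"
    by auto
  moreover have "closedin T \<dots>"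
    using assms by (intro closedin_Inter) (auto intro: closedin_vimage)
  ultimately show ?thesis
    by simp
qed

lemma closed_subgroup_centralizer_mod:
  assumes "closed_subgroup G T X" "closed_subgroup G T Z" "invariant_under G X Z" "Y \<subseteq> carrier G"
  shows "closed_subgroup G T (centralizer_mod G X Y Z)"
proof -
  have "closedin T (centralizer_mod G X Y Z)"
    unfolding centralizer_mod_def
    using assms by (intro closedin_ball_vimage continuous_commutator_left) (auto simp: closed_subgroup_def)
  then show ?thesis
    using assms by (simp add: closed_subgroup_def subgroup_centralizer_mod)
qed

lemma closed_subgroup_carrier: "closed_subgroup G T (carrier G)"
  using closedin_topspace[of T] by (simp add: closed_subgroup_def subgroup_self topspace_eq)

lemma closed_subgroup_Inter:
  assumes "\<And>H. H \<in> \<H> \<Longrightarrow> closed_subgroup G T H" "\<H> \<noteq> {}"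
  shows "closed_subgroup G T (\<Inter>\<H>)"
  using assms unfolding closed_subgroup_def by (auto intro!: subgroups_Inter closedin_Inter)

lemma closed_subgroup_Int:
  "\<lbrakk>closed_subgroup G T H; closed_subgroup G T K\<rbrakk> \<Longrightarrow> closed_subgroup G T (H \<inter> K)"
  by (simp add: closed_subgroup_def closedin_Int subgroups_Inter_pair)

lemma closed_subgroup_subset: "closed_subgroup G T H \<Longrightarrow> H \<subseteq> carrier G"
  by (simp add: closed_subgroup_def subgroup.subset)

lemma closed_subgroup_conj:
  assumes "closed_subgroup G T H" "g \<in> carrier G"
  shows "closed_subgroup G T (conjugation G g ` H)"
proof -
  have "closedin T {x \<in> carrier G. conjugation G (inv g) x \<in> H}"
    using assms by (intro closedin_vimage continuous_conjugation) (auto simp: closed_subgroup_def)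
  then have "closedin T (conjugation G g ` H)"
    using assms by (simp add: conj_image_eq_vimage closed_subgroup_subset)
  then show ?thesis
    using assms by (simp add: closed_subgroup_def subgroup_conj)
qed

lemma closed_normal_subgroup_iff:
  "closed_normal_subgroup G T N \<longleftrightarrow> closed_subgroup G T N \<and> invariant_under G (carrier G) N"
  by (auto simp: closed_normal_subgroup_def closed_subgroup_def normal_iff_invariant)

text \<open>Closedness comes from continuity of \<open>g \<mapsto> g p g\<^sup>-\<^sup>1\<close> for each fixed \<open>p\<close>. Both \<open>g\<close> and \<open>g\<^sup>-\<^sup>1\<close> are
  required to map \<open>P\<close> into itself, as \<open>g P g\<^sup>-\<^sup>1 \<subseteq> P\<close> alone does not define a subgroup.
  This lets normality pass from a subgroup to its closure.\<close>

lemma closed_subgroup_normalizer: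
  assumes P: "closed_subgroup G T P"
  shows "closed_subgroup G T {g \<in> carrier G. \<forall>p\<in>P. conjugation G g p \<in> P \<and> conjugation G (inv g) p \<in> P}"
    (is "closed_subgroup G T ?N")
proof -
  have sub: "P \<subseteq> carrier G"
    using P by (rule closed_subgroup_subset)
  have c1: "closedin T {g \<in> carrier G. \<forall>p\<in>P. conjugation G g p \<in> P}"
    using P sub closed_subgroup_carrier
    by (intro closedin_ball_vimage continuous_conjugation_left) (auto simp: closed_subgroup_def)
  have c2: "closedin T {g \<in> carrier G. \<forall>p\<in>P. conjugation G (inv g) p \<in> P}"
    using P sub closed_subgroup_carrier
    by (intro closedin_ball_vimage continuous_map_compose[OF continuous_inv continuous_conjugation_left, unfolded o_def])
      (auto simp: closed_subgroup_def)
  have "?N = {g \<in> carrier G. \<forall>p\<in>P. conjugation G g p \<in> P} \<inter> {g \<in> carrier G. \<forall>p\<in>P. conjugation G (inv g) p \<in> P}"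
    by auto
  with c1 c2 have "closedin T ?N"
    by (simp add: closedin_Int)
  moreover have "subgroup ?N G"
  proof (rule subgroupI)
    show "?N \<subseteq> carrier G" by auto
    have "\<one> \<in> ?N" using sub by auto
    then show "?N \<noteq> {}" by blast
    show "inv a \<in> ?N" if "a \<in> ?N" for a
      using that by auto
    show "a \<otimes> b \<in> ?N" if "a \<in> ?N" "b \<in> ?N" for a b
    proof -
      have "conjugation G (a \<otimes> b) p = conjugation G a (conjugation G b p)"
        "conjugation G (inv (a \<otimes> b)) p = conjugation G (inv b) (conjugation G (inv a) p)" if "p \<in> P" for p
        using that \<open>a \<in> ?N\<close> \<open>b \<in> ?N\<close> sub by (auto simp: conjugation_conjugation inv_mult_group)
      then show ?thesis
        using that by auto
    qed
  qed
  ultimately show ?thesis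
    by (simp add: closed_subgroup_def)
qed

end

section \<open>Invariant closed subgroups between two terms of a factor\<close>

text \<open>For \<open>K = carrier G\<close> and \<open>L\<close> trivial these are the closed normal subgroups of \<open>G\<close>; in general they
  correspond to the closed normal subgroups of the factor \<open>K / L\<close>. Working with subsets of \<open>G\<close> allows
  one to compare different factors without passing to quotients.\<close>

definition between ::
    "('a, 'b) monoid_scheme \<Rightarrow> 'a topology \<Rightarrow> 'a set \<Rightarrow> 'a set \<Rightarrow> 'a set \<Rightarrow> bool" where
  "between G T K L P \<longleftrightarrow> closed_subgroup G T P \<and> invariant_under G K P \<and> L \<subseteq> P \<and> P \<subseteq> K"

text \<open>The head of \<open>N\<close> in the sense of module theory: the quotient of \<open>N\<close> by a proper member \<open>N0\<close> of the poset
  that contains all other proper members below \<open>N\<close>. If \<open>N0 = L\<close>, then \<open>N\<close> is a minimal member above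
  \<open>L\<close>, non-abelian modulo \<open>L\<close>.\<close>

definition nonabelian_head ::
    "('a, 'b) monoid_scheme \<Rightarrow> 'a topology \<Rightarrow> 'a set \<Rightarrow> 'a set \<Rightarrow> 'a set \<Rightarrow> 'a set \<Rightarrow> bool" where
  "nonabelian_head G T K L N N0 \<longleftrightarrow> between G T K L N \<and> between G T K L N0 \<and> N0 \<subset> N \<and>
    (\<forall>P. between G T K L P \<and> P \<subset> N \<longrightarrow> P \<subseteq> N0) \<and> \<not> commutators_in G N N N0"

lemma betweenD:
  assumes "between G T K L P"
  shows "closed_subgroup G T P" "subgroup P G" "closedin T P" "invariant_under G K P" "L \<subseteq> P" "P \<subseteq> K"
  using assms by (auto simp: between_def closed_subgroup_def)

lemma between_invariant: "\<lbrakk>between G T K L P; J \<subseteq> K\<rbrakk> \<Longrightarrow> invariant_under G J P"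
  by (auto simp: between_def invariant_under_def)

lemma nonabelian_headD:
  assumes "nonabelian_head G T K L N N0"
  shows "between G T K L N" "between G T K L N0" "N0 \<subset> N" "\<not> commutators_in G N N N0"
    "\<And>P. \<lbrakk>between G T K L P; P \<subset> N\<rbrakk> \<Longrightarrow> P \<subseteq> N0"
  using assms by (auto simp: nonabelian_head_def)

context topological_group
begin

lemma between_Int: "\<lbrakk>between G T K L P; between G T K L Q\<rbrakk> \<Longrightarrow> between G T K L (P \<inter> Q)"
  by (auto simp: between_def closed_subgroup_Int intro: invariant_under_Int)

lemma between_Inter:
  assumes "\<And>P. P \<in> \<P> \<Longrightarrow> between G T K L P" "\<P> \<noteq> {}"
  shows "between G T K L (\<Inter>\<P>)"
  using assms closed_subgroup_Inter[of \<P>]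
  by (fastforce simp: between_def invariant_under_def)

lemma between_top:
  "\<lbrakk>closed_subgroup G T K; L \<subseteq> K\<rbrakk> \<Longrightarrow> between G T K L K"
  by (simp add: between_def closed_subgroup_def invariant_under_self)

definition closed_subgroup_hull :: "'a set \<Rightarrow> 'a set" where
  "closed_subgroup_hull X = \<Inter>{H. closed_subgroup G T H \<and> X \<subseteq> H}"

lemma closed_subgroup_hull:
  "X \<subseteq> carrier G \<Longrightarrow> closed_subgroup G T (closed_subgroup_hull X)"
  unfolding closed_subgroup_hull_def using closed_subgroup_carrier
  by (intro closed_subgroup_Inter) auto

lemma closed_subgroup_hull_superset: "X \<subseteq> closed_subgroup_hull X"
  by (auto simp: closed_subgroup_hull_def)

lemma closed_subgroup_hull_least: "\<lbrakk>closed_subgroup G T H; X \<subseteq> H\<rbrakk> \<Longrightarrow> closed_subgroup_hull X \<subseteq> H"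
  by (auto simp: closed_subgroup_hull_def)

lemma invariant_imp_subset_normalizer:
  assumes P: "closed_subgroup G T P" and X: "invariant_under G X P" "subgroup X G"
  shows "X \<subseteq> {g \<in> carrier G. \<forall>p\<in>P. conjugation G g p \<in> P \<and> conjugation G (inv g) p \<in> P}"
  using X subgroup.subset[OF X(2)]
  by (auto simp: invariant_under_def subgroup.m_inv_closed)

text \<open>The normalizer of \<open>P\<close> is a closed subgroup, so it contains the closed subgroup generated by \<open>X\<close> and \<open>Y\<close>
  as soon as it contains both.\<close>

lemma invariant_under_closed_subgroup_hull:
  assumes P: "closed_subgroup G T P" and X: "invariant_under G X P" "subgroup X G"
    and Y: "invariant_under G Y P" "subgroup Y G"
  shows "invariant_under G (closed_subgroup_hull (X \<union> Y)) P"
proof -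
  have "closed_subgroup_hull (X \<union> Y)
    \<subseteq> {g \<in> carrier G. \<forall>p\<in>P. conjugation G g p \<in> P \<and> conjugation G (inv g) p \<in> P}"
    using closed_subgroup_normalizer[OF P] invariant_imp_subset_normalizer[OF P X]
      invariant_imp_subset_normalizer[OF P Y]
    by (intro closed_subgroup_hull_least) auto
  then show ?thesis
    by (auto simp: invariant_under_def)
qed

end

section \<open>Non-abelian chief factors and their centralizers\<close>

lemma (in group) coset_eq_iff:
  assumes "subgroup L G" "x \<in> carrier G" "y \<in> carrier G"
  shows "L #> x = L #> y \<longleftrightarrow> x \<otimes> inv y \<in> L"
proof
  assume eq: "L #> x = L #> y"
  have "x \<in> L #> x"
    using assms by (simp add: rcos_self)
  then obtain l where "l \<in> L" "x = l \<otimes> y"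
    using eq by (auto simp: r_coset_def)
  then show "x \<otimes> inv y \<in> L"
    using assms by (simp add: m_assoc subgroup.mem_carrier)
next
  assume "x \<otimes> inv y \<in> L"
  then have "x \<in> L #> y"
    using assms by (auto simp: r_coset_def m_assoc intro!: bexI[where x = "x \<otimes> inv y"])
  then show "L #> x = L #> y"
    using assms repr_independence by metis
qed

lemma r_coset_carrier_update [simp]: "r_coset (G\<lparr>carrier := K\<rparr>) L x = r_coset G L x"
  by (simp add: r_coset_def)

lemma set_mult_carrier_update [simp]: "set_mult (G\<lparr>carrier := K\<rparr>) X Y = set_mult G X Y"
  by (simp add: set_mult_def)

lemma carrier_factor_group: "carrier (factor_group G K L) = r_coset G L ` K"
  by (simp add: factor_group_def carrier_FactGroup)

lemma mult_factor_group: "X \<otimes>\<^bsub>factor_group G K L\<^esub> Y = X <#>\<^bsub>G\<^esub> Y"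
  by (simp add: factor_group_def)

lemma (in group) comm_group_factor_group_iff:
  assumes L: "L \<lhd> G" and K: "subgroup K G" and LK: "L \<subseteq> K"
  shows "comm_group (factor_group G K L) \<longleftrightarrow> commutators_in G K K L"
proof -
  interpret K: group "G\<lparr>carrier := K\<rparr>"
    using K by (rule subgroup_imp_group)
  interpret L: normal L "G\<lparr>carrier := K\<rparr>"
    using normal_restrict_supergroup[OF K L LK] .
  have Q: "group (factor_group G K L)"
    unfolding factor_group_def by (rule L.factorgroup_is_group)
  have KG: "K \<subseteq> carrier G"
    using K by (rule subgroup.subset)
  have mult: "(L #> x) <#> (L #> y) = L #> (x \<otimes> y)" if "x \<in> K" "y \<in> K" for x y
    using L.rcos_sum[of x y] that by simp
  have "comm_group (factor_group G K L) \<longleftrightarrow>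
      (\<forall>x\<in>K. \<forall>y\<in>K. (L #> x) <#> (L #> y) = (L #> y) <#> (L #> x))"
  proof
    assume "comm_group (factor_group G K L)"
    then have "comm_monoid (factor_group G K L)"
      by (rule comm_group.axioms)
    from comm_monoid.m_comm[OF this]
    show "\<forall>x\<in>K. \<forall>y\<in>K. (L #> x) <#> (L #> y) = (L #> y) <#> (L #> x)"
      by (simp add: carrier_factor_group mult_factor_group)
  next
    assume *: "\<forall>x\<in>K. \<forall>y\<in>K. (L #> x) <#> (L #> y) = (L #> y) <#> (L #> x)"
    show "comm_group (factor_group G K L)"
      using Q
    proof (rule group.group_comm_groupI)
      fix X Y assume "X \<in> carrier (factor_group G K L)" "Y \<in> carrier (factor_group G K L)"
      then obtain x y where "x \<in> K" "y \<in> K" "X = L #> x" "Y = L #> y"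
        by (auto simp: carrier_factor_group)
      then show "X \<otimes>\<^bsub>factor_group G K L\<^esub> Y = Y \<otimes>\<^bsub>factor_group G K L\<^esub> X"
        using * by (simp add: mult_factor_group)
    qed
  qed
  also have "\<dots> \<longleftrightarrow> commutators_in G K K L"
    unfolding commutators_in_def
  proof (intro ball_cong refl)
    fix x y assume xy: "x \<in> K" "y \<in> K"
    then have "x \<in> carrier G" "y \<in> carrier G"
      using KG by auto
    moreover from this have "x \<otimes> y \<otimes> inv (y \<otimes> x) = commutator G x y"
      by (simp add: commutator_def inv_mult_group m_assoc)
    ultimately show "(L #> x) <#> (L #> y) = (L #> y) <#> (L #> x) \<longleftrightarrow> commutator G x y \<in> L"
      using xy L by (simp add: mult coset_eq_iff normal_imp_subgroup)
  qed
  finally show ?thesis .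
qed

lemma factor_centralizer_eq: "factor_centralizer G (K, L) = centralizer_mod G (carrier G) K L"
  by (simp add: factor_centralizer_def centralizer_mod_def commutator_def)

lemma (in topological_group) chief_factorD:
  assumes "chief_factor G T (K, L)"
  shows "closed_subgroup G T K" "invariant_under G (carrier G) K"
    "closed_subgroup G T L" "invariant_under G (carrier G) L" "L \<subset> K"
    "\<And>N. \<lbrakk>closed_subgroup G T N; invariant_under G (carrier G) N; L \<subseteq> N; N \<subseteq> K\<rbrakk> \<Longrightarrow> N = L \<or> N = K"
  using assms by (auto simp: chief_factor_def normal_factor_def closed_normal_subgroup_iff)

locale nonabelian_chief = topological_group +
  fixes A B :: "'a set"
  assumes factor: "(A, B) \<in> nonabelian_chief_factors G T"
begin

definition C :: "'a set" where "C = factor_centralizer G (A, B)"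
text \<open>Since \<open>C\<close> is normal, this is the closure of \<open>A C\<close>. The factor \<open>M / C\<close> stands for the
  whole block, and all representatives embed densely into it.\<close>

definition M :: "'a set" where "M = closed_subgroup_hull (A \<union> C)"

lemma chief: "chief_factor G T (A, B)"
  using factor by (simp add: nonabelian_chief_factors_def)

lemmas A_closed = chief_factorD(1)[OF chief]
  and A_normal = chief_factorD(2)[OF chief]
  and B_closed = chief_factorD(3)[OF chief]
  and B_normal = chief_factorD(4)[OF chief]
  and B_psubset_A = chief_factorD(5)[OF chief]
  and no_intermediate = chief_factorD(6)[OF chief]

lemma B_subset_A: "B \<subseteq> A"
  using B_psubset_A by auto

lemma A_subset: "A \<subseteq> carrier G"
  using A_closed by (rule closed_subgroup_subset)

lemma A_subgroup: "subgroup A G" and B_subgroup: "subgroup B G"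
  using A_closed B_closed by (simp_all add: closed_subgroup_def)

lemma nonabelian: "\<not> commutators_in G A A B"
  using factor comm_group_factor_group_iff[of B A] A_subgroup B_subgroup B_subset_A B_normal
  by (simp add: nonabelian_chief_factors_def normal_iff_invariant)

lemma C_eq: "C = centralizer_mod G (carrier G) A B"
  by (simp add: C_def factor_centralizer_eq)

lemma C_closed: "closed_subgroup G T C"
  unfolding C_eq using closed_subgroup_carrier B_closed B_normal A_subset
  by (rule closed_subgroup_centralizer_mod)

lemma C_subgroup: "subgroup C G"
  using C_closed by (simp add: closed_subgroup_def)

lemma C_normal: "invariant_under G (carrier G) C"
  unfolding C_eq
  by (intro invariant_under_centralizer_mod subgroup_self invariant_under_self A_normal B_normal
      A_subset order_refl)

lemma C_subset: "C \<subseteq> carrier G"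
  using C_closed by (rule closed_subgroup_subset)

lemma subset_C_iff: "X \<subseteq> carrier G \<Longrightarrow> X \<subseteq> C \<longleftrightarrow> commutators_in G X A B"
  by (simp add: C_eq subset_centralizer_mod_iff)

lemma commutators_C_A: "commutators_in G C A B"
  using subset_C_iff[OF C_subset] by simp

lemma B_subset_C: "B \<subseteq> C"
  using B_subset_A A_subset B_subgroup invariant_under_mono[OF B_normal A_subset]
    commutators_in_invariant_left[of A B]
  by (subst subset_C_iff) auto

text \<open>The intersection is the centre of \<open>A / B\<close>, which is trivial in a non-abelian chief factor.\<close>

lemma A_Int_C: "A \<inter> C = B"
proof -
  have "A \<inter> C = B \<or> A \<inter> C = A"
    using B_subset_A B_subset_C A_closed C_closed A_normal C_normal
    by (intro no_intermediate closed_subgroup_Int invariant_under_Int) auto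
  moreover have "A \<inter> C \<noteq> A"
    using nonabelian subset_C_iff[OF A_subset] by blast
  ultimately show ?thesis
    by blast
qed

lemma M_closed: "closed_subgroup G T M"
  unfolding M_def using A_subset C_subset by (intro closed_subgroup_hull) simp

lemma M_subgroup: "subgroup M G"
  using M_closed by (simp add: closed_subgroup_def)

lemma M_subset: "M \<subseteq> carrier G"
  using M_closed by (rule closed_subgroup_subset)

lemma A_subset_M: "A \<subseteq> M" and C_subset_M: "C \<subseteq> M"
  unfolding M_def using closed_subgroup_hull_superset[of "A \<union> C"] by auto

lemma M_least: "\<lbrakk>closed_subgroup G T H; A \<subseteq> H; C \<subseteq> H\<rbrakk> \<Longrightarrow> M \<subseteq> H"
  unfolding M_def by (intro closed_subgroup_hull_least) auto

text \<open>Because \<open>C\<close> centralizes \<open>A\<close> modulo \<open>B \<le> P\<close>, it normalizes \<open>P\<close>, and then so does the closure of \<open>A C\<close>.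
  Hence the poset of \<open>(A, B)\<close> does not change if invariance under \<open>A\<close> is replaced by invariance
  under \<open>M\<close>.\<close>

lemma between_invariant_M:
  assumes P: "between G T A B P"
  shows "invariant_under G M P"
proof -
  have "commutators_in G C P P"
    using commutators_in_mono[OF commutators_C_A order_refl betweenD(6)[OF P] betweenD(5)[OF P]] .
  then have "invariant_under G C P"
    using betweenD(2)[OF P] C_subset by (intro invariant_under_commutators_in)
  then show ?thesis
    unfolding M_def using betweenD[OF P] A_subgroup C_subgroup
    by (intro invariant_under_closed_subgroup_hull)
qed

lemma between_M_Int_A:
  assumes R: "between G T M C R"
  shows "between G T A B (R \<inter> A)"
  using betweenD[OF R] A_closed B_subset_A B_subset_C
    invariant_under_mono[OF betweenD(4)[OF R] A_subset_M]
    invariant_under_mono[OF A_normal A_subset]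
  by (auto simp: between_def closed_subgroup_Int intro!: invariant_under_Int)

lemma between_M_M: "between G T M C M"
  by (intro between_top M_closed C_subset_M)

lemma between_A_A: "between G T A B A"
  by (intro between_top A_closed B_subset_A)

lemma between_A_subset: "between G T A B P \<Longrightarrow> P \<subseteq> carrier G"
  by (meson betweenD(2) subgroup.subset)

lemma between_M_subset: "between G T M C P \<Longrightarrow> P \<subseteq> carrier G"
  by (meson betweenD(2) subgroup.subset)

section \<open>Heads of a chief factor and of its block\<close>

text \<open>The closure of \<open>P C\<close> when \<open>P\<close> is itself a term between \<open>B\<close> and \<open>A\<close>. The description from above gives
  the universal property without computations with closures.\<close>

definition lift :: "'a set \<Rightarrow> 'a set" where
  "lift P = \<Inter>{R. between G T M C R \<and> P \<subseteq> R}"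

lemma lift_between: "P \<subseteq> M \<Longrightarrow> between G T M C (lift P)"
  unfolding lift_def using between_M_M by (intro between_Inter) auto

lemma lift_superset: "P \<subseteq> lift P"
  by (auto simp: lift_def)

lemma lift_least: "\<lbrakk>between G T M C R; P \<subseteq> R\<rbrakk> \<Longrightarrow> lift P \<subseteq> R"
  by (auto simp: lift_def)

text \<open>The elements of \<open>M\<close> that commute with \<open>Y\<close> modulo \<open>Z\<close> form a member of the poset of \<open>(M, C)\<close>, so they
  contain \<open>lift P\<close> once they contain \<open>P\<close> and \<open>C\<close>. All statements about commutators with \<open>lift P\<close> are
  reduced to \<open>P\<close> in this way.\<close>

lemma commutators_lift:
  assumes "P \<subseteq> M" "commutators_in G P Y Z" "commutators_in G C Y Z" "Y \<subseteq> carrier G"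
    "closed_subgroup G T Z" "invariant_under G M Z" "invariant_under G M Y"
  shows "commutators_in G (lift P) Y Z"
proof -
  have ce: "closed_subgroup G T (centralizer_mod G M Y Z)"
    using M_closed assms by (intro closed_subgroup_centralizer_mod) auto
  have "invariant_under G M (centralizer_mod G M Y Z)"
    using assms M_subset
    by (intro invariant_under_centralizer_mod M_subgroup invariant_under_self) auto
  moreover have "centralizer_mod G M Y Z \<subseteq> M"
    by (auto simp: centralizer_mod_def)
  moreover have "P \<subseteq> centralizer_mod G M Y Z" "C \<subseteq> centralizer_mod G M Y Z"
    using assms C_subset_M by (simp_all add: subset_centralizer_mod_iff)
  ultimately have "lift P \<subseteq> centralizer_mod G M Y Z"
    using ce by (intro lift_least) (auto simp: between_def)
  then show ?thesis
    unfolding commutators_in_def centralizer_mod_def by blast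
qed

lemma commutators_between:
  assumes R: "between G T M C R" and N: "between G T A B N"
  shows "commutators_in G R N (R \<inter> N)"
proof -
  have "commutators_in G R N N"
    using invariant_under_mono[OF between_invariant_M[OF N]] betweenD[OF N] betweenD[OF R] M_subset
    by (intro commutators_in_invariant_right) auto
  moreover have "commutators_in G R N R"
    using between_invariant[OF R, of N] betweenD[OF N] betweenD[OF R] A_subset_M A_subset
    by (intro commutators_in_invariant_left) auto
  ultimately show ?thesis
    by (simp add: commutators_in_def)
qed

text \<open>A member \<open>P\<close> of the poset of \<open>(M, C)\<close> that does not contain \<open>N\<close> meets \<open>N\<close> within \<open>N0\<close>, and therefore
  commutes with \<open>N\<close> modulo \<open>N0\<close>. So the centralizer of \<open>N / N0\<close> in \<open>lift N\<close> is the largest proper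
  member below \<open>lift N\<close>.\<close>

lemma head_lift:
  assumes head: "nonabelian_head G T A B N N0"
  defines "R0 \<equiv> centralizer_mod G (lift N) N N0"
  shows "nonabelian_head G T M C (lift N) R0"
proof -
  note N = nonabelian_headD(1)[OF head] and N0 = nonabelian_headD(2)[OF head]
  note ps = nonabelian_headD(3)[OF head] and nab = nonabelian_headD(4)[OF head]
    and max = nonabelian_headD(5)[OF head]
  have NM: "N \<subseteq> M"
    using betweenD(6)[OF N] A_subset_M by auto
  note R = lift_between[OF NM]
  have CN: "commutators_in G C N N0"
    using commutators_in_mono[OF commutators_C_A order_refl betweenD(6)[OF N] betweenD(5)[OF N0]] .
  have R0: "between G T M C R0"
  proof -
    have "closed_subgroup G T R0"
      unfolding R0_def using betweenD[OF R] betweenD[OF N0] between_A_subset[OF N]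
        invariant_under_mono[OF between_invariant_M[OF N0]]
      by (intro closed_subgroup_centralizer_mod) auto
    moreover have "invariant_under G M R0"
      unfolding R0_def using betweenD[OF R] between_invariant_M[OF N] between_invariant_M[OF N0]
        between_A_subset[OF N] M_subset
      by (intro invariant_under_centralizer_mod M_subgroup) auto
    moreover have "C \<subseteq> R0"
      unfolding R0_def using betweenD(5)[OF R] CN by (simp add: subset_centralizer_mod_iff)
    moreover have "R0 \<subseteq> M"
      using betweenD(6)[OF R] by (auto simp: R0_def centralizer_mod_def)
    ultimately show ?thesis
      by (simp add: between_def)
  qed
  have sub_R0: "N \<inter> P \<subseteq> N0 \<Longrightarrow> P \<subseteq> lift N \<Longrightarrow> between G T M C P \<Longrightarrow> P \<subseteq> R0" for P
    using commutators_in_mono[OF commutators_between[OF _ N] order_refl order_refl, of P N0]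
    unfolding R0_def by (subst subset_centralizer_mod_iff) (auto simp: Int_commute)
  have small: "N \<inter> P \<subseteq> N0" if P: "between G T M C P" and "\<not> N \<subseteq> P" for P
  proof (rule max)
    have "between G T A B (P \<inter> A \<inter> N)"
      using between_M_Int_A[OF P] N by (rule between_Int)
    moreover have "P \<inter> A \<inter> N = N \<inter> P"
      using betweenD(6)[OF N] by auto
    ultimately show "between G T A B (N \<inter> P)"
      by simp
    show "N \<inter> P \<subset> N"
      using that by auto
  qed
  have notR0: "\<not> N \<subseteq> R0"
    using nab lift_superset[of N] unfolding R0_def by (simp add: subset_centralizer_mod_iff)
  show ?thesis
    unfolding nonabelian_head_def
  proof (intro conjI allI impI)
    show "between G T M C (lift N)" "between G T M C R0"
      by (fact R R0)+
    show "R0 \<subset> lift N"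
      using notR0 lift_superset[of N] by (auto simp: R0_def centralizer_mod_def)
    show "P \<subseteq> R0" if P: "between G T M C P \<and> P \<subset> lift N" for P
    proof (rule sub_R0)
      have "\<not> N \<subseteq> P"
        using P lift_least[of P N] by auto
      then show "N \<inter> P \<subseteq> N0"
        using P small by blast
    qed (use P in auto)
    show "\<not> commutators_in G (lift N) (lift N) R0"
    proof
      assume "commutators_in G (lift N) (lift N) R0"
      then have "commutators_in G N N R0"
        by (rule commutators_in_mono) (simp_all add: lift_superset)
      moreover have "commutators_in G N N N"
        using betweenD(2)[OF N] between_A_subset[OF N]
        by (intro commutators_in_invariant_right invariant_under_self)
      ultimately have "commutators_in G N N (N \<inter> R0)"
        by (auto simp: commutators_in_def)
      from commutators_in_mono[OF this order_refl order_refl small[OF R0 notR0]] nab show False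
        by blast
    qed
  qed
qed


text \<open>The candidate \<open>R0\<close> from the previous lemma centralizes \<open>N\<close> modulo \<open>B\<close>. A conjugate of \<open>N\<close> in \<open>G\<close> that
  differs from \<open>N\<close> meets it in \<open>B\<close>, as both are minimal, and hence commutes with \<open>N\<close>, thus with \<open>lift N\<close>
  and with \<open>R0\<close>, modulo \<open>B\<close>. So \<open>R0\<close> centralizes all conjugates of \<open>N\<close> modulo \<open>B\<close>. These generate a
  dense subgroup of \<open>A\<close> modulo \<open>B\<close>, since \<open>A / B\<close> is chief; it follows that \<open>R0\<close> lies in \<open>C\<close>.\<close>

lemma head_lift_minimal:
  assumes head: "nonabelian_head G T A B N B"
  shows "nonabelian_head G T M C (lift N) C"
proof -
  define R0 where "R0 = centralizer_mod G (lift N) N B"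
  have R0: "nonabelian_head G T M C (lift N) R0"
    unfolding R0_def using head by (rule head_lift)
  note N = nonabelian_headD(1)[OF head]
  have NM: "N \<subseteq> M"
    using betweenD(6)[OF N] A_subset_M by auto
  have R0M: "R0 \<subseteq> carrier G"
    using between_M_subset[OF nonabelian_headD(2)[OF R0]] .
  \<comment> \<open>\<open>W\<close> is normal in \<open>G\<close>, which \<open>R0\<close> need not be, so that chiefness of \<open>A / B\<close> applies to
    the centralizer of \<open>W\<close>.\<close>
  define W where "W = centralizer_mod G (carrier G) (\<Union>g\<in>carrier G. conjugation G g ` N) B"
  have conj_sub: "(\<Union>g\<in>carrier G. conjugation G g ` N) \<subseteq> A"
    using betweenD(6)[OF N] A_normal by (auto simp: invariant_under_def)
  have conj_inv: "invariant_under G (carrier G) (\<Union>g\<in>carrier G. conjugation G g ` N)"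
    unfolding invariant_under_def
  proof (intro ballI)
    fix g x assume g: "g \<in> carrier G" and "x \<in> (\<Union>g\<in>carrier G. conjugation G g ` N)"
    then obtain h n where "h \<in> carrier G" "n \<in> N" "x = conjugation G h n"
      by blast
    then have "conjugation G g x = conjugation G (g \<otimes> h) n"
      using g between_A_subset[OF N] by (auto simp: conjugation_conjugation)
    then show "conjugation G g x \<in> (\<Union>g\<in>carrier G. conjugation G g ` N)"
      using g \<open>h \<in> carrier G\<close> \<open>n \<in> N\<close> by blast
  qed
  have W_closed: "closed_subgroup G T W"
    unfolding W_def using closed_subgroup_carrier B_closed B_normal conj_sub A_subset
    by (intro closed_subgroup_centralizer_mod) auto
  have W_normal: "invariant_under G (carrier G) W"
    unfolding W_def using conj_sub A_subset
    by (intro invariant_under_centralizer_mod conj_inv B_normal subgroup_self invariant_under_self) auto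
  have comm_conj: "commutators_in G R0 (conjugation G g ` N) B" if g: "g \<in> carrier G" for g
  proof (cases "conjugation G g ` N = N")
    case True
    then show ?thesis
      by (auto simp: R0_def commutators_in_def centralizer_mod_def)
  next
    case False
    have Ng: "between G T A B (conjugation G g ` N)" if g: "g \<in> carrier G" for g
      unfolding between_def
    proof (intro conjI)
      show "closed_subgroup G T (conjugation G g ` N)"
        using betweenD(1)[OF N] g by (rule closed_subgroup_conj)
      show "conjugation G g ` N \<subseteq> A"
        using conj_sub g by blast
      have "B = conjugation G g ` B"
        using B_normal B_subset_A A_subset g by (subst conj_image_invariant) auto
      then show "B \<subseteq> conjugation G g ` N"
        using betweenD(5)[OF N] by blast
      show "invariant_under G A (conjugation G g ` N)"
        unfolding invariant_under_def
      proof (intro ballI)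
        fix a x assume a: "a \<in> A" and "x \<in> conjugation G g ` N"
        then obtain n where n: "n \<in> N" "x = conjugation G g n"
          by blast
        have a': "conjugation G (inv g) a \<in> A" "a \<in> carrier G" "n \<in> carrier G"
          using a A_normal A_subset g n between_A_subset[OF N] by (auto simp: invariant_under_def)
        then have "conjugation G a x = conjugation G g (conjugation G (conjugation G (inv g) a) n)"
          using n g by (simp add: conjugation_def m_assoc inv_mult_group)
        moreover have "conjugation G (conjugation G (inv g) a) n \<in> N"
          using a' n betweenD(4)[OF N] by (simp add: invariant_underD)
        ultimately show "conjugation G a x \<in> conjugation G g ` N"
          by blast
      qed
    qed
    have minimal: "P = B" if "between G T A B P" "P \<subset> N" for P
      using nonabelian_headD(5)[OF head that] betweenD(5)[OF that(1)] by simp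
    have "\<not> N \<subseteq> conjugation G g ` N"
    proof
      assume "N \<subseteq> conjugation G g ` N"
      then have "conjugation G (inv g) ` N \<subseteq> conjugation G (inv g) ` conjugation G g ` N"
        by (rule image_mono)
      also have "\<dots> = N"
        using g between_A_subset[OF N] by (simp add: conj_image_image_inv)
      finally have "conjugation G (inv g) ` N \<subseteq> N" .
      then have "conjugation G (inv g) ` N = N \<or> conjugation G (inv g) ` N = B"
        using minimal[of "conjugation G (inv g) ` N"] Ng[of "inv g"] g by auto
      moreover have "conjugation G g ` conjugation G (inv g) ` N = N"
        using g between_A_subset[OF N] by (simp add: conj_image_image_inv)
      moreover have "conjugation G g ` B = B"
        using B_normal B_subset_A A_subset g by (intro conj_image_invariant) auto
      ultimately show False
        using False nonabelian_headD(3)[OF head] by auto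
    qed
    then have disjoint: "N \<inter> conjugation G g ` N = B"
      using minimal[OF between_Int[OF N Ng[OF g]]] by auto
    have inv: "invariant_under G N (conjugation G g ` N)" "invariant_under G (conjugation G g ` N) N"
      using betweenD(6)[OF N] betweenD(6)[OF Ng[OF g]] N Ng[OF g] between_invariant by metis+
    have "commutators_in G N (conjugation G g ` N) (conjugation G g ` N)" "commutators_in G N (conjugation G g ` N) N"
      using inv betweenD(2)[OF N] betweenD(2)[OF Ng[OF g]] between_A_subset[OF N]
        between_A_subset[OF Ng[OF g]]
      by (auto intro!: commutators_in_invariant_left commutators_in_invariant_right)
    then have "commutators_in G N (conjugation G g ` N) B"
      using disjoint unfolding commutators_in_def by blast
    moreover have "commutators_in G C (conjugation G g ` N) B"
      using commutators_in_mono[OF commutators_C_A order_refl betweenD(6)[OF Ng[OF g]] order_refl] .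
    ultimately have "commutators_in G (lift N) (conjugation G g ` N) B"
      using NM between_A_subset[OF Ng[OF g]] B_closed invariant_under_mono[OF B_normal M_subset]
        between_invariant_M[OF Ng[OF g]]
      by (intro commutators_lift)
    then show ?thesis
      by (auto simp: R0_def commutators_in_def centralizer_mod_def)
  qed
  have "R0 \<subseteq> W"
    unfolding W_def subset_centralizer_mod_iff[OF R0M]
    using comm_conj by (auto simp: commutators_in_def)
  moreover have "W \<subseteq> C"
  proof -
    define D where "D = centralizer_mod G A W B"
    have W_sub: "W \<subseteq> carrier G"
      using W_closed by (rule closed_subgroup_subset)
    have "closed_subgroup G T D" "invariant_under G (carrier G) D"
      unfolding D_def using A_closed B_closed W_sub invariant_under_mono[OF B_normal A_subset]
        A_normal B_normal W_normal A_subset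
      by (auto intro!: closed_subgroup_centralizer_mod invariant_under_centralizer_mod subgroup_self)
    moreover have "B \<subseteq> D"
      unfolding D_def subset_centralizer_mod_iff[OF B_subset_A]
      using W_sub invariant_under_mono[OF B_normal W_sub] B_subgroup
      by (intro commutators_in_invariant_left)
    moreover have "D \<subseteq> A"
      by (auto simp: D_def centralizer_mod_def)
    ultimately have "D = B \<or> D = A"
      by (rule no_intermediate)
    moreover have "N \<subseteq> D"
    proof -
      have "N \<subseteq> (\<Union>g\<in>carrier G. conjugation G g ` N)"
      proof
        fix n assume "n \<in> N"
        moreover from this have "n = conjugation G \<one> n"
          using between_A_subset[OF N] by auto
        ultimately show "n \<in> (\<Union>g\<in>carrier G. conjugation G g ` N)"
          by blast
      qed
      then have "commutators_in G W N B"
        unfolding W_def by (auto simp: commutators_in_def centralizer_mod_def)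
      then have "commutators_in G N W B"
        using B_subgroup W_sub between_A_subset[OF N] by (rule commutators_in_commute)
      then show ?thesis
        unfolding D_def by (simp add: subset_centralizer_mod_iff betweenD(6)[OF N])
    qed
    ultimately have "D = A"
      using nonabelian_headD(3)[OF head] by auto
    then have "commutators_in G A W B"
      unfolding D_def by (auto simp: commutators_in_def centralizer_mod_def)
    from commutators_in_commute[OF this B_subgroup A_subset W_sub] show ?thesis
      by (simp add: subset_C_iff W_sub)
  qed
  ultimately have "R0 = C"
    using betweenD(5)[OF nonabelian_headD(2)[OF R0]] by auto
  with R0 show ?thesis
    by simp
qed

text \<open>If \<open>P \<le> R\<close> is a term between \<open>B\<close> and \<open>A\<close> and is not contained in \<open>R0\<close>, then \<open>lift P = R\<close>, hence
  \<open>[R, A] \<le> P\<close>, because \<open>A\<close> commutes with \<open>lift P\<close> modulo \<open>P\<close>. So the smallest term \<open>N\<close> that contains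
  \<open>[R, A]\<close> lies below all such \<open>P\<close>, and everything that is strictly smaller than \<open>N\<close> lies in \<open>R0\<close>.\<close>

lemma head_restrict:
  assumes head: "nonabelian_head G T M C R R0"
  shows "\<exists>N. nonabelian_head G T A B N (N \<inter> R0)"
proof -
  note R = nonabelian_headD(1)[OF head] and R0 = nonabelian_headD(2)[OF head]
  note ps = nonabelian_headD(3)[OF head] and nab = nonabelian_headD(4)[OF head]
    and max = nonabelian_headD(5)[OF head]
  define N where "N = \<Inter>{P. between G T A B P \<and> commutators_in G R A P}"
  have R_sub: "R \<subseteq> carrier G"
    using between_M_subset[OF R] .
  have RA: "commutators_in G R A (R \<inter> A)"
    using R between_A_A by (rule commutators_between)
  have N: "between G T A B N"
    unfolding N_def using RA between_M_Int_A[OF R] by (intro between_Inter) auto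
  have N_sub: "N \<subseteq> R"
    unfolding N_def using RA between_M_Int_A[OF R] by auto
  have RAN: "commutators_in G R A N"
    by (auto simp: N_def commutators_in_def)
  have lift_eq: "lift P = R" if "P \<subseteq> R" "\<not> P \<subseteq> R0" for P
  proof -
    have "lift P \<subseteq> R"
      using R that by (intro lift_least)
    moreover have "between G T M C (lift P)"
      using that betweenD(6)[OF R] by (intro lift_between) auto
    ultimately show ?thesis
      using max[of "lift P"] that lift_superset[of P] by blast
  qed
  have N_least: "N \<subseteq> P" if P: "between G T A B P" and "P \<subseteq> R" "\<not> P \<subseteq> R0" for P
  proof -
    have "P \<subseteq> M"
      using betweenD(6)[OF P] A_subset_M by auto
    moreover have "commutators_in G P A P"
      using betweenD[OF P] A_subset by (intro commutators_in_invariant_left)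
    moreover have "commutators_in G C A P"
      using commutators_in_mono[OF commutators_C_A order_refl order_refl betweenD(5)[OF P]] .
    ultimately have "commutators_in G (lift P) A P"
      using betweenD(1)[OF P] A_subset between_invariant_M[OF P]
        invariant_under_mono[OF A_normal M_subset]
      by (intro commutators_lift)
    then show ?thesis
      unfolding lift_eq[OF that(2,3)] using P by (auto simp: N_def)
  qed
  have R_M: "\<not> commutators_in G R A R0"
  proof
    assume "commutators_in G R A R0"
    then have "A \<subseteq> centralizer_mod G M R R0"
      using commutators_in_commute[of R A R0] betweenD(2)[OF R0] R_sub A_subset
      by (simp add: subset_centralizer_mod_iff A_subset_M)
    moreover have "C \<subseteq> centralizer_mod G M R R0"
    proof -
      have "commutators_in G C R C"
        using C_subgroup R_sub invariant_under_mono[OF C_normal R_sub]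
        by (intro commutators_in_invariant_left)
      from commutators_in_mono[OF this order_refl order_refl betweenD(5)[OF R0]] show ?thesis
        by (simp add: subset_centralizer_mod_iff C_subset_M)
    qed
    moreover have "closed_subgroup G T (centralizer_mod G M R R0)"
      using M_closed betweenD(1,4)[OF R0] R_sub by (intro closed_subgroup_centralizer_mod)
    ultimately have "M \<subseteq> centralizer_mod G M R R0"
      by (intro M_least)
    then have "commutators_in G M R R0"
      by (simp add: subset_centralizer_mod_iff)
    from commutators_in_mono[OF this betweenD(6)[OF R] order_refl order_refl] nab show False
      by blast
  qed
  have N_R0: "\<not> N \<subseteq> R0"
    using commutators_in_mono[OF RAN order_refl order_refl] R_M by blast
  have "nonabelian_head G T A B N (N \<inter> R0)"
    unfolding nonabelian_head_def
  proof (intro conjI allI impI)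
    show "between G T A B N" by (fact N)
    have "N \<inter> (R0 \<inter> A) = N \<inter> R0"
      using betweenD(6)[OF N] by auto
    then show "between G T A B (N \<inter> R0)"
      using between_Int[OF N between_M_Int_A[OF R0]] by simp
    show "N \<inter> R0 \<subset> N"
      using N_R0 by auto
    show "P \<subseteq> N \<inter> R0" if P: "between G T A B P \<and> P \<subset> N" for P
      using P N_sub N_least[of P] by blast
    show "\<not> commutators_in G N N (N \<inter> R0)"
    proof
      assume "commutators_in G N N (N \<inter> R0)"
      then have NN: "commutators_in G N N R0"
        by (auto simp: commutators_in_def)
      have NM: "N \<subseteq> M"
        using betweenD(6)[OF N] A_subset_M by auto
      have CX: "commutators_in G C X R0" if X: "X \<subseteq> carrier G" for X
      proof -
        have "commutators_in G C X C"
          using C_subgroup X invariant_under_mono[OF C_normal X]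
          by (intro commutators_in_invariant_left)
        from commutators_in_mono[OF this order_refl order_refl betweenD(5)[OF R0]] show ?thesis .
      qed
      \<comment> \<open>Since \<open>lift N = R\<close>, the relation passes from \<open>N\<close> to \<open>R\<close>, one argument at a time.\<close>
      have "commutators_in G (lift N) N R0"
        by (rule commutators_lift[OF NM NN CX[OF between_A_subset[OF N]] between_A_subset[OF N]
              betweenD(1,4)[OF R0] between_invariant_M[OF N]])
      then have "commutators_in G R N R0"
        unfolding lift_eq[OF N_sub N_R0] .
      then have "commutators_in G N R R0"
        using betweenD(2)[OF R0] R_sub between_A_subset[OF N] by (rule commutators_in_commute)
      from commutators_lift[OF NM this CX[OF R_sub] R_sub betweenD(1,4)[OF R0] betweenD(4)[OF R]]
      have "commutators_in G (lift N) R R0" .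
      then show False
        using nab lift_eq[OF N_sub N_R0] by simp
    qed
  qed
  then show ?thesis
    by blast
qed

lemma ex_head_iff:
  "(\<exists>N N0. nonabelian_head G T A B N N0) \<longleftrightarrow> (\<exists>R R0. nonabelian_head G T M C R R0)"
  using head_lift head_restrict by blast

lemma ex_minimal_head_iff:
  "(\<exists>N. nonabelian_head G T A B N B) \<longleftrightarrow> (\<exists>R. nonabelian_head G T M C R C)"
proof
  assume "\<exists>R. nonabelian_head G T M C R C"
  then obtain N where N: "nonabelian_head G T A B N (N \<inter> C)"
    using head_restrict by blast
  then have "N \<inter> C = B"
    using betweenD(5,6)[OF nonabelian_headD(1)[OF N]] A_Int_C B_subset_C by auto
  with N show "\<exists>N. nonabelian_head G T A B N B"
    by auto
qed (use head_lift_minimal in blast)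

end

section \<open>Associated factors\<close>

context topological_group
begin

lemma nonabelian_chiefI: "F \<in> nonabelian_chief_factors G T \<Longrightarrow> nonabelian_chief G T (fst F) (snd F)"
  using topological_group_axioms
  by (simp add: nonabelian_chief_def nonabelian_chief_axioms_def)

lemma set_mult_superset_left: "\<lbrakk>X \<subseteq> carrier G; \<one> \<in> Y\<rbrakk> \<Longrightarrow> X \<subseteq> X <#> Y"
  by (force simp: set_mult_def)

lemma closure_set_mult_least:
  assumes "closed_subgroup G T H" "X \<subseteq> H" "Y \<subseteq> H"
  shows "T closure_of (X <#> Y) \<subseteq> H"
  using assms by (intro closure_of_minimal) (auto simp: set_mult_def closed_subgroup_def intro!: subgroup.m_closed)

lemma associated_commute:
  assumes "L1 \<lhd> G" "subgroup L2 G" "associated G T (K1, L1) (K2, L2)"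
  shows "associated G T (K2, L2) (K1, L1)"
  using assms commut_normal[of L2 L1] by (auto simp: associated_def)

text \<open>If \<open>c\<close> centralizes \<open>K1 / L1\<close>, then \<open>[c, k l] = [c, k] \<cdot> k [c, l] k\<^sup>-\<^sup>1\<close> shows that commutation with \<open>c\<close>
  maps \<open>K1 L2\<close> into \<open>L1 L2\<close>. By continuity it maps \<open>K2\<close>, which lies in the closure of \<open>K1 L2\<close>, into
  \<open>K2 \<inter> closure (L1 L2) = L2\<close>.\<close>

lemma associated_centralizer_subset:
  assumes F1: "(K1, L1) \<in> nonabelian_chief_factors G T"
    and F2: "(K2, L2) \<in> nonabelian_chief_factors G T"
    and as: "associated G T (K1, L1) (K2, L2)"
  shows "factor_centralizer G (K1, L1) \<subseteq> factor_centralizer G (K2, L2)"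
proof
  interpret F1: nonabelian_chief G T K1 L1
    using nonabelian_chiefI[OF F1] by simp
  interpret F2: nonabelian_chief G T K2 L2
    using nonabelian_chiefI[OF F2] by simp
  fix c assume c: "c \<in> factor_centralizer G (K1, L1)"
  then have cG: "c \<in> carrier G"
    by (simp add: factor_centralizer_def)
  have L2G: "L2 \<subseteq> carrier G"
    using F2.B_closed by (rule closed_subgroup_subset)
  have "commutator G c k \<in> L2" if k: "k \<in> K2" for k
  proof -
    have cont: "continuous_map T T (\<lambda>y. commutator G c y)"
      unfolding commutator_def using cG
      by (intro continuous_mult_map continuous_inv_map continuous_const continuous_id) auto
    have img: "commutator G c ` (K1 <#> L2) \<subseteq> L1 <#> L2"
    proof (clarsimp simp: set_mult_def)
      fix k l assume kl: "k \<in> K1" "l \<in> L2"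
      then have carr: "k \<in> carrier G" "l \<in> carrier G"
        using F1.A_subset L2G by auto
      have "commutator G c k \<in> L1"
        using c kl by (simp add: factor_centralizer_def commutator_def)
      moreover have "commutator G c l \<in> L2"
        using commutators_in_invariant_right[OF F2.B_normal F2.B_subgroup] cG kl
        by (simp add: commutators_in_def)
      then have "conjugation G k (commutator G c l) \<in> L2"
        using F2.B_normal carr by (simp add: invariant_underD)
      ultimately show "\<exists>x\<in>L1. \<exists>xa\<in>L2. commutator G c (k \<otimes> l) = x \<otimes> xa"
        using commutator_mult_right[of k l c] carr cG by blast
    qed
    have "\<one> \<in> L1"
      using F1.B_subgroup by (rule subgroup.one_closed)
    then have "K2 \<subseteq> K2 <#> L1"
      by (intro set_mult_superset_left F2.A_subset)
    moreover have "K2 <#> L1 \<subseteq> topspace T"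
      unfolding topspace_eq using F2.A_subset F1.B_subset_A F1.A_subset
      by (intro set_mult_closed) auto
    ultimately have "k \<in> T closure_of (K1 <#> L2)"
      using k as closure_of_subset[of "K2 <#> L1" T] by (auto simp: associated_def)
    then have "commutator G c k \<in> T closure_of (commutator G c ` (K1 <#> L2))"
      using continuous_map_image_closure_subset[OF cont] by blast
    then have "commutator G c k \<in> T closure_of (L1 <#> L2)"
      using closure_of_mono[OF img] by blast
    moreover have "commutator G c k \<in> K2"
      using commutators_in_invariant_right[OF F2.A_normal F2.A_subgroup] cG k
      by (simp add: commutators_in_def)
    ultimately show ?thesis
      using as by (auto simp: associated_def)
  qed
  then show "c \<in> factor_centralizer G (K2, L2)"
    using cG by (simp add: factor_centralizer_def commutator_def)
qed

lemma associated_factors: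
  assumes F1: "(K1, L1) \<in> nonabelian_chief_factors G T"
    and F2: "(K2, L2) \<in> nonabelian_chief_factors G T"
    and as: "associated G T (K1, L1) (K2, L2)"
  shows "associated G T (K2, L2) (K1, L1)"
    and "factor_centralizer G (K1, L1) = factor_centralizer G (K2, L2)"
    and "nonabelian_chief.M G T K1 L1 = nonabelian_chief.M G T K2 L2"
proof -
  interpret F1: nonabelian_chief G T K1 L1
    using nonabelian_chiefI[OF F1] by simp
  interpret F2: nonabelian_chief G T K2 L2
    using nonabelian_chiefI[OF F2] by simp
  show as': "associated G T (K2, L2) (K1, L1)"
    using as F1.B_normal F1.B_subgroup F2.B_subgroup
    by (intro associated_commute[OF _ _ as]) (simp_all add: normal_iff_invariant)
  show C: "factor_centralizer G (K1, L1) = factor_centralizer G (K2, L2)"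
    using associated_centralizer_subset[OF F1 F2 as] associated_centralizer_subset[OF F2 F1 as']
    by blast
  have CC: "F1.C = F2.C"
    using C by (simp add: F1.C_def F2.C_def)
  have sub: "K1 \<subseteq> T closure_of (K1 <#> L2)" "K2 \<subseteq> T closure_of (K2 <#> L1)"
  proof -
    have "K1 <#> L2 \<subseteq> topspace T" "K2 <#> L1 \<subseteq> topspace T"
      unfolding topspace_eq
      using F2.A_subset F1.A_subset F1.B_subset_A F2.B_subset_A by (intro set_mult_closed; blast)+
    then show "K1 \<subseteq> T closure_of (K1 <#> L2)" "K2 \<subseteq> T closure_of (K2 <#> L1)"
      using set_mult_superset_left[OF F1.A_subset subgroup.one_closed[OF F2.B_subgroup]]
        set_mult_superset_left[OF F2.A_subset subgroup.one_closed[OF F1.B_subgroup]] closure_of_subset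
      by blast+
  qed
  have eq: "T closure_of (K1 <#> L2) = T closure_of (K2 <#> L1)"
    using as by (simp add: associated_def)
  have "K1 \<subseteq> F2.M"
    using sub(1) closure_set_mult_least[OF F2.M_closed F2.A_subset_M, of L1]
      F1.B_subset_C F2.C_subset_M unfolding eq CC by blast
  moreover have "K2 \<subseteq> F1.M"
    using sub(2) closure_set_mult_least[OF F1.M_closed F1.A_subset_M, of L2]
      F2.B_subset_C F1.C_subset_M unfolding eq CC by blast
  ultimately show "F1.M = F2.M"
    using F1.M_least[OF F2.M_closed] F2.M_least[OF F1.M_closed] F1.C_subset_M F2.C_subset_M
    unfolding CC by blast
qed

lemma associated_refl:
  assumes "(K, L) \<in> nonabelian_chief_factors G T"
  shows "associated G T (K, L) (K, L)"
proof -
  interpret nonabelian_chief G T K L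
    using nonabelian_chiefI[OF assms] by simp
  have "L <#> L = L"
    using B_subgroup by (rule subgroup_mult_id)
  moreover have "T closure_of L = L"
    using B_closed by (simp add: closed_subgroup_def closure_of_closedin)
  ultimately show ?thesis
    using B_subset_A by (auto simp: associated_def)
qed

lemma chief_block_cases:
  assumes "\<aa> \<in> chief_blocks G T"
  obtains K L where "(K, L) \<in> nonabelian_chief_factors G T" "\<aa> = association G T `` {(K, L)}"
  using assms by (auto simp: chief_blocks_def quotient_def)

text \<open>Blocks are association classes of a single factor \<open>K / L\<close>, so two representatives are compared
  through \<open>K / L\<close>.\<close>

lemma chief_block_representatives:
  assumes "\<aa> \<in> chief_blocks G T" "(A, B) \<in> \<aa>" "(A', B') \<in> \<aa>"
  shows "nonabelian_chief G T A B"
    and "factor_centralizer G (A, B) = factor_centralizer G (A', B')"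
    and "nonabelian_chief.M G T A B = nonabelian_chief.M G T A' B'"
proof -
  obtain K L where KL: "(K, L) \<in> nonabelian_chief_factors G T" "\<aa> = association G T `` {(K, L)}"
    using assms(1) by (rule chief_block_cases)
  then have F: "(A, B) \<in> nonabelian_chief_factors G T" "associated G T (K, L) (A, B)"
    and F': "(A', B') \<in> nonabelian_chief_factors G T" "associated G T (K, L) (A', B')"
    using assms(2,3) by (auto simp: association_def)
  show "nonabelian_chief G T A B"
    using nonabelian_chiefI[OF F(1)] by simp
  show "factor_centralizer G (A, B) = factor_centralizer G (A', B')"
    "nonabelian_chief.M G T A B = nonabelian_chief.M G T A' B'"
    using associated_factors(2,3)[OF KL(1) F] associated_factors(2,3)[OF KL(1) F'] by metis+
qed

end

section \<open>Factors as topological groups\<close>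

text \<open>Products of quotient maps need not be quotient maps; for open maps they are. This is what makes
  multiplication on a quotient group continuous.\<close>

lemma quotient_map_prod:
  assumes q: "quotient_map X Y f" and o: "open_map X Y f"
  shows "quotient_map (prod_topology X X) (prod_topology Y Y) (\<lambda>(x, y). (f x, f y))"
proof (rule continuous_open_imp_quotient_map)
  have c: "continuous_map X Y f" and s: "f ` topspace X = topspace Y"
    using q by (simp_all add: quotient_imp_continuous_map quotient_imp_surjective_map)
  show "continuous_map (prod_topology X X) (prod_topology Y Y) (\<lambda>(x, y). (f x, f y))"
    unfolding case_prod_unfold
    using continuous_map_compose[OF continuous_map_fst c] continuous_map_compose[OF continuous_map_snd c]
    by (intro continuous_map_pairedI) (simp_all add: o_def)
  show "open_map (prod_topology X X) (prod_topology Y Y) (\<lambda>(x, y). (f x, f y))"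
    unfolding open_map_def
  proof (intro allI impI)
    fix W assume W: "openin (prod_topology X X) W"
    show "openin (prod_topology Y Y) ((\<lambda>(x, y). (f x, f y)) ` W)"
      unfolding openin_prod_topology_alt
    proof (intro allI impI)
      fix a b assume "(a, b) \<in> (\<lambda>(x, y). (f x, f y)) ` W"
      then obtain x y where xy: "(x, y) \<in> W" "a = f x" "b = f y"
        by auto
      then obtain U V where UV: "openin X U" "openin X V" "x \<in> U" "y \<in> V" "U \<times> V \<subseteq> W"
        using W unfolding openin_prod_topology_alt by meson
      have "f ` U \<times> f ` V \<subseteq> (\<lambda>(x, y). (f x, f y)) ` W"
        using UV(5) by force
      moreover have "openin Y (f ` U)" "openin Y (f ` V)"
        using o UV by (simp_all add: open_map_def)
      ultimately show "\<exists>U V. openin Y U \<and> openin Y V \<and> a \<in> U \<and> b \<in> V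
          \<and> U \<times> V \<subseteq> (\<lambda>(x, y). (f x, f y)) ` W"
        using UV xy by blast
    qed
  qed
  show "(\<lambda>(x, y). (f x, f y)) ` topspace (prod_topology X X) = topspace (prod_topology Y Y)"
    using s by (simp add: image_paired_Times)
qed

locale normal_section = topological_group +
  fixes K L :: "'a set"
  assumes K: "closed_subgroup G T K" and L: "closed_subgroup G T L"
    and inv: "invariant_under G K L" and LK: "L \<subseteq> K"
begin

abbreviation "Q \<equiv> factor_group G K L"
abbreviation "TQ \<equiv> factor_topology G T K L"
abbreviation "\<pi> \<equiv> r_coset G L"
abbreviation "TK \<equiv> subtopology T K"

lemma K_subgroup: "subgroup K G" and L_subgroup: "subgroup L G" and K_subset: "K \<subseteq> carrier G"
  using K L closed_subgroup_subset by (simp_all add: closed_subgroup_def)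

lemma L_normal: "L \<lhd> G\<lparr>carrier := K\<rparr>"
proof -
  interpret K: group "G\<lparr>carrier := K\<rparr>"
    using K_subgroup by (rule subgroup_imp_group)
  have "subgroup L (G\<lparr>carrier := K\<rparr>)"
    using LK by (rule subgroup_incl[OF L_subgroup K_subgroup])
  moreover have "conjugation (G\<lparr>carrier := K\<rparr>) x y = conjugation G x y" if "x \<in> K" for x y
    using that K_subgroup by (simp add: conjugation_def m_inv_consistent)
  ultimately show ?thesis
    using inv by (auto simp: K.normal_iff_invariant invariant_under_def)
qed

sublocale LN: normal L "G\<lparr>carrier := K\<rparr>"
  by (rule L_normal)

lemma Q_group: "group Q"
  unfolding factor_group_def by (rule LN.factorgroup_is_group)

sublocale Q: group Q
  by (rule Q_group)

lemma carrier_Q: "carrier Q = \<pi> ` K"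
  by (rule carrier_factor_group)

lemma one_Q: "\<one>\<^bsub>Q\<^esub> = L"
  by (simp add: factor_group_def)

lemma pi_closed [simp]: "x \<in> K \<Longrightarrow> \<pi> x \<in> carrier Q"
  by (simp add: carrier_Q)

lemma K_mult: "\<lbrakk>x \<in> K; y \<in> K\<rbrakk> \<Longrightarrow> x \<otimes> y \<in> K" and K_inv: "x \<in> K \<Longrightarrow> inv x \<in> K"
  and K_one: "\<one> \<in> K" and K_carrier: "x \<in> K \<Longrightarrow> x \<in> carrier G"
  using K_subgroup K_subset
  by (auto simp: subgroup.m_closed subgroup.m_inv_closed subgroup.one_closed)

lemma pi_mult: "\<lbrakk>x \<in> K; y \<in> K\<rbrakk> \<Longrightarrow> \<pi> x \<otimes>\<^bsub>Q\<^esub> \<pi> y = \<pi> (x \<otimes> y)"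
  using LN.rcos_sum[of x y] by (simp add: mult_factor_group)

lemma pi_eq_iff: "\<lbrakk>x \<in> K; y \<in> K\<rbrakk> \<Longrightarrow> \<pi> x = \<pi> y \<longleftrightarrow> x \<otimes> inv y \<in> L"
  using coset_eq_iff[OF L_subgroup] K_carrier by simp

lemma pi_one: "\<pi> \<one> = \<one>\<^bsub>Q\<^esub>"
  using L_subgroup by (simp add: one_Q coset_mult_one subgroup.subset)

lemma pi_eq_one_iff: "x \<in> K \<Longrightarrow> \<pi> x = \<one>\<^bsub>Q\<^esub> \<longleftrightarrow> x \<in> L"
  using pi_eq_iff[of x \<one>] K_one K_carrier by (simp add: pi_one)

lemma pi_inv: "x \<in> K \<Longrightarrow> inv\<^bsub>Q\<^esub> \<pi> x = \<pi> (inv x)"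
  by (rule Q.inv_equality) (simp_all add: pi_mult K_inv K_carrier pi_one K_mult)

lemma pi_commutator: "\<lbrakk>x \<in> K; y \<in> K\<rbrakk> \<Longrightarrow> commutator Q (\<pi> x) (\<pi> y) = \<pi> (commutator G x y)"
  unfolding commutator_def by (simp only: pi_mult pi_inv K_mult K_inv)

lemma pi_conjugation: "\<lbrakk>x \<in> K; y \<in> K\<rbrakk> \<Longrightarrow> conjugation Q (\<pi> x) (\<pi> y) = \<pi> (conjugation G x y)"
  unfolding conjugation_def by (simp only: pi_mult pi_inv K_mult K_inv)

lemma topspace_TK: "topspace TK = K"
  using K_subset by (auto simp: topspace_eq topspace_subtopology)

lemma topspace_TQ: "topspace TQ = carrier Q"
  by (simp only: factor_topology_def topspace_quotient_topology topspace_TK carrier_Q)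

lemma quotient_pi: "quotient_map TK TQ \<pi>"
  unfolding factor_topology_def by (rule quotient_map_quotient_topology)

lemma continuous_TK:
  "\<lbrakk>continuous_map X T f; f \<in> topspace X \<rightarrow> K\<rbrakk> \<Longrightarrow> continuous_map X TK f"
  by (simp add: continuous_map_in_subtopology Pi_iff image_subset_iff)

lemma continuous_inclusion: "continuous_map TK T (\<lambda>x. x)"
  using continuous_map_from_subtopology[OF continuous_id] .

text \<open>The saturation of an open set \<open>U\<close> is \<open>L U\<close>, a union of translates of \<open>U\<close>.\<close>

lemma open_pi: "open_map TK TQ \<pi>"
  unfolding open_map_def
proof (intro allI impI)
  fix U assume U: "openin TK U"
  then have UK: "U \<subseteq> K"
    using openin_subset topspace_TK by metis
  have "{x \<in> K. \<pi> x \<in> \<pi> ` U} = (\<Union>l\<in>L. {x \<in> K. l \<otimes> x \<in> U})"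
  proof (intro equalityI subsetI)
    fix x assume "x \<in> {x \<in> K. \<pi> x \<in> \<pi> ` U}"
    then obtain u where u: "x \<in> K" "u \<in> U" "\<pi> u = \<pi> x"
      by force
    then have "u \<otimes> inv x \<in> L" "u \<in> carrier G" "x \<in> carrier G"
      using UK K_carrier pi_eq_iff by auto
    then have "u \<otimes> inv x \<in> L" "u \<otimes> inv x \<otimes> x \<in> U"
      using u by (auto simp: m_assoc)
    then show "x \<in> (\<Union>l\<in>L. {x \<in> K. l \<otimes> x \<in> U})"
      using u by blast
  next
    fix x assume "x \<in> (\<Union>l\<in>L. {x \<in> K. l \<otimes> x \<in> U})"
    then obtain l where l: "l \<in> L" "x \<in> K" "l \<otimes> x \<in> U"
      by auto
    moreover from this have "\<pi> (l \<otimes> x) = \<pi> x"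
      using UK K_carrier LK by (subst pi_eq_iff) (auto simp: m_assoc)
    ultimately show "x \<in> {x \<in> K. \<pi> x \<in> \<pi> ` U}"
      by (metis (mono_tags, lifting) CollectI imageI)
  qed
  moreover have "openin TK {x \<in> K. l \<otimes> x \<in> U}" if "l \<in> L" for l
  proof -
    have l: "l \<in> K"
      using that LK by auto
    then have "continuous_map TK TK (\<lambda>x. l \<otimes> x)"
      using K_carrier K_mult
      by (intro continuous_TK continuous_mult_map continuous_const continuous_inclusion)
        (auto simp: topspace_TK simp del: topspace_subtopology)
    from openin_continuous_map_preimage[OF this U] show ?thesis
      by (simp only: topspace_TK)
  qed
  ultimately have "openin TK {x \<in> K. \<pi> x \<in> \<pi> ` U}"
    by auto
  then show "openin TQ (\<pi> ` U)"
    using UK unfolding factor_topology_def openin_quotient_topology topspace_TK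
    by (simp add: image_mono)
qed

lemma topological_group_Q: "topological_group Q TQ"
proof (rule topological_group.intro[OF Q_group topological_group_axioms.intro])
  show "topspace TQ = carrier Q"
    by (rule topspace_TQ)
  have cpi: "continuous_map TK TQ \<pi>"
    using quotient_pi by (rule quotient_imp_continuous_map)
  show "continuous_map (prod_topology TQ TQ) TQ (\<lambda>(x, y). x \<otimes>\<^bsub>Q\<^esub> y)"
  proof (rule continuous_compose_quotient_map[OF quotient_map_prod[OF quotient_pi open_pi]])
    have "continuous_map (prod_topology TK TK) TK (\<lambda>p. fst p \<otimes> snd p)"
      using K_mult topspace_TK
      by (intro continuous_TK continuous_mult_map
          continuous_map_compose[OF continuous_map_fst continuous_inclusion, unfolded o_def]
          continuous_map_compose[OF continuous_map_snd continuous_inclusion, unfolded o_def]) auto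
    from continuous_map_compose[OF this cpi]
    have "continuous_map (prod_topology TK TK) TQ (\<lambda>p. \<pi> (fst p \<otimes> snd p))"
      by (simp add: o_def)
    then show "continuous_map (prod_topology TK TK) TQ ((\<lambda>(x, y). x \<otimes>\<^bsub>Q\<^esub> y) \<circ> (\<lambda>(x, y). (\<pi> x, \<pi> y)))"
      by (rule continuous_map_eq) (auto simp: topspace_TK pi_mult)
  qed
  show "continuous_map TQ TQ (\<lambda>x. inv\<^bsub>Q\<^esub> x)"
  proof (rule continuous_compose_quotient_map[OF quotient_pi])
    have "continuous_map TK TK (\<lambda>x. inv x)"
      using K_inv topspace_TK by (intro continuous_TK continuous_inv_map continuous_inclusion) auto
    from continuous_map_compose[OF this cpi]
    show "continuous_map TK TQ ((\<lambda>x. inv\<^bsub>Q\<^esub> x) \<circ> \<pi>)"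
      by (rule continuous_map_eq) (auto simp: topspace_TK pi_inv simp del: topspace_subtopology)
  qed
qed

sublocale Q: topological_group Q TQ
  by (rule topological_group_Q)

definition preim :: "'a set set \<Rightarrow> 'a set" where
  "preim X = {x \<in> K. \<pi> x \<in> X}"

lemma closedin_TQ_iff: "X \<subseteq> carrier Q \<Longrightarrow> closedin TQ X \<longleftrightarrow> closedin T (preim X)"
proof -
  assume X: "X \<subseteq> carrier Q"
  have "closedin TQ X \<longleftrightarrow> closedin TK (preim X)"
    using quotient_pi X unfolding quotient_map_closedin preim_def topspace_TQ topspace_TK by simp
  also have "\<dots> \<longleftrightarrow> closedin T (preim X)"
    using K by (subst closedin_closed_subtopology) (auto simp: closed_subgroup_def preim_def)
  finally show ?thesis .
qed

lemma preim_image: "\<lbrakk>L \<subseteq> P; P \<subseteq> K; subgroup P G\<rbrakk> \<Longrightarrow> preim (\<pi> ` P) = P"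
proof (intro equalityI subsetI)
  fix x assume P: "L \<subseteq> P" "P \<subseteq> K" "subgroup P G" and "x \<in> preim (\<pi> ` P)"
  then obtain p where p: "p \<in> P" "\<pi> x = \<pi> p" "x \<in> K"
    by (auto simp: preim_def)
  then have "x \<otimes> inv p \<in> P"
    using P pi_eq_iff[of x p] by blast
  then have "x \<otimes> inv p \<otimes> p \<in> P"
    using P p by (simp add: subgroup.m_closed)
  then show "x \<in> P"
    using p P K_carrier by (auto simp: m_assoc)
qed (auto simp: preim_def)

lemma image_preim: "X \<subseteq> carrier Q \<Longrightarrow> \<pi> ` preim X = X"
  by (auto simp: preim_def carrier_Q)

lemma closed_subgroup_preim:
  assumes X: "closed_subgroup Q TQ X"
  shows "closed_subgroup G T (preim X)" "L \<subseteq> preim X"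
proof -
  have sub: "subgroup X Q" and cl: "closedin TQ X" and XQ: "X \<subseteq> carrier Q"
    using X Q.closed_subgroup_subset by (auto simp: closed_subgroup_def)
  have "subgroup (preim X) G"
  proof (rule subgroupI)
    show "preim X \<subseteq> carrier G"
      by (auto simp: preim_def K_carrier)
    have "\<one> \<in> preim X"
      using sub by (simp add: preim_def K_one pi_one subgroup.one_closed)
    then show "preim X \<noteq> {}"
      by blast
    show "inv a \<in> preim X" if "a \<in> preim X" for a
      using that sub by (auto simp: preim_def K_inv subgroup.m_inv_closed simp flip: pi_inv)
    show "a \<otimes> b \<in> preim X" if "a \<in> preim X" "b \<in> preim X" for a b
      using that sub
      by (auto simp: preim_def K_mult subgroup.m_closed simp flip: pi_mult)
  qed
  then show "closed_subgroup G T (preim X)"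
    using cl XQ by (simp add: closed_subgroup_def closedin_TQ_iff)
  show "L \<subseteq> preim X"
  proof
    fix l assume l: "l \<in> L"
    then have "\<pi> l = \<one>\<^bsub>Q\<^esub>"
      using LK pi_eq_one_iff by auto
    then show "l \<in> preim X"
      using l LK sub subgroup.one_closed by (auto simp: preim_def)
  qed
qed

lemma between_preim:
  assumes X: "between Q TQ (carrier Q) {\<one>\<^bsub>Q\<^esub>} X"
  shows "between G T K L (preim X)"
proof -
  note D = betweenD[OF X]
  have "invariant_under G K (preim X)"
    unfolding invariant_under_def
  proof (intro ballI)
    fix g x assume gx: "g \<in> K" "x \<in> preim X"
    then have "conjugation Q (\<pi> g) (\<pi> x) \<in> X"
      using D(4) by (auto simp: preim_def intro: invariant_underD)
    then have "\<pi> (conjugation G g x) \<in> X"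
      using gx pi_conjugation[of g x] by (simp add: preim_def)
    moreover have "conjugation G g x \<in> K"
      using gx by (simp add: preim_def conjugation_def K_mult K_inv)
    ultimately show "conjugation G g x \<in> preim X"
      by (simp add: preim_def)
  qed
  with closed_subgroup_preim[OF D(1)] show ?thesis
    by (auto simp: between_def preim_def)
qed

lemma between_image:
  assumes P: "between G T K L P"
  shows "between Q TQ (carrier Q) {\<one>\<^bsub>Q\<^esub>} (\<pi> ` P)"
proof -
  note D = betweenD[OF P]
  have PQ: "\<pi> ` P \<subseteq> carrier Q"
    using D(6) by auto
  have "subgroup (\<pi> ` P) Q"
  proof (rule Q.subgroupI[OF PQ])
    show "\<pi> ` P \<noteq> {}"
      using subgroup.one_closed[OF D(2)] by blast
    show "inv\<^bsub>Q\<^esub> a \<in> \<pi> ` P" if "a \<in> \<pi> ` P" for a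
      using that D(2,6) by (auto simp: pi_inv subset_iff subgroup.m_inv_closed)
    show "a \<otimes>\<^bsub>Q\<^esub> b \<in> \<pi> ` P" if ab: "a \<in> \<pi> ` P" "b \<in> \<pi> ` P" for a b
    proof -
      obtain x y where "a = \<pi> x" "b = \<pi> y" "x \<in> P" "y \<in> P"
        using ab by blast
      then show ?thesis
        using D(2,6) pi_mult[of x y] subgroup.m_closed[OF D(2), of x y] by auto
    qed
  qed
  moreover have "closedin TQ (\<pi> ` P)"
    using PQ D by (simp add: closedin_TQ_iff preim_image)
  moreover have "invariant_under Q (carrier Q) (\<pi> ` P)"
    using D(4,6) by (auto simp: invariant_under_def carrier_Q pi_conjugation subset_iff)
  moreover have "\<one>\<^bsub>Q\<^esub> \<in> \<pi> ` P"
    using subgroup.one_closed[OF D(2)] pi_one by (metis imageI)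
  ultimately show ?thesis
    using PQ by (simp add: between_def closed_subgroup_def)
qed

lemma image_pi_mono_iff:
  assumes "between G T K L P" "between G T K L P'"
  shows "\<pi> ` P \<subseteq> \<pi> ` P' \<longleftrightarrow> P \<subseteq> P'"
proof
  assume "\<pi> ` P \<subseteq> \<pi> ` P'"
  then have "preim (\<pi> ` P) \<subseteq> preim (\<pi> ` P')"
    by (auto simp: preim_def)
  then show "P \<subseteq> P'"
    using betweenD[OF assms(1)] betweenD[OF assms(2)] by (simp add: preim_image)
qed auto

lemma commutators_in_image_iff:
  assumes "X \<subseteq> K" "Y \<subseteq> K" and P: "between G T K L P"
  shows "commutators_in Q (\<pi> ` X) (\<pi> ` Y) (\<pi> ` P) \<longleftrightarrow> commutators_in G X Y P"
proof -
  have "commutator Q (\<pi> x) (\<pi> y) \<in> \<pi> ` P \<longleftrightarrow> commutator G x y \<in> P" if xy: "x \<in> X" "y \<in> Y" for x y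
  proof -
    have xyK: "x \<in> K" "y \<in> K"
      using xy assms by auto
    then have "commutator G x y \<in> K"
      by (simp add: commutator_def K_mult K_inv)
    then have "\<pi> (commutator G x y) \<in> \<pi> ` P \<longleftrightarrow> commutator G x y \<in> preim (\<pi> ` P)"
      by (simp add: preim_def)
    also have "\<dots> \<longleftrightarrow> commutator G x y \<in> P"
      using betweenD[OF P] by (simp add: preim_image)
    finally show ?thesis
      using xyK by (simp add: pi_commutator)
  qed
  then show ?thesis
    by (auto simp: commutators_in_def)
qed

text \<open>The correspondence theorem identifies the poset of \<open>(K, L)\<close> with the closed normal subgroups of the
  factor, and it respects commutators.\<close>

lemma head_image_iff:
  assumes N: "between G T K L N" and N0: "between G T K L N0"
  shows "nonabelian_head Q TQ (carrier Q) {\<one>\<^bsub>Q\<^esub>} (\<pi> ` N) (\<pi> ` N0)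
    \<longleftrightarrow> nonabelian_head G T K L N N0"
proof -
  have ps: "\<pi> ` P \<subset> \<pi> ` P' \<longleftrightarrow> P \<subset> P'" if "between G T K L P" "between G T K L P'" for P P'
    using image_pi_mono_iff that by (simp add: less_le_not_le)
  have "(\<forall>X. between Q TQ (carrier Q) {\<one>\<^bsub>Q\<^esub>} X \<and> X \<subset> \<pi> ` N \<longrightarrow> X \<subseteq> \<pi> ` N0) \<longleftrightarrow>
      (\<forall>P. between G T K L P \<and> P \<subset> N \<longrightarrow> P \<subseteq> N0)" (is "?l \<longleftrightarrow> ?r")
  proof
    assume ?l
    then show ?r
      using between_image ps image_pi_mono_iff N N0 by meson
  next
    assume r: ?r
    show ?l
    proof (intro allI impI)
      fix X assume X: "between Q TQ (carrier Q) {\<one>\<^bsub>Q\<^esub>} X \<and> X \<subset> \<pi> ` N"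
      then have eq: "X = \<pi> ` preim X"
        using image_preim betweenD(6) by metis
      have "between G T K L (preim X)"
        using X between_preim by blast
      moreover from this have "preim X \<subset> N"
        using X eq ps N by metis
      ultimately have "preim X \<subseteq> N0"
        using r by blast
      then show "X \<subseteq> \<pi> ` N0"
        using eq by blast
    qed
  qed
  then show ?thesis
    using commutators_in_image_iff[OF _ _ N0, of N N] betweenD(6)[OF N] ps[OF N0 N] N N0
      between_image[OF N] between_image[OF N0]
    unfolding nonabelian_head_def by simp
qed

lemma ex_head_factor:
  "(\<exists>X X0. nonabelian_head Q TQ (carrier Q) {\<one>\<^bsub>Q\<^esub>} X X0) \<longleftrightarrow> (\<exists>N N0. nonabelian_head G T K L N N0)"
proof
  assume "\<exists>X X0. nonabelian_head Q TQ (carrier Q) {\<one>\<^bsub>Q\<^esub>} X X0"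
  then obtain X X0 where X: "nonabelian_head Q TQ (carrier Q) {\<one>\<^bsub>Q\<^esub>} X X0"
    by blast
  note b = nonabelian_headD(1,2)[OF X]
  have "X = \<pi> ` preim X" "X0 = \<pi> ` preim X0"
    using b[THEN betweenD(6)] by (simp_all add: image_preim)
  with X have "nonabelian_head G T K L (preim X) (preim X0)"
    using head_image_iff[OF b[THEN between_preim]] by simp
  then show "\<exists>N N0. nonabelian_head G T K L N N0"
    by blast
next
  assume "\<exists>N N0. nonabelian_head G T K L N N0"
  then obtain N N0 where N: "nonabelian_head G T K L N N0"
    by blast
  then show "\<exists>X X0. nonabelian_head Q TQ (carrier Q) {\<one>\<^bsub>Q\<^esub>} X X0"
    using head_image_iff[OF nonabelian_headD(1,2)[OF N]] by blast
qed

lemma image_pi_L: "\<pi> ` L = {\<one>\<^bsub>Q\<^esub>}"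
proof
  show "\<pi> ` L \<subseteq> {\<one>\<^bsub>Q\<^esub>}"
    using LK pi_eq_one_iff by blast
  show "{\<one>\<^bsub>Q\<^esub>} \<subseteq> \<pi> ` L"
    using subgroup.one_closed[OF L_subgroup] pi_one by force
qed

lemma between_L: "between G T K L L"
  using L inv LK by (simp add: between_def)

lemma closed_one_Q: "closedin TQ {\<one>\<^bsub>Q\<^esub>}"
  using betweenD(3)[OF between_image[OF between_L]] by (simp add: image_pi_L)

lemma ex_minimal_head_factor:
  "(\<exists>X. nonabelian_head Q TQ (carrier Q) {\<one>\<^bsub>Q\<^esub>} X {\<one>\<^bsub>Q\<^esub>}) \<longleftrightarrow> (\<exists>N. nonabelian_head G T K L N L)"
proof
  assume "\<exists>X. nonabelian_head Q TQ (carrier Q) {\<one>\<^bsub>Q\<^esub>} X {\<one>\<^bsub>Q\<^esub>}"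
  then obtain X where X: "nonabelian_head Q TQ (carrier Q) {\<one>\<^bsub>Q\<^esub>} X {\<one>\<^bsub>Q\<^esub>}"
    by blast
  note b = nonabelian_headD(1)[OF X]
  have "X = \<pi> ` preim X"
    using betweenD(6)[OF b] by (simp add: image_preim)
  with X have "nonabelian_head G T K L (preim X) L"
    using head_image_iff[OF between_preim[OF b] between_L] by (simp add: image_pi_L)
  then show "\<exists>N. nonabelian_head G T K L N L"
    by blast
next
  assume "\<exists>N. nonabelian_head G T K L N L"
  then obtain N where N: "nonabelian_head G T K L N L"
    by blast
  then show "\<exists>X. nonabelian_head Q TQ (carrier Q) {\<one>\<^bsub>Q\<^esub>} X {\<one>\<^bsub>Q\<^esub>}"
    using head_image_iff[OF nonabelian_headD(1,2)[OF N]] image_pi_L by auto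
qed

end

text \<open>Conjugation by elements of \<open>G\<close> induces topological automorphisms of \<open>K / L\<close>. A closed subgroup that all
  of them preserve has a preimage that is normal in \<open>G\<close> and lies between \<open>L\<close> and \<open>K\<close>.\<close>

lemma (in topological_group) chief_factor_top_char_simple:
  assumes chief: "chief_factor G T (K, L)"
  shows "top_char_simple (factor_group G K L) (factor_topology G T K L)"
proof -
  note D = chief_factorD[OF chief]
  interpret normal_section G T K L
    using D closed_subgroup_subset[OF D(1)]
    by unfold_locales (auto simp: invariant_under_def)
  define \<psi> where "\<psi> g X = conjugation G g ` X" for g X
  have \<psi>_pi: "\<psi> g (\<pi> x) = \<pi> (conjugation G g x)" if g: "g \<in> carrier G" and x: "x \<in> K" for g x
  proof -
    have "conjugation G g ` L = L"
      using D(3,4) g closed_subgroup_subset by (intro conj_image_invariant) auto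
    then have "\<pi> (conjugation G g x) = (conjugation G g ` L) #> conjugation G g x"
      by simp
    also have "\<dots> = \<psi> g (\<pi> x)"
      using g x K_carrier LK by (auto simp: \<psi>_def r_coset_def conjugation_mult subset_iff image_iff)
    finally show ?thesis
      by simp
  qed
  have cjK: "conjugation G g x \<in> K" if "g \<in> carrier G" "x \<in> K" for g x
    using that D(2) by (simp add: invariant_underD)
  have inverse: "\<psi> (inv g) (\<psi> g X) = X" "\<psi> g (\<psi> (inv g) X) = X"
    if "g \<in> carrier G" "X \<in> carrier Q" for g X
    using that by (auto simp: carrier_Q \<psi>_pi cjK K_carrier)
  have closed: "\<psi> g X \<in> carrier Q" if "g \<in> carrier G" "X \<in> carrier Q" for g X
    using that by (auto simp: carrier_Q \<psi>_pi cjK)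
  have cont: "continuous_map TQ TQ (\<psi> g)" if g: "g \<in> carrier G" for g
  proof (rule continuous_compose_quotient_map[OF quotient_pi])
    have "continuous_map TK TK (conjugation G g)"
      using g cjK topspace_TK
      by (intro continuous_TK continuous_map_from_subtopology continuous_conjugation) auto
    from continuous_map_compose[OF this quotient_imp_continuous_map[OF quotient_pi]]
    show "continuous_map TK TQ (\<psi> g \<circ> \<pi>)"
      by (rule continuous_map_eq) (auto simp: topspace_TK \<psi>_pi g simp del: topspace_subtopology)
  qed
  have aut: "\<psi> g \<in> top_aut Q TQ" if g: "g \<in> carrier G" for g
  proof -
    have "homeomorphic_maps TQ TQ (\<psi> g) (\<psi> (inv g))"
      using cont[OF g] cont[of "inv g"] g inverse by (simp add: homeomorphic_maps_def topspace_TQ)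
    then have h: "homeomorphic_map TQ TQ (\<psi> g)"
      using homeomorphic_maps_map by blast
    have "bij_betw (\<psi> g) (carrier Q) (carrier Q)"
      using homeomorphic_imp_injective_map[OF h] homeomorphic_imp_surjective_map[OF h]
      by (simp add: bij_betw_def topspace_TQ)
    moreover have "\<psi> g \<in> hom Q Q"
    proof (rule homI)
      show "\<psi> g X \<in> carrier Q" if "X \<in> carrier Q" for X
        using closed g that by blast
      fix X Y assume "X \<in> carrier Q" "Y \<in> carrier Q"
      then obtain x y where xy: "X = \<pi> x" "Y = \<pi> y" "x \<in> K" "y \<in> K"
        by (auto simp: carrier_Q)
      show "\<psi> g (X \<otimes>\<^bsub>Q\<^esub> Y) = \<psi> g X \<otimes>\<^bsub>Q\<^esub> \<psi> g Y"
        unfolding xy using xy g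
        by (simp only: pi_mult \<psi>_pi K_mult cjK conjugation_mult K_carrier)
    qed
    ultimately show ?thesis
      using h by (simp add: top_aut_def iso_def)
  qed
  have "H = {\<one>\<^bsub>Q\<^esub>} \<or> H = carrier Q"
    if H: "closed_subgroup Q TQ H" and inv: "\<forall>\<psi>\<in>top_aut Q TQ. \<psi> ` H = H" for H
  proof -
    have HQ: "H \<subseteq> carrier Q"
      using H by (rule Q.closed_subgroup_subset)
    have "invariant_under G (carrier G) (preim H)"
      unfolding invariant_under_def
    proof (intro ballI)
      fix g x assume g: "g \<in> carrier G" and x: "x \<in> preim H"
      have "\<psi> g (\<pi> x) \<in> H"
        using inv aut[OF g] x by (auto simp: preim_def)
      then show "conjugation G g x \<in> preim H"
        using x g by (simp add: preim_def \<psi>_pi cjK)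
    qed
    then have "preim H = L \<or> preim H = K"
      using closed_subgroup_preim[OF H] by (intro D(6)) (auto simp: preim_def)
    then have "\<pi> ` preim H = {\<one>\<^bsub>Q\<^esub>} \<or> \<pi> ` preim H = carrier Q"
      using image_pi_L carrier_Q by auto
    then show ?thesis
      by (simp add: image_preim HQ)
  qed
  moreover have "carrier Q \<noteq> {\<one>\<^bsub>Q\<^esub>}"
  proof
    assume "carrier Q = {\<one>\<^bsub>Q\<^esub>}"
    then have "K \<subseteq> L"
      using pi_closed pi_eq_one_iff by blast
    then show False
      using D(5) by blast
  qed
  ultimately show ?thesis
    using topological_group_Q by (simp add: top_char_simple_def)
qed

section \<open>Topological automorphisms\<close>

context topological_group
begin

lemma top_autD:
  assumes "\<psi> \<in> top_aut G T"
  shows "\<psi> \<in> hom G G" "inj_on \<psi> (carrier G)" "\<psi> ` carrier G = carrier G" "homeomorphic_map T T \<psi>"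
  using assms by (auto simp: top_aut_def iso_def bij_betw_def)

lemma top_aut_closed: "\<lbrakk>\<psi> \<in> top_aut G T; x \<in> carrier G\<rbrakk> \<Longrightarrow> \<psi> x \<in> carrier G"
  using top_autD(3) by blast

lemma top_aut_mult:
  "\<lbrakk>\<psi> \<in> top_aut G T; x \<in> carrier G; y \<in> carrier G\<rbrakk> \<Longrightarrow> \<psi> (x \<otimes> y) = \<psi> x \<otimes> \<psi> y"
  using top_autD(1) by (rule hom_mult)

lemma top_aut_group_hom: "\<psi> \<in> top_aut G T \<Longrightarrow> group_hom G G \<psi>"
  using top_autD(1) is_group by (simp add: group_hom_def group_hom_axioms_def)

lemma top_aut_inv: "\<lbrakk>\<psi> \<in> top_aut G T; x \<in> carrier G\<rbrakk> \<Longrightarrow> \<psi> (inv x) = inv (\<psi> x)"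
  using group_hom.hom_inv[OF top_aut_group_hom] by simp

lemma top_aut_conjugation:
  "\<lbrakk>\<psi> \<in> top_aut G T; x \<in> carrier G; y \<in> carrier G\<rbrakk> \<Longrightarrow> \<psi> (conjugation G x y) = conjugation G (\<psi> x) (\<psi> y)"
  by (simp add: conjugation_def top_aut_mult top_aut_inv)

lemma top_aut_commutator:
  "\<lbrakk>\<psi> \<in> top_aut G T; x \<in> carrier G; y \<in> carrier G\<rbrakk> \<Longrightarrow> \<psi> (commutator G x y) = commutator G (\<psi> x) (\<psi> y)"
  by (simp add: commutator_def top_aut_mult top_aut_inv)

lemma top_aut_id: "(\<lambda>x. x) \<in> top_aut G T"
  using homeomorphic_map_id[of T T] by (simp add: top_aut_def iso_def hom_def bij_betw_def id_def)

lemma top_aut_comp: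
  assumes "\<psi> \<in> top_aut G T" "\<phi> \<in> top_aut G T"
  shows "(\<lambda>x. \<psi> (\<phi> x)) \<in> top_aut G T"
proof -
  have "homeomorphic_map T T (\<psi> \<circ> \<phi>)"
    using top_autD(4)[OF assms(2)] top_autD(4)[OF assms(1)] by (rule homeomorphic_map_compose)
  moreover have "\<psi> \<circ> \<phi> \<in> iso G G"
    using assms by (intro iso_set_trans[of \<phi> G G \<psi> G]) (auto simp: top_aut_def)
  ultimately show ?thesis
    by (simp add: top_aut_def o_def)
qed

lemma top_aut_inverse:
  assumes "\<psi> \<in> top_aut G T"
  obtains \<phi> where "\<phi> \<in> top_aut G T" "\<forall>x\<in>carrier G. \<psi> (\<phi> x) = x"
    "\<forall>x\<in>carrier G. \<phi> (\<psi> x) = x"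
proof -
  obtain \<phi> where \<phi>: "homeomorphic_maps T T \<psi> \<phi>"
    using top_autD(4)[OF assms] homeomorphic_map_maps by blast
  then have inv: "\<forall>x\<in>carrier G. \<psi> (\<phi> x) = x" "\<forall>x\<in>carrier G. \<phi> (\<psi> x) = x"
    and h: "homeomorphic_map T T \<phi>"
    unfolding homeomorphic_maps_map topspace_eq by auto
  have bij: "bij_betw \<phi> (carrier G) (carrier G)"
    using homeomorphic_imp_injective_map[OF h] homeomorphic_imp_surjective_map[OF h]
    by (simp add: bij_betw_def topspace_eq)
  then have closed: "\<phi> x \<in> carrier G" if "x \<in> carrier G" for x
    using that by (auto simp: bij_betw_def)
  have "\<phi> (x \<otimes> y) = \<phi> x \<otimes> \<phi> y" if xy: "x \<in> carrier G" "y \<in> carrier G" for x y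
  proof -
    have "x \<otimes> y = \<psi> (\<phi> x \<otimes> \<phi> y)"
      using xy closed by (simp add: top_aut_mult[OF assms] inv(1))
    then show ?thesis
      using xy closed by (simp add: inv(2))
  qed
  then have "\<phi> \<in> top_aut G T"
    using h bij closed by (simp add: top_aut_def iso_def hom_def)
  then show thesis
    using inv that by blast
qed

lemma top_aut_closed_subgroup:
  assumes \<psi>: "\<psi> \<in> top_aut G T" and H: "closed_subgroup G T H"
  shows "closed_subgroup G T (\<psi> ` H)"
proof -
  have "subgroup (\<psi> ` H) G"
    using H group_hom.subgroup_img_is_subgroup[OF top_aut_group_hom[OF \<psi>]]
    by (simp add: closed_subgroup_def)
  moreover have "closedin T (\<psi> ` H)"
    using H homeomorphic_imp_closed_map[OF top_autD(4)[OF \<psi>]]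
    by (simp add: closed_subgroup_def closed_map_def)
  ultimately show ?thesis
    by (simp add: closed_subgroup_def)
qed

lemma top_aut_invariant:
  assumes \<psi>: "\<psi> \<in> top_aut G T" and H: "invariant_under G (carrier G) H" "H \<subseteq> carrier G"
  shows "invariant_under G (carrier G) (\<psi> ` H)"
  unfolding invariant_under_def
proof (intro ballI)
  fix g x assume g: "g \<in> carrier G" and "x \<in> \<psi> ` H"
  then obtain h g' where h: "h \<in> H" "x = \<psi> h" "g' \<in> carrier G" "g = \<psi> g'"
    using top_autD(3)[OF \<psi>] by blast
  then have "conjugation G g x = \<psi> (conjugation G g' h)" "conjugation G g' h \<in> H"
    using H by (auto simp: top_aut_conjugation[OF \<psi>] invariant_under_def)
  then show "conjugation G g x \<in> \<psi> ` H"
    by blast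
qed

lemma closed_normal_subset: "closed_normal_subgroup G T N \<Longrightarrow> N \<subseteq> carrier G"
  by (simp add: closed_normal_subgroup_iff closed_subgroup_subset)

lemma top_aut_closed_normal:
  "\<lbrakk>\<psi> \<in> top_aut G T; closed_normal_subgroup G T N\<rbrakk> \<Longrightarrow> closed_normal_subgroup G T (\<psi> ` N)"
  using closed_normal_subset[of N]
  by (simp add: closed_normal_subgroup_iff top_aut_closed_subgroup top_aut_invariant)

lemma top_aut_closed_normal_surj:
  assumes \<psi>: "\<psi> \<in> top_aut G T" and N: "closed_normal_subgroup G T N"
  obtains N' where "closed_normal_subgroup G T N'" "N = \<psi> ` N'"
proof -
  obtain \<phi> where \<phi>: "\<phi> \<in> top_aut G T" "\<forall>x\<in>carrier G. \<psi> (\<phi> x) = x"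
    "\<forall>x\<in>carrier G. \<phi> (\<psi> x) = x"
    using \<psi> by (blast elim: top_aut_inverse)
  have "\<psi> ` \<phi> ` N = (\<lambda>x. x) ` N"
    unfolding image_image by (rule image_cong) (use \<phi>(2) closed_normal_subset[OF N] in auto)
  then show thesis
    using that[OF top_aut_closed_normal[OF \<phi>(1) N]] by simp
qed

lemma top_aut_image_subset_iff:
  "\<lbrakk>\<psi> \<in> top_aut G T; X \<subseteq> carrier G; Y \<subseteq> carrier G\<rbrakk> \<Longrightarrow> \<psi> ` X \<subseteq> \<psi> ` Y \<longleftrightarrow> X \<subseteq> Y"
  using top_autD(2) by (rule inj_on_image_subset_iff)

lemma top_aut_commutators_in_iff:
  assumes \<psi>: "\<psi> \<in> top_aut G T" and sub: "X \<subseteq> carrier G" "Y \<subseteq> carrier G" "Z \<subseteq> carrier G"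
  shows "commutators_in G (\<psi> ` X) (\<psi> ` Y) (\<psi> ` Z) \<longleftrightarrow> commutators_in G X Y Z"
proof -
  have "commutator G (\<psi> x) (\<psi> y) \<in> \<psi> ` Z \<longleftrightarrow> commutator G x y \<in> Z" if "x \<in> X" "y \<in> Y" for x y
  proof -
    have "x \<in> carrier G" "y \<in> carrier G"
      using that sub by auto
    then show ?thesis
      using inj_on_image_mem_iff[OF top_autD(2)[OF \<psi>] _ sub(3)]
      by (simp flip: top_aut_commutator[OF \<psi>])
  qed
  then show ?thesis
    by (simp add: commutators_in_def)
qed

lemma top_aut_factor_centralizer:
  assumes \<psi>: "\<psi> \<in> top_aut G T" and sub: "K \<subseteq> carrier G" "L \<subseteq> carrier G"
  shows "factor_centralizer G (\<psi> ` K, \<psi> ` L) = \<psi> ` factor_centralizer G (K, L)"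
proof -
  have *: "\<psi> c \<in> factor_centralizer G (\<psi> ` K, \<psi> ` L) \<longleftrightarrow> c \<in> factor_centralizer G (K, L)"
    if c: "c \<in> carrier G" for c
    using top_aut_commutators_in_iff[OF \<psi> _ sub, of "{c}"] c top_aut_closed[OF \<psi> c]
    by (simp add: factor_centralizer_eq centralizer_mod_def commutators_in_def)
  have "factor_centralizer G F \<subseteq> carrier G" for F
    by (auto simp: factor_centralizer_def)
  note carr = this
  show ?thesis
  proof (intro equalityI subsetI)
    fix y assume y: "y \<in> factor_centralizer G (\<psi> ` K, \<psi> ` L)"
    then obtain c where "c \<in> carrier G" "y = \<psi> c"
      using carr top_autD(3)[OF \<psi>] by blast
    with y * show "y \<in> \<psi> ` factor_centralizer G (K, L)"
      by blast
  qed (use * carr in blast)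
qed

lemma top_aut_chief:
  assumes \<psi>: "\<psi> \<in> top_aut G T" and F: "(K, L) \<in> nonabelian_chief_factors G T"
  shows "(\<psi> ` K, \<psi> ` L) \<in> nonabelian_chief_factors G T"
proof -
  interpret nonabelian_chief G T K L
    using nonabelian_chiefI[OF F] by simp
  have cn: "closed_normal_subgroup G T K" "closed_normal_subgroup G T L"
    using A_closed A_normal B_closed B_normal by (simp_all add: closed_normal_subgroup_iff)
  note cn' = top_aut_closed_normal[OF \<psi> cn(1)] top_aut_closed_normal[OF \<psi> cn(2)]
  note sub = closed_normal_subset[OF cn(1)] closed_normal_subset[OF cn(2)]
  have ps: "\<psi> ` X \<subset> \<psi> ` Y \<longleftrightarrow> X \<subset> Y" if "X \<subseteq> carrier G" "Y \<subseteq> carrier G" for X Y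
    using top_aut_image_subset_iff[OF \<psi>] that by (simp add: less_le_not_le)
  have "\<not> (\<exists>N. closed_normal_subgroup G T N \<and> \<psi> ` L \<subset> N \<and> N \<subset> \<psi> ` K)"
  proof
    assume "\<exists>N. closed_normal_subgroup G T N \<and> \<psi> ` L \<subset> N \<and> N \<subset> \<psi> ` K"
    then obtain N where N: "closed_normal_subgroup G T N" "\<psi> ` L \<subset> N" "N \<subset> \<psi> ` K"
      by blast
    then obtain N' where "closed_normal_subgroup G T N'" "N = \<psi> ` N'"
      using top_aut_closed_normal_surj[OF \<psi>] by blast
    then have "closed_normal_subgroup G T N'" "L \<subset> N'" "N' \<subset> K"
      using N ps sub closed_normal_subset by auto
    then show False
      using chief by (auto simp: chief_factor_def)
  qed
  then have "chief_factor G T (\<psi> ` K, \<psi> ` L)"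
    using cn' ps[OF sub(2,1)] B_psubset_A by (simp add: chief_factor_def normal_factor_def)
  moreover have "\<not> comm_group (factor_group G (\<psi> ` K) (\<psi> ` L))"
  proof -
    have "comm_group (factor_group G (\<psi> ` K) (\<psi> ` L)) \<longleftrightarrow> commutators_in G (\<psi> ` K) (\<psi> ` K) (\<psi> ` L)"
      using cn' B_subset_A
      by (intro comm_group_factor_group_iff)
        (auto simp: closed_normal_subgroup_def normal_imp_subgroup)
    then show ?thesis
      using nonabelian top_aut_commutators_in_iff[OF \<psi> sub(1) sub(1) sub(2)] by simp
  qed
  ultimately show ?thesis
    by (simp add: nonabelian_chief_factors_def)
qed

end

section \<open>Minimally covered blocks\<close>

context topological_group
begin

abbreviation "head \<equiv> nonabelian_head G T (carrier G) {\<one>}"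

lemma between_carrier_iff: "between G T (carrier G) {\<one>} P \<longleftrightarrow> closed_normal_subgroup G T P"
  by (auto simp: between_def closed_normal_subgroup_iff closed_subgroup_def subgroup.one_closed
      subgroup.mem_carrier)

text \<open>\<open>D\<close> is the largest closed normal subgroup that does not contain \<open>N\<close>, and \<open>N\<close> is the smallest one that
  is not contained in \<open>D\<close>. For a minimally covered block, \<open>D\<close> is its centralizer and \<open>N\<close> the smallest
  subgroup that covers it. As \<open>N\<close> and \<open>D\<close> determine each other, the order of blocks, given by
  centralizers, becomes inclusion of the subgroups \<open>N\<close>.\<close>

definition dual_pair :: "'a set \<Rightarrow> 'a set \<Rightarrow> bool" where
  "dual_pair N D \<longleftrightarrow> closed_normal_subgroup G T N \<and> closed_normal_subgroup G T D \<and>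
    (\<forall>P. closed_normal_subgroup G T P \<longrightarrow> (N \<subseteq> P \<longleftrightarrow> \<not> P \<subseteq> D))"

lemma dual_pairD:
  assumes "dual_pair N D"
  shows "closed_normal_subgroup G T N" "closed_normal_subgroup G T D" "\<not> N \<subseteq> D"
    "\<And>P. closed_normal_subgroup G T P \<Longrightarrow> N \<subseteq> P \<longleftrightarrow> \<not> P \<subseteq> D"
  using assms by (auto simp: dual_pair_def)

lemma dual_pair_subset_iff:
  assumes "dual_pair N D" "dual_pair N' D'"
  shows "D \<subseteq> D' \<longleftrightarrow> N \<subseteq> N'"
  using dual_pairD[OF assms(1)] dual_pairD[OF assms(2)] by (meson order_trans)

lemma dual_pair_image:
  assumes \<psi>: "\<psi> \<in> top_aut G T" and d: "dual_pair N D"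
  shows "dual_pair (\<psi> ` N) (\<psi> ` D)"
  unfolding dual_pair_def
proof (intro conjI allI impI)
  note D = dual_pairD[OF d]
  show "closed_normal_subgroup G T (\<psi> ` N)" "closed_normal_subgroup G T (\<psi> ` D)"
    using \<psi> D by (simp_all add: top_aut_closed_normal)
  fix P assume "closed_normal_subgroup G T P"
  then obtain P' where P': "closed_normal_subgroup G T P'" "P = \<psi> ` P'"
    using top_aut_closed_normal_surj[OF \<psi>] by blast
  then show "\<psi> ` N \<subseteq> P \<longleftrightarrow> \<not> P \<subseteq> \<psi> ` D"
    using D(4)[OF P'(1)] D(1,2) by (simp add: top_aut_image_subset_iff[OF \<psi>] closed_normal_subset)
qed

lemma block_centralizer_eqI:
  assumes "X \<noteq> {}" "\<And>F. F \<in> X \<Longrightarrow> factor_centralizer G F = D"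
  shows "block_centralizer G X = D"
proof -
  have "factor_centralizer G ` X = {D}"
    using assms by auto
  then show ?thesis
    by (simp add: block_centralizer_def)
qed

lemma block_centralizer_association:
  assumes F: "(K, L) \<in> nonabelian_chief_factors G T"
  shows "block_centralizer G (association G T `` {(K, L)}) = factor_centralizer G (K, L)"
proof (rule block_centralizer_eqI)
  show "association G T `` {(K, L)} \<noteq> {}"
    using associated_refl[OF F] F by (auto simp: association_def)
  show "factor_centralizer G F' = factor_centralizer G (K, L)"
    if F': "F' \<in> association G T `` {(K, L)}" for F'
  proof -
    obtain A B where "F' = (A, B)"
      by fastforce
    then show ?thesis
      using associated_factors(2)[OF F, of A B] F' by (simp add: association_def)
  qed
qed

lemma block_centralizer_action:
  assumes \<psi>: "\<psi> \<in> top_aut G T" and \<cc>: "\<cc> \<in> chief_blocks G T"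
  shows "block_centralizer G (block_action G T \<psi> \<cc>) = \<psi> ` block_centralizer G \<cc>"
proof -
  obtain K L where KL: "(K, L) \<in> nonabelian_chief_factors G T" "\<cc> = association G T `` {(K, L)}"
    using \<cc> by (rule chief_block_cases)
  have cent: "block_centralizer G \<cc> = factor_centralizer G (K, L)"
    unfolding KL(2) using KL(1) by (rule block_centralizer_association)
  show ?thesis
  proof (rule block_centralizer_eqI)
    have "(K, L) \<in> \<cc>"
      using KL associated_refl[OF KL(1)] by (simp add: association_def)
    moreover have "((\<psi> ` K, \<psi> ` L), (\<psi> ` K, \<psi> ` L)) \<in> association G T"
      using top_aut_chief[OF \<psi> KL(1)] associated_refl by (simp add: association_def)
    ultimately show "block_action G T \<psi> \<cc> \<noteq> {}"
      unfolding block_action_def by force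
  next
    fix F assume "F \<in> block_action G T \<psi> \<cc>"
    then obtain A B A' B' where AB: "(A, B) \<in> \<cc>" "((\<psi> ` A, \<psi> ` B), F) \<in> association G T" "F = (A', B')"
      by (cases F) (auto simp: block_action_def)
    then have as: "(\<psi> ` A, \<psi> ` B) \<in> nonabelian_chief_factors G T" "(A', B') \<in> nonabelian_chief_factors G T"
      "associated G T (\<psi> ` A, \<psi> ` B) (A', B')"
      by (auto simp: association_def)
    have AB': "(A, B) \<in> nonabelian_chief_factors G T" "associated G T (K, L) (A, B)"
      using AB(1) KL by (auto simp: association_def)
    interpret AB: nonabelian_chief G T A B
      using nonabelian_chiefI[OF AB'(1)] by simp
    have "factor_centralizer G F = factor_centralizer G (\<psi> ` A, \<psi> ` B)"
      using associated_factors(2)[OF as] AB(3) by simp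
    also have "\<dots> = \<psi> ` factor_centralizer G (A, B)"
      using \<psi> AB.A_subset AB.B_subset_A by (intro top_aut_factor_centralizer) auto
    also have "\<dots> = \<psi> ` block_centralizer G \<cc>"
      using associated_factors(2)[OF KL(1) AB'] cent by simp
    finally show "factor_centralizer G F = \<psi> ` block_centralizer G \<cc>" .
  qed
qed

text \<open>Let \<open>K / L\<close> be a representative. The subgroup \<open>N \<inter> K\<close> still covers the block: otherwise it would be central
  modulo \<open>L\<close>, hence contained in \<open>L\<close>, and \<open>[N, K] \<le> N \<inter> K\<close> would make \<open>N\<close> centralize \<open>K / L\<close>. So \<open>N \<le> K\<close>
  by minimality. If \<open>N\<close> were abelian modulo \<open>N \<inter> D \<le> L\<close>, then the centralizer of \<open>N\<close> in \<open>K\<close> modulo \<open>L\<close>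
  would contain \<open>N\<close> and so be all of \<open>K\<close>, again contradicting that \<open>N\<close> covers the block.\<close>

lemma min_chief_block_head:
  assumes \<cc>: "\<cc> \<in> min_chief_blocks G T"
  defines "D \<equiv> block_centralizer G \<cc>"
  obtains N where "dual_pair N D" "head N (N \<inter> D)"
proof -
  obtain K L where KL: "(K, L) \<in> nonabelian_chief_factors G T" "\<cc> = association G T `` {(K, L)}"
    using \<cc> chief_block_cases by (auto simp: min_chief_blocks_def)
  interpret nonabelian_chief G T K L
    using nonabelian_chiefI[OF KL(1)] by simp
  have D: "D = C"
    unfolding D_def KL(2) C_def using KL(1) by (rule block_centralizer_association)
  have DN: "closed_normal_subgroup G T D"
    using C_closed C_normal by (simp add: D closed_normal_subgroup_iff)
  obtain N where N: "closed_normal_subgroup G T N" "\<not> N \<subseteq> D"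
    and least: "\<And>P. \<lbrakk>closed_normal_subgroup G T P; \<not> P \<subseteq> D\<rbrakk> \<Longrightarrow> N \<subseteq> P"
    using \<cc> by (auto simp: min_chief_blocks_def minimally_covered_def covers_def D_def)
  have dual: "dual_pair N D"
    unfolding dual_pair_def using N least DN by (auto dest: order_trans)
  have NG: "N \<subseteq> carrier G"
    using N(1) by (rule closed_normal_subset)
  have Nsub: "closed_subgroup G T N" "subgroup N G" "invariant_under G (carrier G) N"
    using N(1) by (simp_all add: closed_normal_subgroup_iff closed_subgroup_def)
  have comm: "commutators_in G N K (N \<inter> K)"
  proof -
    have "commutators_in G N K N"
      using invariant_under_mono[OF Nsub(3) A_subset] Nsub(2) A_subset
      by (rule commutators_in_invariant_left)
    moreover have "commutators_in G N K K"
      using invariant_under_mono[OF A_normal NG] A_subgroup NG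
      by (rule commutators_in_invariant_right)
    ultimately show ?thesis
      by (simp add: commutators_in_def)
  qed
  have "\<not> N \<inter> K \<subseteq> D"
  proof
    assume "N \<inter> K \<subseteq> D"
    then have "N \<inter> K \<subseteq> L"
      using A_Int_C unfolding D by blast
    from commutators_in_mono[OF comm order_refl order_refl this] show False
      using N(2) by (simp add: D subset_C_iff NG)
  qed
  then have NK: "N \<subseteq> K"
    using least[of "N \<inter> K"] N(1) A_closed A_normal
    by (auto simp: closed_normal_subgroup_iff closed_subgroup_Int intro: invariant_under_Int)
  have nonab: "\<not> commutators_in G N N (N \<inter> D)"
  proof
    assume NN: "commutators_in G N N (N \<inter> D)"
    have "N \<inter> D \<subseteq> L"
      using NK A_Int_C unfolding D by blast
    from commutators_in_mono[OF NN order_refl order_refl this]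
    have NNL: "commutators_in G N N L" .
    define E where "E = centralizer_mod G K N L"
    have "E = L \<or> E = K"
    proof (rule no_intermediate)
      show "closed_subgroup G T E"
        unfolding E_def using A_closed B_closed invariant_under_mono[OF B_normal A_subset] NG
        by (rule closed_subgroup_centralizer_mod)
      show "invariant_under G (carrier G) E"
        unfolding E_def using subgroup_self A_normal Nsub(3) B_normal A_subset NG
        by (rule invariant_under_centralizer_mod)
      have "commutators_in G L N L"
        using invariant_under_mono[OF B_normal NG] B_subgroup NG
        by (rule commutators_in_invariant_left)
      then show "L \<subseteq> E"
        by (simp add: E_def subset_centralizer_mod_iff B_subset_A)
      show "E \<subseteq> K"
        by (auto simp: E_def centralizer_mod_def)
    qed
    moreover have "N \<subseteq> E"
      using NNL by (simp add: E_def subset_centralizer_mod_iff NK)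
    ultimately have "E = K"
      using N(2) B_subset_C unfolding D by auto
    then have "commutators_in G K N L"
      by (auto simp: E_def centralizer_mod_def commutators_in_def)
    from commutators_in_commute[OF this B_subgroup A_subset NG] show False
      using N(2) by (simp add: D subset_C_iff NG)
  qed
  have "head N (N \<inter> D)"
    unfolding nonabelian_head_def between_carrier_iff
  proof (intro conjI allI impI)
    show "closed_normal_subgroup G T N" "closed_normal_subgroup G T (N \<inter> D)"
      using N(1) DN between_Int unfolding between_carrier_iff[symmetric] by blast+
    show "N \<inter> D \<subset> N"
      using N(2) by auto
    show "P \<subseteq> N \<inter> D" if "closed_normal_subgroup G T P \<and> P \<subset> N" for P
      using that least[of P] by auto
    show "\<not> commutators_in G N N (N \<inter> D)"
      by (fact nonab)
  qed
  with dual show thesis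
    using that by blast
qed

text \<open>A closed normal subgroup \<open>P\<close> that does not contain \<open>N\<close> satisfies \<open>[P, N] \<le> P \<inter> N \<le> N0\<close>, so it centralizes
  \<open>N / N0\<close>.\<close>

lemma head_min_chief_block:
  assumes h: "head N N0"
  defines "\<dd> \<equiv> association G T `` {(N, N0)}"
  shows "\<dd> \<in> min_chief_blocks G T" "dual_pair N (block_centralizer G \<dd>)"
proof -
  note H = nonabelian_headD[OF h, unfolded between_carrier_iff]
  have "chief_factor G T (N, N0)"
    using H by (auto simp: chief_factor_def normal_factor_def)
  moreover have "\<not> comm_group (factor_group G N N0)"
    using comm_group_factor_group_iff[of N0 N] H
    by (auto simp: closed_normal_subgroup_def normal_imp_subgroup)
  ultimately have F: "(N, N0) \<in> nonabelian_chief_factors G T"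
    by (simp add: nonabelian_chief_factors_def)
  interpret nonabelian_chief G T N N0
    using nonabelian_chiefI[OF F] by simp
  have C: "block_centralizer G \<dd> = C"
    unfolding \<dd>_def C_def using F by (rule block_centralizer_association)
  have CN: "closed_normal_subgroup G T C"
    using C_closed C_normal by (simp add: closed_normal_subgroup_iff)
  have NC: "\<not> N \<subseteq> C"
    using H(4) by (simp add: subset_C_iff A_subset)
  have least: "N \<subseteq> P" if P: "closed_normal_subgroup G T P" "\<not> P \<subseteq> C" for P
  proof (rule ccontr)
    assume "\<not> N \<subseteq> P"
    then have "P \<inter> N \<subset> N"
      by auto
    moreover have "closed_normal_subgroup G T (P \<inter> N)"
      using P(1) H(1) between_Int unfolding between_carrier_iff[symmetric] by blast
    ultimately have PN: "P \<inter> N \<subseteq> N0"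
      using H(5) by blast
    have PG: "P \<subseteq> carrier G"
      using P(1) by (rule closed_normal_subset)
    have Psub: "subgroup P G" "invariant_under G (carrier G) P"
      using P(1) by (simp_all add: closed_normal_subgroup_iff closed_subgroup_def)
    have "commutators_in G P N P"
      using invariant_under_mono[OF Psub(2) A_subset] Psub(1) A_subset
      by (rule commutators_in_invariant_left)
    moreover have "commutators_in G P N N"
      using invariant_under_mono[OF A_normal PG] A_subgroup PG
      by (rule commutators_in_invariant_right)
    ultimately have "commutators_in G P N N0"
      using PN unfolding commutators_in_def by blast
    then show False
      using P(2) by (simp add: subset_C_iff PG)
  qed
  show "dual_pair N (block_centralizer G \<dd>)"
    unfolding dual_pair_def C using H(1) CN NC least by (auto dest: order_trans)
  have "\<dd> \<in> chief_blocks G T"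
    unfolding \<dd>_def chief_blocks_def using F by (rule quotientI)
  moreover have "minimally_covered G T \<dd>"
    unfolding minimally_covered_def covers_def C
    by (intro exI[of _ N] conjI allI impI H(1) NC least) simp_all
  ultimately show "\<dd> \<in> min_chief_blocks G T"
    by (simp add: min_chief_blocks_def)
qed

lemma min_chief_blocks_nonempty_iff: "min_chief_blocks G T \<noteq> {} \<longleftrightarrow> (\<exists>N N0. head N N0)"
  using min_chief_block_head head_min_chief_block(1) by blast

end

section \<open>Topologically characteristically simple groups\<close>

locale char_simple_group = topological_group +
  assumes char_simple: "top_char_simple G T"
    and closed_one: "closedin T {\<one>}"
begin

lemma nontrivial: "carrier G \<noteq> {\<one>}"
  using char_simple by (simp add: top_char_simple_def)

lemma closed_normal_one: "closed_normal_subgroup G T {\<one>}"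
  using closed_one
  by (auto simp: closed_normal_subgroup_iff closed_subgroup_def invariant_under_def conjugation_def triv_subgroup)

lemma one_subset: "closed_normal_subgroup G T P \<Longrightarrow> {\<one>} \<subseteq> P"
  by (simp add: closed_normal_subgroup_def normal_imp_subgroup subgroup.one_closed)

text \<open>Here \<open>I\<close> is the largest subgroup of \<open>E\<close> that is invariant under all automorphisms.\<close>

lemma char_core:
  assumes E: "closed_subgroup G T E"
  defines "I \<equiv> {x \<in> carrier G. \<forall>\<psi>\<in>top_aut G T. \<psi> x \<in> E}"
  shows "I = {\<one>} \<or> I = carrier G"
proof -
  have vim: "closed_subgroup G T {x \<in> carrier G. \<psi> x \<in> E}" if \<psi>: "\<psi> \<in> top_aut G T" for \<psi>
  proof -
    obtain \<phi> where \<phi>: "\<phi> \<in> top_aut G T" "\<forall>x\<in>carrier G. \<psi> (\<phi> x) = x"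
      "\<forall>x\<in>carrier G. \<phi> (\<psi> x) = x"
      using \<psi> by (blast elim: top_aut_inverse)
    have "{x \<in> carrier G. \<psi> x \<in> E} = \<phi> ` E"
    proof (intro equalityI subsetI)
      fix x assume "x \<in> {x \<in> carrier G. \<psi> x \<in> E}"
      then have "x = \<phi> (\<psi> x)" "\<psi> x \<in> E"
        using \<phi>(3) by auto
      then show "x \<in> \<phi> ` E"
        by blast
    next
      fix x assume "x \<in> \<phi> ` E"
      then show "x \<in> {x \<in> carrier G. \<psi> x \<in> E}"
        using \<phi> closed_subgroup_subset[OF E] top_aut_closed by (auto simp: subset_iff)
    qed
    then show ?thesis
      using top_aut_closed_subgroup[OF \<phi>(1) E] by simp
  qed
  have "I = \<Inter>((\<lambda>\<psi>. {x \<in> carrier G. \<psi> x \<in> E}) ` top_aut G T)"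
    using top_aut_id by (auto simp: I_def)
  then have closed: "closed_subgroup G T I"
    using closed_subgroup_Inter[of "(\<lambda>\<psi>. {x \<in> carrier G. \<psi> x \<in> E}) ` top_aut G T"] vim top_aut_id
    by auto
  have sub: "\<phi> ` I \<subseteq> I" if \<phi>: "\<phi> \<in> top_aut G T" for \<phi>
    using \<phi> top_aut_comp[OF _ \<phi>] top_aut_closed[OF \<phi>] by (auto simp: I_def)
  have "\<phi> ` I = I" if \<phi>: "\<phi> \<in> top_aut G T" for \<phi>
  proof (intro equalityI sub[OF \<phi>] subsetI)
    fix x assume x: "x \<in> I"
    obtain \<eta> where \<eta>: "\<eta> \<in> top_aut G T" "\<forall>x\<in>carrier G. \<phi> (\<eta> x) = x"
      "\<forall>x\<in>carrier G. \<eta> (\<phi> x) = x"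
      using \<phi> by (blast elim: top_aut_inverse)
    then have "\<eta> x \<in> I" "x = \<phi> (\<eta> x)"
      using sub[OF \<eta>(1)] x by (auto simp: I_def)
    then show "x \<in> \<phi> ` I"
      by blast
  qed
  then show ?thesis
    using char_simple closed by (simp add: top_char_simple_def)
qed

lemma closed_subgroup_containing_images:
  assumes E: "closed_subgroup G T E" and X: "X \<subseteq> carrier G" "\<not> X \<subseteq> {\<one>}"
    and sub: "\<And>\<psi>. \<psi> \<in> top_aut G T \<Longrightarrow> \<psi> ` X \<subseteq> E"
  shows "E = carrier G"
proof -
  have "X \<subseteq> {x \<in> carrier G. \<forall>\<psi>\<in>top_aut G T. \<psi> x \<in> E}"
    using X(1) sub by blast
  then have "{x \<in> carrier G. \<forall>\<psi>\<in>top_aut G T. \<psi> x \<in> E} = carrier G"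
    using char_core[OF E] X(2) by auto
  then have "\<forall>\<psi>\<in>top_aut G T. \<psi> x \<in> E" if "x \<in> carrier G" for x
    using that by blast
  from this[THEN bspec, OF _ top_aut_id] have "carrier G \<subseteq> E"
    by blast
  then show ?thesis
    using closed_subgroup_subset[OF E] by blast
qed

text \<open>The automorphic images of \<open>P\<close> generate a dense subgroup, so one of them escapes \<open>D\<close> and hence contains \<open>N\<close>.\<close>

lemma dual_pair_image_subset:
  assumes d: "dual_pair N D" and P: "closed_normal_subgroup G T P" "\<not> P \<subseteq> {\<one>}"
  obtains \<phi> where "\<phi> \<in> top_aut G T" "\<phi> ` N \<subseteq> P"
proof -
  note D = dual_pairD[OF d]
  have PG: "P \<subseteq> carrier G"
    using P(1) by (rule closed_normal_subset)
  have "D \<noteq> carrier G"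
    using D(1,3) closed_normal_subset by blast
  moreover have "closed_subgroup G T D"
    using D(2) by (simp add: closed_normal_subgroup_iff)
  ultimately obtain \<psi> where \<psi>: "\<psi> \<in> top_aut G T" "\<not> \<psi> ` P \<subseteq> D"
    using closed_subgroup_containing_images[OF _ PG P(2)] by blast
  then have "N \<subseteq> \<psi> ` P"
    using D(4) top_aut_closed_normal[OF \<psi>(1) P(1)] by blast
  obtain \<phi> where \<phi>: "\<phi> \<in> top_aut G T" "\<forall>x\<in>carrier G. \<psi> (\<phi> x) = x"
    "\<forall>x\<in>carrier G. \<phi> (\<psi> x) = x"
    using \<psi>(1) by (blast elim: top_aut_inverse)
  have "\<phi> ` N \<subseteq> \<phi> ` \<psi> ` P"
    using \<open>N \<subseteq> \<psi> ` P\<close> by (rule image_mono)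
  also have "\<dots> = (\<lambda>x. x) ` P"
    unfolding image_image by (rule image_cong) (use \<phi>(3) PG in auto)
  finally show thesis
    using that \<phi>(1) by simp
qed

text \<open>Given two minimally covered blocks with smallest covering subgroups \<open>N\<close> and \<open>N'\<close>, some automorphism moves
  \<open>N\<close> into any prescribed non-trivial closed normal subgroup. If \<open>N'\<close> has a non-trivial proper closed
  subgroup that is normal in the whole group, then \<open>N\<close> can be moved strictly below \<open>N'\<close>, as stacking type
  demands. If it has none, then \<open>N'\<close> is a head over the trivial group. Conversely, an image of a minimal
  \<open>N\<close> never lies strictly below \<open>N\<close>.\<close>

lemma stacking_iff:
  "stacking_type G T \<longleftrightarrow> (\<exists>N N0. head N N0) \<and> \<not> (\<exists>N. head N {\<one>})"
proof
  assume st: "stacking_type G T"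
  have "\<not> head N {\<one>}" for N
  proof
    assume h: "head N {\<one>}"
    define \<dd> where "\<dd> = association G T `` {(N, {\<one>})}"
    have \<dd>: "\<dd> \<in> min_chief_blocks G T" and dual: "dual_pair N (block_centralizer G \<dd>)"
      using head_min_chief_block[OF h] by (simp_all add: \<dd>_def)
    obtain \<psi> where \<psi>: "\<psi> \<in> top_aut G T" "block_less G (block_action G T \<psi> \<dd>) \<dd>"
      using st \<dd> by (auto simp: stacking_type_def)
    have "\<dd> \<in> chief_blocks G T"
      using \<dd> by (simp add: min_chief_blocks_def)
    then have less: "\<psi> ` block_centralizer G \<dd> \<subset> block_centralizer G \<dd>"
      using \<psi> by (auto simp: block_less_def block_le_def block_centralizer_action)
    note dual' = dual_pair_image[OF \<psi>(1) dual]
    have "\<psi> ` N \<subset> N"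
      using less dual_pair_subset_iff[OF dual' dual] dual_pair_subset_iff[OF dual dual']
      by (simp add: less_le_not_le)
    then have "\<psi> ` N \<subseteq> {\<one>}"
      using nonabelian_headD(5)[OF h, of "\<psi> ` N"] dual_pairD(1)[OF dual']
      by (simp add: between_carrier_iff)
    then show False
      using dual_pairD(2,3)[OF dual'] one_subset by blast
  qed
  moreover have "\<exists>N N0. head N N0"
    using st min_chief_blocks_nonempty_iff by (simp add: stacking_type_def)
  ultimately show "(\<exists>N N0. head N N0) \<and> \<not> (\<exists>N. head N {\<one>})"
    by blast
next
  assume a: "(\<exists>N N0. head N N0) \<and> \<not> (\<exists>N. head N {\<one>})"
  have "\<exists>\<psi>\<in>top_aut G T. block_less G (block_action G T \<psi> \<cc>) \<dd>"
    if \<cc>: "\<cc> \<in> min_chief_blocks G T" and \<dd>: "\<dd> \<in> min_chief_blocks G T" for \<cc> \<dd>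
  proof (rule ccontr)
    assume no: "\<not> (\<exists>\<psi>\<in>top_aut G T. block_less G (block_action G T \<psi> \<cc>) \<dd>)"
    obtain N where N: "dual_pair N (block_centralizer G \<cc>)"
      using min_chief_block_head[OF \<cc>] by blast
    obtain N' where N': "dual_pair N' (block_centralizer G \<dd>)"
      "head N' (N' \<inter> block_centralizer G \<dd>)"
      using min_chief_block_head[OF \<dd>] by blast
    note H = nonabelian_headD[OF N'(2), unfolded between_carrier_iff]
    have "\<cc> \<in> chief_blocks G T"
      using \<cc> by (simp add: min_chief_blocks_def)
    then have not_less: "\<not> \<psi> ` block_centralizer G \<cc> \<subset> block_centralizer G \<dd>"
      if "\<psi> \<in> top_aut G T" for \<psi>
      using no that by (auto simp: block_less_def block_le_def block_centralizer_action)
    have minimal: "P \<subseteq> {\<one>}" if P: "closed_normal_subgroup G T P" "P \<subset> N'" for P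
    proof (rule ccontr)
      assume "\<not> P \<subseteq> {\<one>}"
      then obtain \<phi> where \<phi>: "\<phi> \<in> top_aut G T" "\<phi> ` N \<subseteq> P"
        using dual_pair_image_subset[OF N P(1)] by blast
      note dual = dual_pair_image[OF \<phi>(1) N]
      have "\<phi> ` N \<subset> N'"
        using \<phi>(2) P(2) by blast
      then show False
        using not_less[OF \<phi>(1)] dual_pair_subset_iff[OF dual N'(1)]
          dual_pair_subset_iff[OF N'(1) dual] by (simp add: less_le_not_le)
    qed
    have "N' \<inter> block_centralizer G \<dd> = {\<one>}"
      using minimal[OF H(2,3)] one_subset[OF H(2)] by blast
    with N'(2) a show False
      by auto
  qed
  then show "stacking_type G T"
    using a char_simple min_chief_blocks_nonempty_iff by (auto simp: stacking_type_def)
qed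

lemma weak_iff: "weak_type G T \<longleftrightarrow> \<not> (\<exists>N N0. head N N0)"
  using char_simple min_chief_blocks_nonempty_iff by (auto simp: weak_type_def)

end

section \<open>Components\<close>

lemma center_restrictD:
  assumes "z \<in> center (G\<lparr>carrier := N\<rparr>)"
  shows "z \<in> N" "g \<in> N \<Longrightarrow> z \<otimes>\<^bsub>G\<^esub> g = g \<otimes>\<^bsub>G\<^esub> z"
  using assms by (simp_all add: center_def)

lemma (in group) center_eq: "center G = centralizer_mod G (carrier G) (carrier G) {\<one>}"
  by (auto simp: center_def centralizer_mod_def commutator_eq_one_iff)

lemma (in group) center_normal: "center G \<lhd> G"
proof -
  have "invariant_under G (carrier G) {\<one>}"
    by (auto simp: invariant_under_def conjugation_def)
  then show ?thesis
    unfolding center_eq normal_iff_invariant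
    by (intro conjI subgroup_centralizer_mod invariant_under_centralizer_mod subgroup_self
        invariant_under_self triv_subgroup order_refl)
qed

lemma (in group) commutator_restrict:
  "\<lbrakk>subgroup M G; x \<in> M; y \<in> M\<rbrakk> \<Longrightarrow> commutator (G\<lparr>carrier := M\<rparr>) x y = commutator G x y"
  by (simp add: commutator_def m_inv_consistent)

lemma (in group) comm_group_Mod_center_iff:
  "comm_group (G Mod center G) \<longleftrightarrow> commutators_in G (carrier G) (carrier G) (center G)"
  using comm_group_factor_group_iff[OF center_normal subgroup_self]
  by (simp add: factor_group_def center_def subset_iff)

context topological_group
begin

lemma closed_subgroup_closure:
  assumes S: "subgroup S G"
  shows "closed_subgroup G T (T closure_of S)"
proof -
  have SG: "S \<subseteq> carrier G"
    using S by (rule subgroup.subset)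
  let ?C = "T closure_of S"
  have CG: "?C \<subseteq> carrier G"
    using closure_of_subset_topspace[of T S] by (simp add: topspace_eq)
  have SC: "S \<subseteq> ?C"
    using SG by (intro closure_of_subset) (simp add: topspace_eq)
  have into: "f x \<in> ?C" if "continuous_map T T f" "f ` S \<subseteq> ?C" "x \<in> ?C" for f x
  proof -
    have "f x \<in> T closure_of (f ` S)"
      using continuous_map_image_closure_subset[OF that(1)] that(3) by blast
    also have "\<dots> \<subseteq> ?C"
      using that(2) by (intro closure_of_minimal) simp_all
    finally show ?thesis .
  qed
  have left: "x \<otimes> y \<in> ?C" if "x \<in> S" "y \<in> ?C" for x y
  proof (rule into[OF _ _ that(2)])
    show "continuous_map T T (\<lambda>y. x \<otimes> y)"
      using that SG by (intro continuous_mult_map continuous_const continuous_id) auto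
    show "(\<lambda>y. x \<otimes> y) ` S \<subseteq> ?C"
      using that(1) SC subgroup.m_closed[OF S] by blast
  qed
  have "subgroup ?C G"
  proof (rule subgroupI)
    show "?C \<subseteq> carrier G" by (fact CG)
    show "?C \<noteq> {}"
      using SC subgroup.one_closed[OF S] by blast
    show "inv a \<in> ?C" if "a \<in> ?C" for a
    proof (rule into[OF continuous_inv _ that])
      show "(\<lambda>x. inv x) ` S \<subseteq> ?C"
        using SC subgroup.m_inv_closed[OF S] by blast
    qed
    show "a \<otimes> b \<in> ?C" if "a \<in> ?C" "b \<in> ?C" for a b
    proof (rule into[OF _ _ that(1)])
      show "continuous_map T T (\<lambda>x. x \<otimes> b)"
        using that CG by (intro continuous_mult_map continuous_const continuous_id) auto
      show "(\<lambda>x. x \<otimes> b) ` S \<subseteq> ?C"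
        using left that(2) by blast
    qed
  qed
  then show ?thesis
    by (simp add: closed_subgroup_def)
qed

lemma closed_normal_closure:
  assumes "M \<subseteq> carrier G"
  shows "closed_normal_subgroup G T (closed_normal_closure G T M)"
proof -
  have "closed_normal_subgroup G T (carrier G)"
    by (simp add: closed_normal_subgroup_iff closed_subgroup_carrier invariant_under_self subgroup_self)
  then have "between G T (carrier G) {\<one>} (\<Inter>{N. closed_normal_subgroup G T N \<and> M \<subseteq> N})"
    using assms by (intro between_Inter) (auto simp: between_carrier_iff)
  then show ?thesis
    by (simp add: between_carrier_iff closed_normal_closure_def)
qed

lemma closed_normal_closure_superset: "M \<subseteq> closed_normal_closure G T M"
  by (auto simp: closed_normal_closure_def)

lemma closed_normal_closure_least:
  "\<lbrakk>closed_normal_subgroup G T N; M \<subseteq> N\<rbrakk> \<Longrightarrow> closed_normal_closure G T M \<subseteq> N"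
  by (auto simp: closed_normal_closure_def)

lemma closed_normal_subgroupD:
  assumes "closed_normal_subgroup G T N"
  shows "closed_subgroup G T N" "subgroup N G" "invariant_under G (carrier G) N" "N \<subseteq> carrier G"
  using assms closed_normal_subset by (auto simp: closed_normal_subgroup_iff closed_subgroup_def)

text \<open>As \<open>M\<close> is closed, its closed subsets are the closed subsets of the whole group that it contains.
  The notion of component can thus be stated without restricting groups and topologies.\<close>

lemma closed_normal_subgroup_restrict_iff:
  assumes M: "closed_subgroup G T M"
  shows "closed_normal_subgroup (G\<lparr>carrier := M\<rparr>) (subtopology T M) H \<longleftrightarrow>
    closed_subgroup G T H \<and> invariant_under G M H \<and> H \<subseteq> M"
proof -
  have Msub: "subgroup M G" and Mcl: "closedin T M"
    using M by (simp_all add: closed_subgroup_def)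
  interpret M: group "G\<lparr>carrier := M\<rparr>"
    using Msub by (rule subgroup_imp_group)
  have "subgroup H (G\<lparr>carrier := M\<rparr>) \<longleftrightarrow> subgroup H G \<and> H \<subseteq> M"
    using subgroup_incl[OF _ Msub, of H] incl_subgroup[OF Msub, of H] subgroup.subset[of H "G\<lparr>carrier := M\<rparr>"]
    by auto
  moreover have "invariant_under (G\<lparr>carrier := M\<rparr>) M H \<longleftrightarrow> invariant_under G M H"
    using Msub by (simp add: invariant_under_def conjugation_def m_inv_consistent)
  moreover have "closedin (subtopology T M) H \<longleftrightarrow> closedin T H \<and> H \<subseteq> M"
    using Mcl by (rule closedin_closed_subtopology)
  ultimately show ?thesis
    by (auto simp: closed_normal_subgroup_def M.normal_iff_invariant closed_subgroup_def)
qed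

lemma component_iff:
  assumes M: "closed_subgroup G T M"
  defines "N \<equiv> closed_normal_closure G T M"
  shows "component_of_group G T M \<longleftrightarrow> invariant_under G N M \<and>
    \<not> commutators_in G M M (center (G\<lparr>carrier := M\<rparr>)) \<and>
    (\<forall>H. closed_subgroup G T H \<and> invariant_under G M H \<and> H \<subset> M \<longrightarrow>
      H \<subseteq> center (G\<lparr>carrier := N\<rparr>))"
proof -
  have MG: "M \<subseteq> carrier G" and Msub: "subgroup M G"
    using M closed_subgroup_subset by (auto simp: closed_subgroup_def)
  have N: "closed_normal_subgroup G T N"
    unfolding N_def using MG by (rule closed_normal_closure)
  note ND = closed_normal_subgroupD[OF N]
  have MN: "M \<subseteq> N"
    unfolding N_def by (rule closed_normal_closure_superset)
  interpret M: group "G\<lparr>carrier := M\<rparr>"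
    using Msub by (rule subgroup_imp_group)
  interpret N: group "G\<lparr>carrier := N\<rparr>"
    using ND(2) by (rule subgroup_imp_group)
  have "M \<lhd> G\<lparr>carrier := N\<rparr> \<longleftrightarrow> invariant_under G N M"
    using subgroup_incl[OF Msub ND(2) MN] ND(2)
    by (simp add: N.normal_iff_invariant invariant_under_def conjugation_def m_inv_consistent)
  moreover have "comm_group ((G\<lparr>carrier := M\<rparr>) Mod center (G\<lparr>carrier := M\<rparr>)) \<longleftrightarrow>
      commutators_in G M M (center (G\<lparr>carrier := M\<rparr>))"
    using Msub by (simp add: M.comm_group_Mod_center_iff commutators_in_def commutator_restrict)
  ultimately show ?thesis
    using M unfolding component_of_group_def N_def[symmetric] closed_normal_subgroup_restrict_iff[OF M]
    by (auto simp: psubset_eq)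
qed

end

context char_simple_group
begin

text \<open>Minimality forces the intersection to be trivial, and commutators of normal subgroups lie in the
  intersection.\<close>

lemma distinct_minimal_heads_commute:
  assumes h: "head N {\<one>}" and h': "head N' {\<one>}" and ne: "N \<noteq> N'"
  shows "commutators_in G N N' {\<one>}"
proof -
  note H = nonabelian_headD[OF h, unfolded between_carrier_iff]
  note H' = nonabelian_headD[OF h', unfolded between_carrier_iff]
  note D = closed_normal_subgroupD[OF H(1)] and D' = closed_normal_subgroupD[OF H'(1)]
  have cap: "closed_normal_subgroup G T (N \<inter> N')"
    using H(1) H'(1) between_Int unfolding between_carrier_iff[symmetric] by blast
  have "N \<inter> N' \<subset> N \<or> N \<inter> N' \<subset> N'"
    using ne by auto
  then have "N \<inter> N' \<subseteq> {\<one>}"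
    using H(5)[OF cap] H'(5)[OF cap] by blast
  moreover have "commutators_in G N N' N" "commutators_in G N N' N'"
    using commutators_in_invariant_left[OF invariant_under_mono[OF D(3) D'(4)] D(2) D'(4)]
      commutators_in_invariant_right[OF invariant_under_mono[OF D'(3) D(4)] D'(2) D(4)] .
  ultimately show ?thesis
    unfolding commutators_in_def by blast
qed

lemma top_aut_head:
  assumes \<psi>: "\<psi> \<in> top_aut G T" and h: "head N {\<one>}"
  shows "head (\<psi> ` N) {\<one>}"
proof -
  note H = nonabelian_headD[OF h, unfolded between_carrier_iff]
  have NG: "N \<subseteq> carrier G"
    using H(1) by (rule closed_normal_subset)
  have one: "\<psi> ` {\<one>} = {\<one>}"
    using group_hom.hom_one[OF top_aut_group_hom[OF \<psi>]] by simp
  have ps: "\<psi> ` X \<subset> \<psi> ` Y \<longleftrightarrow> X \<subset> Y" if "X \<subseteq> carrier G" "Y \<subseteq> carrier G" for X Y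
    using top_aut_image_subset_iff[OF \<psi>] that by (simp add: less_le_not_le)
  show ?thesis
    unfolding nonabelian_head_def between_carrier_iff
  proof (intro conjI allI impI)
    show "closed_normal_subgroup G T (\<psi> ` N)"
      using \<psi> H(1) by (rule top_aut_closed_normal)
    show "closed_normal_subgroup G T {\<one>}"
      by (rule closed_normal_one)
    show "{\<one>} \<subset> \<psi> ` N"
      using H(3) ps[of "{\<one>}" N] NG one by simp
    show "\<not> commutators_in G (\<psi> ` N) (\<psi> ` N) {\<one>}"
      using H(4) top_aut_commutators_in_iff[OF \<psi> NG NG, of "{\<one>}"] one by simp
    fix P assume P: "closed_normal_subgroup G T P \<and> P \<subset> \<psi> ` N"
    then obtain P' where P': "closed_normal_subgroup G T P'" "P = \<psi> ` P'"
      using top_aut_closed_normal_surj[OF \<psi>] by blast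
    then have "P' \<subset> N"
      using P ps NG closed_normal_subset by simp
    then have "P' \<subseteq> {\<one>}"
      using H(5) P'(1) by blast
    then have "\<psi> ` P' \<subseteq> \<psi> ` {\<one>}"
      by (rule image_mono)
    then show "P \<subseteq> {\<one>}"
      using P'(2) one by simp
  qed
qed

text \<open>The point is that a closed subgroup \<open>S\<close> of \<open>N\<close> that is normal in \<open>N\<close> is normal in the whole group: \<open>N\<close>
  normalizes it, and the automorphic images of \<open>N\<close> other than \<open>N\<close> commute with \<open>N\<close>; together they
  generate a dense subgroup. So \<open>S\<close> is trivial or equal to \<open>N\<close> by minimality.\<close>

lemma head_component:
  assumes h: "head N {\<one>}"
  shows "component_of_group G T N"
proof -
  note H = nonabelian_headD[OF h, unfolded between_carrier_iff]
  note D = closed_normal_subgroupD[OF H(1)]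
  have hull: "closed_normal_closure G T N = N"
    using closed_normal_closure_superset closed_normal_closure_least[OF H(1)] by blast
  interpret N: group "G\<lparr>carrier := N\<rparr>"
    using D(2) by (rule subgroup_imp_group)
  have "centralizer_mod G N N {\<one>} \<subseteq> {\<one>}"
  proof (rule H(5))
    have "between G T (carrier G) {\<one>} (centralizer_mod G N N {\<one>})"
      unfolding between_def
    proof (intro conjI)
      show "closed_subgroup G T (centralizer_mod G N N {\<one>})"
        using D(1) closed_normal_subgroupD(1)[OF closed_normal_one] D(4)
          invariant_under_mono[OF closed_normal_subgroupD(3)[OF closed_normal_one] D(4)]
        by (intro closed_subgroup_centralizer_mod)
      show "invariant_under G (carrier G) (centralizer_mod G N N {\<one>})"
        using subgroup_self D(3) D(3) closed_normal_subgroupD(3)[OF closed_normal_one] D(4) D(4)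
        by (rule invariant_under_centralizer_mod)
      show "{\<one>} \<subseteq> centralizer_mod G N N {\<one>}"
        using one_subset[OF H(1)] D(4) by (auto simp: centralizer_mod_def commutator_eq_one_iff subset_iff)
      show "centralizer_mod G N N {\<one>} \<subseteq> carrier G"
        using D(4) by (auto simp: centralizer_mod_def)
    qed
    then show "closed_normal_subgroup G T (centralizer_mod G N N {\<one>})"
      by (simp add: between_carrier_iff)
    show "centralizer_mod G N N {\<one>} \<subset> N"
      using H(4) by (auto simp: centralizer_mod_def commutators_in_def)
  qed
  moreover have "center (G\<lparr>carrier := N\<rparr>) = centralizer_mod G N N {\<one>}"
    unfolding N.center_eq using D(2) by (auto simp: centralizer_mod_def commutator_restrict)
  ultimately have center: "center (G\<lparr>carrier := N\<rparr>) \<subseteq> {\<one>}"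
    by simp
  have trivial: "S \<subseteq> {\<one>}"
    if S: "closed_subgroup G T S" "invariant_under G N S" "S \<subset> N" for S
  proof -
    have "{g \<in> carrier G. \<forall>p\<in>S. conjugation G g p \<in> S \<and> conjugation G (inv g) p \<in> S} = carrier G" (is "?E = _")
    proof (rule closed_subgroup_containing_images)
      show "closed_subgroup G T ?E"
        using S(1) by (rule closed_subgroup_normalizer)
      show "N \<subseteq> carrier G" "\<not> N \<subseteq> {\<one>}"
        using D(4) H(3) by auto
      fix \<psi> assume \<psi>: "\<psi> \<in> top_aut G T"
      note h' = top_aut_head[OF \<psi> h]
      note D' = closed_normal_subgroupD[OF nonabelian_headD(1)[OF h', unfolded between_carrier_iff]]
      have "invariant_under G (\<psi> ` N) S"
      proof (cases "\<psi> ` N = N")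
        case True
        then show ?thesis
          using S(2) by simp
      next
        case False
        then have "commutators_in G (\<psi> ` N) N {\<one>}"
          using distinct_minimal_heads_commute[OF h' h] by simp
        then have "commutators_in G (\<psi> ` N) S S"
          using S(3) subgroup.one_closed[of S G] S(1)
          by (auto simp: commutators_in_def closed_subgroup_def)
        then show ?thesis
          using S(1) D'(4) by (intro invariant_under_commutators_in) (auto simp: closed_subgroup_def)
      qed
      then show "\<psi> ` N \<subseteq> ?E"
        using S(1) D'(2) by (intro invariant_imp_subset_normalizer)
    qed
    then have "invariant_under G (carrier G) S"
      by (auto simp: invariant_under_def)
    then show ?thesis
      using S H(5)[of S] by (simp add: closed_normal_subgroup_iff)
  qed
  have one: "{\<one>} \<subseteq> center (G\<lparr>carrier := N\<rparr>)"
    using D(2) D(4) by (auto simp: center_def subgroup.one_closed subset_iff)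
  show ?thesis
    unfolding component_iff[OF D(1)] hull
  proof (intro conjI allI impI)
    show "invariant_under G N N"
      using D(2) by (rule invariant_under_self)
    show "\<not> commutators_in G N N (center (G\<lparr>carrier := N\<rparr>))"
      using H(4) commutators_in_mono[OF _ order_refl order_refl center] by blast
    show "S \<subseteq> center (G\<lparr>carrier := N\<rparr>)"
      if "closed_subgroup G T S \<and> invariant_under G N S \<and> S \<subset> N" for S
      using trivial[of S] that one by blast
  qed
qed

text \<open>Under the hypothesis, \<open>m \<mapsto> [m, x]\<close> is a homomorphism from \<open>M\<close> to an abelian group. Its kernel \<open>S\<close> is
  closed, normal in \<open>M\<close> and contains the commutators of \<open>M\<close>. A proper kernel would be central by the
  definition of a component, which would make \<open>M\<close> modulo its centre abelian.\<close>

lemma component_centralizes: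
  assumes M: "component_of_group G T M"
  defines "N \<equiv> closed_normal_closure G T M"
  assumes x: "x \<in> carrier G" and central: "\<And>m. m \<in> M \<Longrightarrow> commutator G m x \<in> center (G\<lparr>carrier := N\<rparr>)"
  shows "\<forall>m\<in>M. commutator G m x = \<one>"
proof -
  have Mcl: "closed_subgroup G T M"
    using M by (simp add: component_of_group_def)
  have MG: "M \<subseteq> carrier G" and Msub: "subgroup M G"
    using Mcl closed_subgroup_subset by (auto simp: closed_subgroup_def)
  have MN: "M \<subseteq> N"
    unfolding N_def by (rule closed_normal_closure_superset)
  note comp = M[unfolded component_iff[OF Mcl], folded N_def]
  define S where "S = centralizer_mod G M {x} {\<one>}"
  have S: "S = {m \<in> M. commutator G m x = \<one>}"
    by (simp add: S_def centralizer_mod_def)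
  have S_closed: "closed_subgroup G T S"
    unfolding S_def using Mcl closed_normal_subgroupD(1)[OF closed_normal_one] x
      invariant_under_mono[OF closed_normal_subgroupD(3)[OF closed_normal_one] MG]
    by (intro closed_subgroup_centralizer_mod) auto
  have hom: "commutator G (a \<otimes> b) x = commutator G a x \<otimes> commutator G b x" if ab: "a \<in> M" "b \<in> M" for a b
  proof -
    have c: "a \<in> carrier G" "b \<in> carrier G"
      using ab MG by auto
    have "a \<in> N"
      using ab(1) MN by blast
    then have "a \<otimes> commutator G b x = commutator G b x \<otimes> a"
      using center_restrictD(2)[OF central[OF ab(2)]] by simp
    then have "conjugation G a (commutator G b x) = commutator G b x"
      using c x by (simp add: conjugation_def m_assoc)
    then have "commutator G (a \<otimes> b) x = commutator G b x \<otimes> commutator G a x"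
      using c x by (simp add: commutator_mult_left)
    also have "\<dots> = commutator G a x \<otimes> commutator G b x"
      using center_restrictD[OF central] ab by blast
    finally show ?thesis .
  qed
  have comm: "commutator G a x \<otimes> commutator G b x = commutator G b x \<otimes> commutator G a x" if "a \<in> M" "b \<in> M" for a b
    using center_restrictD[OF central] that by blast
  have Mm: "a \<otimes> b \<in> M" "inv a \<in> M" "a \<in> carrier G" "commutator G a b \<in> M" "conjugation G a b \<in> M"
    if "a \<in> M" "b \<in> M" for a b
    using that Msub MG by (auto simp: commutator_def conjugation_def subgroup.m_closed subgroup.m_inv_closed)
  have "invariant_under G M S"
    unfolding invariant_under_def
  proof (intro ballI)
    fix m s assume m: "m \<in> M" and s: "s \<in> S"
    then have sM: "s \<in> M"
      by (simp add: S)
    have "commutator G (conjugation G m s) x \<otimes> commutator G m x = commutator G (conjugation G m s \<otimes> m) x"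
      using m sM Mm by (simp add: hom)
    also have "conjugation G m s \<otimes> m = m \<otimes> s"
      using m sM Mm(3) by (simp add: conjugation_def m_assoc)
    also have "commutator G (m \<otimes> s) x = commutator G m x"
      using m sM s Mm(3) x by (simp add: hom S)
    finally show "conjugation G m s \<in> S"
      using m sM Mm x by (simp add: S)
  qed
  then have small: "S \<subseteq> center (G\<lparr>carrier := N\<rparr>)" if "S \<noteq> M"
    using comp S_closed that by (auto simp: S)
  have derived: "commutator G a b \<in> S" if ab: "a \<in> M" "b \<in> M" for a b
  proof -
    have "commutator G (commutator G a b) x \<otimes> commutator G (b \<otimes> a) x = commutator G (commutator G a b \<otimes> (b \<otimes> a)) x"
      using ab Mm by (simp add: hom)
    also have "commutator G a b \<otimes> (b \<otimes> a) = a \<otimes> b"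
      using ab Mm(3) by (simp add: commutator_def m_assoc)
    also have "commutator G (a \<otimes> b) x = commutator G (b \<otimes> a) x"
      using ab comm by (simp add: hom)
    finally show ?thesis
      using ab Mm x by (simp add: S)
  qed
  have "S = M"
  proof (rule ccontr)
    assume "S \<noteq> M"
    then have "commutators_in G M M (center (G\<lparr>carrier := M\<rparr>))"
      using small derived MN Mm(4) by (auto simp: commutators_in_def center_def subset_iff)
    then show False
      using comp by blast
  qed
  then show ?thesis
    by (auto simp: S)
qed

lemma closed_normal_centralizer:
  assumes K: "closed_normal_subgroup G T K"
  shows "closed_normal_subgroup G T (centralizer_mod G (carrier G) K {\<one>})"
  using closed_normal_subgroupD[OF K] closed_normal_subgroupD[OF closed_normal_one]
  unfolding closed_normal_subgroup_iff
  by (intro conjI closed_subgroup_centralizer_mod invariant_under_centralizer_mod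
      closed_subgroup_carrier subgroup_self invariant_under_self order_refl)

lemma component_closure_centralizes:
  assumes M: "component_of_group G T M"
  defines "N \<equiv> closed_normal_closure G T M"
  assumes K: "closed_normal_subgroup G T K"
    and central: "commutators_in G M K (center (G\<lparr>carrier := N\<rparr>))"
  shows "commutators_in G N K {\<one>}"
proof -
  have MG: "M \<subseteq> carrier G"
    using M closed_subgroup_subset by (simp add: component_of_group_def)
  note KD = closed_normal_subgroupD[OF K]
  have "commutator G m x = \<one>" if "m \<in> M" "x \<in> K" for m x
    using component_centralizes[OF M, of x] that KD(4) central
    unfolding N_def by (auto simp: commutators_in_def)
  then have "commutators_in G M K {\<one>}"
    by (simp add: commutators_in_def)
  then have "N \<subseteq> centralizer_mod G (carrier G) K {\<one>}"
    unfolding N_def using MG closed_normal_centralizer[OF K]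
    by (intro closed_normal_closure_least) (simp_all add: subset_centralizer_mod_iff)
  then show ?thesis
    by (auto simp: centralizer_mod_def commutators_in_def)
qed

lemma component_closure:
  assumes M: "component_of_group G T M"
  defines "N \<equiv> closed_normal_closure G T M"
  shows "closed_normal_subgroup G T N" "M \<subseteq> N" "closed_subgroup G T M"
proof -
  show "closed_subgroup G T M"
    using M by (simp add: component_of_group_def)
  then show "closed_normal_subgroup G T N"
    unfolding N_def by (intro closed_normal_closure closed_subgroup_subset)
  show "M \<subseteq> N"
    unfolding N_def by (rule closed_normal_closure_superset)
qed

text \<open>Here \<open>K \<inter> M\<close> is a proper closed normal subgroup of \<open>M\<close>, hence central in \<open>N\<close>, and it contains the
  commutators of \<open>K\<close> with \<open>M\<close>.\<close>

lemma component_closure_proper_central: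
  assumes M: "component_of_group G T M"
  defines "N \<equiv> closed_normal_closure G T M"
  assumes K: "closed_normal_subgroup G T K" and KN: "K \<subset> N"
  shows "commutators_in G N K {\<one>}"
  unfolding N_def
proof (rule component_closure_centralizes[OF M K])
  note MN = component_closure[OF M, folded N_def]
  have MG: "M \<subseteq> carrier G" and Msub: "subgroup M G"
    using MN(3) closed_subgroup_subset by (auto simp: closed_subgroup_def)
  note KD = closed_normal_subgroupD[OF K]
  note comp = M[unfolded component_iff[OF MN(3)], folded N_def]
  have "\<not> M \<subseteq> K"
    using closed_normal_closure_least[OF K, of M] KN unfolding N_def by blast
  moreover have "invariant_under G M (K \<inter> M)"
    using invariant_under_mono[OF KD(3) MG] invariant_under_self[OF Msub]
    by (rule invariant_under_Int)
  ultimately have cap: "K \<inter> M \<subseteq> center (G\<lparr>carrier := N\<rparr>)"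
    using comp closed_subgroup_Int[OF KD(1) MN(3)] by (simp add: psubset_eq) blast
  have "invariant_under G N M"
    using comp by blast
  then have "invariant_under G K M"
    by (rule invariant_under_mono) (use KN in blast)
  then have "commutators_in G M K M"
    using Msub KD(4) by (rule commutators_in_invariant_left)
  moreover have "commutators_in G M K K"
    using commutators_in_invariant_right[OF invariant_under_mono[OF KD(3) MG] KD(2) MG] .
  ultimately have "commutators_in G M K (K \<inter> M)"
    by (simp add: commutators_in_def)
  from commutators_in_mono[OF this order_refl order_refl cap]
  show "commutators_in G M K (center (G\<lparr>carrier := closed_normal_closure G T M\<rparr>))"
    unfolding N_def .
qed

lemma commutators_in_one_iff:
  "\<lbrakk>X \<subseteq> carrier G; Y \<subseteq> carrier G\<rbrakk> \<Longrightarrow>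
    commutators_in G X Y {\<one>} \<longleftrightarrow> (\<forall>x\<in>X. \<forall>y\<in>Y. x \<otimes> y = y \<otimes> x)"
  by (auto simp: commutators_in_def commutator_eq_one_iff subset_iff)

text \<open>The commutators lie in \<open>N \<inter> K\<close>, a proper closed normal subgroup of \<open>N\<close>, which is central in \<open>N\<close> by
  \<open>component_closure_proper_central\<close>. In particular, components with different closed normal closures commute.\<close>

lemma component_closure_commutes:
  assumes M: "component_of_group G T M"
  defines "N \<equiv> closed_normal_closure G T M"
  assumes K: "closed_normal_subgroup G T K" and NK: "\<not> N \<subseteq> K"
  shows "commutators_in G N K {\<one>}"
  unfolding N_def
proof (rule component_closure_centralizes[OF M K])
  note MN = component_closure[OF M, folded N_def]
  note ND = closed_normal_subgroupD[OF MN(1)] and KD = closed_normal_subgroupD[OF K]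
  have cap: "closed_normal_subgroup G T (N \<inter> K)"
    using MN(1) K between_Int unfolding between_carrier_iff[symmetric] by blast
  have "commutators_in G N (N \<inter> K) {\<one>}"
    using component_closure_proper_central[OF M cap, folded N_def] NK by blast
  then have central: "N \<inter> K \<subseteq> center (G\<lparr>carrier := N\<rparr>)"
    using ND(4) by (subst (asm) commutators_in_one_iff) (auto simp: center_def)
  have "commutators_in G N K N" "commutators_in G N K K"
    using commutators_in_invariant_left[OF invariant_under_mono[OF ND(3) KD(4)] ND(2) KD(4)]
      commutators_in_invariant_right[OF invariant_under_mono[OF KD(3) ND(4)] KD(2) ND(4)] .
  then have "commutators_in G N K (N \<inter> K)"
    by (simp add: commutators_in_def)
  from commutators_in_mono[OF this MN(2) order_refl central]
  show "commutators_in G M K (center (G\<lparr>carrier := closed_normal_closure G T M\<rparr>))"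
    unfolding N_def .
qed

text \<open>If \<open>N\<close> is a head over the trivial group, then its automorphic images are components and generate a dense
  subgroup. Conversely, let \<open>N\<close> be the closed normal closure of a component. A closed normal subgroup
  \<open>P\<close> that is properly contained in \<open>N\<close> commutes with \<open>N\<close> and with the closed normal closures of all
  other components, so it is central in the whole group. The centre is a proper characteristic subgroup,
  hence trivial, and \<open>N\<close> is minimal.\<close>

lemma semisimple_iff: "semisimple_type G T \<longleftrightarrow> (\<exists>N. head N {\<one>})"
proof
  assume "\<exists>N. head N {\<one>}"
  then obtain N where h: "head N {\<one>}"
    by blast
  let ?U = "\<Union>{M. component_of_group G T M}"
  have UG: "?U \<subseteq> carrier G"
    using closed_subgroup_subset by (auto simp: component_of_group_def)
  have cl: "closed_subgroup G T (T closure_of (generate G ?U))"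
    using generate_is_subgroup[OF UG] by (rule closed_subgroup_closure)
  have "generate G ?U \<subseteq> T closure_of (generate G ?U)"
    using generate_in_carrier[OF UG] by (intro closure_of_subset) (auto simp: topspace_eq)
  moreover have "?U \<subseteq> generate G ?U"
    by (rule subsetI) (rule generate.incl)
  ultimately have U: "?U \<subseteq> T closure_of (generate G ?U)"
    by (rule order_trans[rotated])
  have NG: "N \<subseteq> carrier G" "\<not> N \<subseteq> {\<one>}"
    using nonabelian_headD(1,3)[OF h] closed_normal_subset by (auto simp: between_carrier_iff)
  have "T closure_of (generate G ?U) = carrier G"
    by (rule closed_subgroup_containing_images[OF cl NG])
      (use U top_aut_head[OF _ h] head_component in blast)
  then show "semisimple_type G T"
    using char_simple by (simp add: semisimple_type_def)
next
  assume ss: "semisimple_type G T"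
  have all: "E = carrier G"
    if E: "closed_subgroup G T E" "\<And>M. component_of_group G T M \<Longrightarrow> M \<subseteq> E" for E
  proof -
    have "generate G (\<Union>{M. component_of_group G T M}) \<subseteq> E"
      using E by (intro generate_subgroup_incl) (auto simp: closed_subgroup_def)
    then have "T closure_of (generate G (\<Union>{M. component_of_group G T M})) \<subseteq> E"
      using E(1) by (intro closure_of_minimal) (simp_all add: closed_subgroup_def)
    then show ?thesis
      using ss closed_subgroup_subset[OF E(1)] by (auto simp: semisimple_type_def)
  qed
  obtain M where M: "component_of_group G T M"
    using all[OF closed_normal_subgroupD(1)[OF closed_normal_one]] nontrivial by blast
  define N where "N = closed_normal_closure G T M"
  note MN = component_closure[OF M, folded N_def]
  note ND = closed_normal_subgroupD[OF MN(1)]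
  have nonab: "\<not> commutators_in G N N {\<one>}"
  proof
    assume NN: "commutators_in G N N {\<one>}"
    have "{\<one>} \<subseteq> center (G\<lparr>carrier := M\<rparr>)"
      using MN(3) closed_subgroup_subset[OF MN(3)]
      by (auto simp: center_def closed_subgroup_def subgroup.one_closed subset_iff)
    from commutators_in_mono[OF NN MN(2) MN(2) this] show False
      using M by (simp add: component_iff[OF MN(3)])
  qed
  define Z where "Z = centralizer_mod G (carrier G) (carrier G) {\<one>}"
  have Z: "closed_subgroup G T Z"
    unfolding Z_def
    using closed_subgroup_carrier closed_normal_subgroupD(1,3)[OF closed_normal_one] order_refl
    by (rule closed_subgroup_centralizer_mod)
  have trivial: "P \<subseteq> {\<one>}" if P: "closed_normal_subgroup G T P" "P \<subset> N" for P
  proof (rule ccontr)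
    assume nontriv: "\<not> P \<subseteq> {\<one>}"
    note PD = closed_normal_subgroupD[OF P(1)]
    have NP: "commutators_in G N P {\<one>}"
      using component_closure_proper_central[OF M P(1)] P(2) by (simp add: N_def)
    have "centralizer_mod G (carrier G) P {\<one>} = carrier G"
    proof (rule all)
      show "closed_subgroup G T (centralizer_mod G (carrier G) P {\<one>})"
        using closed_normal_centralizer[OF P(1)] by (rule closed_normal_subgroupD)
      fix M' assume M': "component_of_group G T M'"
      define N' where "N' = closed_normal_closure G T M'"
      note MN' = component_closure[OF M', folded N'_def]
      have "commutators_in G N' P {\<one>}"
      proof (cases "N' \<subseteq> P")
        case True
        with P(2) have "N' \<subseteq> N"
          by blast
        from commutators_in_mono[OF NP this order_refl order_refl] show ?thesis .
      next
        case False
        then show ?thesis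
          using component_closure_commutes[OF M' P(1)] by (simp add: N'_def)
      qed
      then show "M' \<subseteq> centralizer_mod G (carrier G) P {\<one>}"
        using MN'(2) closed_subgroup_subset[OF MN'(3)]
        by (auto simp: centralizer_mod_def commutators_in_def)
    qed
    then have "P \<subseteq> Z"
      using PD(4) commutators_in_commute[of "carrier G" P "{\<one>}"] triv_subgroup
      unfolding Z_def by (auto simp: subset_centralizer_mod_iff[OF PD(4)] centralizer_mod_def commutators_in_def)
    have "Z = carrier G"
    proof (rule closed_subgroup_containing_images[OF Z PD(4) nontriv])
      fix \<psi> assume \<psi>: "\<psi> \<in> top_aut G T"
      have "commutators_in G P (carrier G) {\<one>}"
        using \<open>P \<subseteq> Z\<close> by (auto simp: Z_def centralizer_mod_def commutators_in_def)
      then have "commutators_in G (\<psi> ` P) (\<psi> ` carrier G) (\<psi> ` {\<one>})"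
        using PD(4) by (subst top_aut_commutators_in_iff[OF \<psi>]) auto
      moreover have "\<psi> ` {\<one>} = {\<one>}"
        using group_hom.hom_one[OF top_aut_group_hom[OF \<psi>]] by simp
      moreover have "\<psi> ` P \<subseteq> carrier G"
        using PD(4) top_aut_closed[OF \<psi>] by blast
      ultimately show "\<psi> ` P \<subseteq> Z"
        by (simp add: Z_def subset_centralizer_mod_iff top_autD(3)[OF \<psi>])
    qed
    then have "N \<subseteq> centralizer_mod G (carrier G) (carrier G) {\<one>}"
      using ND(4) by (simp add: Z_def)
    then show False
      using nonab ND(4) by (auto simp: centralizer_mod_def commutators_in_def)
  qed
  have "N \<noteq> {\<one>}"
    using nonab by (auto simp: commutators_in_def commutator_def)
  then have "head N {\<one>}"
    unfolding nonabelian_head_def between_carrier_iff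
    using MN(1) closed_normal_one nonab trivial one_subset[OF MN(1)] by blast
  then show "\<exists>N. head N {\<one>}"
    by blast
qed

end

section \<open>Types of chief factors\<close>

lemma (in nonabelian_chief) normal_section_A_B: "normal_section G T A B"
  using A_closed B_closed B_subset_A invariant_under_mono[OF B_normal A_subset]
  by unfold_locales

lemma (in nonabelian_chief) char_simple_group_factor:
  "char_simple_group (factor_group G A B) (factor_topology G T A B)"
proof -
  interpret S: normal_section G T A B
    by (rule normal_section_A_B)
  show ?thesis
    using S.topological_group_Q chief_factor_top_char_simple[OF chief] S.closed_one_Q
    by (simp add: char_simple_group_def char_simple_group_axioms_def)
qed

text \<open>The right-hand sides mention the representative only through \<open>M\<close> and \<open>C\<close>, which belong to the block.\<close>

lemma (in nonabelian_chief) type_iff: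
  defines "Q \<equiv> factor_group G A B" and "TQ \<equiv> factor_topology G T A B"
  shows "weak_type Q TQ \<longleftrightarrow> \<not> (\<exists>R R0. nonabelian_head G T M C R R0)"
    and "semisimple_type Q TQ \<longleftrightarrow> (\<exists>R. nonabelian_head G T M C R C)"
    and "stacking_type Q TQ \<longleftrightarrow>
      (\<exists>R R0. nonabelian_head G T M C R R0) \<and> \<not> (\<exists>R. nonabelian_head G T M C R C)"
proof -
  interpret S: normal_section G T A B
    by (rule normal_section_A_B)
  interpret Q: char_simple_group Q TQ
    unfolding Q_def TQ_def by (rule char_simple_group_factor)
  show "weak_type Q TQ \<longleftrightarrow> \<not> (\<exists>R R0. nonabelian_head G T M C R R0)"
    "semisimple_type Q TQ \<longleftrightarrow> (\<exists>R. nonabelian_head G T M C R C)"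
    "stacking_type Q TQ \<longleftrightarrow>
      (\<exists>R R0. nonabelian_head G T M C R R0) \<and> \<not> (\<exists>R. nonabelian_head G T M C R C)"
    using Q.weak_iff Q.semisimple_iff Q.stacking_iff ex_head_iff ex_minimal_head_iff
      S.ex_head_factor S.ex_minimal_head_factor
    unfolding Q_def TQ_def by simp_all
qed

theorem theorem1p19:
  fixes G :: "('a, 'b) monoid_scheme" and T :: "'a topology"
    and \<aa> :: "('a set \<times> 'a set) set" and A B A' B' :: "'a set"
  assumes "polish_group G T"
    and "\<aa> \<in> chief_blocks G T"
    and "(A, B) \<in> \<aa>"
    and "(A', B') \<in> \<aa>"
  shows "(weak_type (factor_group G A B) (factor_topology G T A B) \<longrightarrow>
          weak_type (factor_group G A' B') (factor_topology G T A' B')) \<and>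
         (semisimple_type (factor_group G A B) (factor_topology G T A B) \<longrightarrow>
          semisimple_type (factor_group G A' B') (factor_topology G T A' B')) \<and>
         (stacking_type (factor_group G A B) (factor_topology G T A B) \<longrightarrow>
          stacking_type (factor_group G A' B') (factor_topology G T A' B'))"
proof -
  interpret topological_group G T
    using assms(1) by (simp add: polish_group_def)
  note rep = chief_block_representatives[OF assms(2,3,4)]
  interpret F: nonabelian_chief G T A B
    by (rule rep(1))
  interpret F': nonabelian_chief G T A' B'
    using assms(2,4,3) by (rule chief_block_representatives(1))
  have "F.C = F'.C" "F.M = F'.M"
    using rep(2,3) by (simp_all add: F.C_def F'.C_def)
  then show ?thesis
    using F.type_iff F'.type_iff by simp
qed

end
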